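(* Let $\xi$ be a model and $h\ge0$. Then $$\min_{\phi\in\mathcal{C}}P_{h,\xi}(\phi)=\max_{\eta\in\mathcal{K}_{h,\xi}}D(\eta),$$ both extrema being attained. Furthermore, if $\phi$ is a minimizer of $P_{h,\xi}$ on $\mathcal{C}$ and $\eta$ a maximizer of $D$ on $\mathcal{K}_{h,\xi}$, then $\phi^2\,\eta''(dx)=dx$ as measures.
   Context: A model is $\xi(t)=\sum_{p\ge2}\beta_p^2t^p$, real $\beta_p$ not all zero, with $\xi(1+\epsilon)<\infty$ for some $\epsilon>0$. $\mathcal{C}$ is the set of $\phi\in C([0,1])$ with $\phi\ge0$, $\phi$ non-increasing and concave. $P_{h,\xi}(\phi)=\int_0^1\big(\xi''(x)\phi(x)+\frac1{\phi(x)}\big)dx+h^2\phi(0)\in[0,\infty]$. $\mathcal{K}_{h,\xi}$ is the set of convex $\eta\in C([0,1])$ with $\eta\ge\xi$ on $[0,1]$, $\eta(1)=\xi(1)$ and $\eta'(0)=\xi'(0)-h^2$, where $\eta'(0)=\lim_{t\to0^+}(\eta(t)-\eta(0))/t$. For such $\eta$, the distributional second derivative $\eta''$ is a nonnegative finite measure on $(0,1)$, regarded as a measure on $[0,1]$ giving no mass to $\{0,1\}$; $\eta''_{ac}$ denotes the density of its absolutely continuous part with respect to Lebesgue measure, and $D(\eta)=2\int_0^1\sqrt{\eta''_{ac}(x)}\,dx$. *)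

theory Defs
  imports "HOL-Analysis.Analysis"
begin

definition xi :: "(nat \<Rightarrow> real) \<Rightarrow> real \<Rightarrow> real" where
  "xi \<beta> t = (\<Sum>p. (if 2 \<le> p then (\<beta> p)\<^sup>2 * t ^ p else 0))"

definition is_model :: "(nat \<Rightarrow> real) \<Rightarrow> bool" where
  "is_model \<beta> \<longleftrightarrow> (\<exists>p\<ge>2. \<beta> p \<noteq> 0) \<and>
     (\<exists>\<epsilon>>0. summable (\<lambda>p. if 2 \<le> p then (\<beta> p)\<^sup>2 * (1 + \<epsilon>) ^ p else 0))"

definition classC :: "(real \<Rightarrow> real) set" where
  "classC = {\<phi>. continuous_on {0..1} \<phi> \<and> (\<forall>x\<in>{0..1}. 0 \<le> \<phi> x) \<and>
               (\<forall>x\<in>{0..1}. \<forall>y\<in>{0..1}. x \<le> y \<longrightarrow> \<phi> y \<le> \<phi> x) \<and>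
               concave_on {0..1} \<phi>}"

definition Pfun :: "real \<Rightarrow> (nat \<Rightarrow> real) \<Rightarrow> (real \<Rightarrow> real) \<Rightarrow> ennreal" where
  "Pfun h \<beta> \<phi> =
     (\<integral>\<^sup>+ x \<in> {0..1}. (ennreal (deriv (deriv (xi \<beta>)) x * \<phi> x)
                        + (if \<phi> x = 0 then \<infinity> else ennreal (1 / \<phi> x))) \<partial>lborel)
     + ennreal (h\<^sup>2 * \<phi> 0)"

definition has_right_deriv0 :: "(real \<Rightarrow> real) \<Rightarrow> real \<Rightarrow> bool" where
  "has_right_deriv0 \<eta> d \<longleftrightarrow> ((\<lambda>t. (\<eta> t - \<eta> 0) / t) \<longlongrightarrow> d) (at_right 0)"

definition classK :: "real \<Rightarrow> (nat \<Rightarrow> real) \<Rightarrow> (real \<Rightarrow> real) set" where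
  "classK h \<beta> = {\<eta>. continuous_on {0..1} \<eta> \<and> convex_on {0..1} \<eta> \<and>
                    (\<forall>x\<in>{0..1}. xi \<beta> x \<le> \<eta> x) \<and> \<eta> 1 = xi \<beta> 1 \<and>
                    has_right_deriv0 \<eta> (deriv (xi \<beta>) 0 - h\<^sup>2)}"

definition smooth_fun :: "(real \<Rightarrow> real) \<Rightarrow> bool" where
  "smooth_fun \<psi> \<longleftrightarrow> (\<forall>n x. ((deriv ^^ n) \<psi> has_real_derivative (deriv ^^ Suc n) \<psi> x) (at x))"

definition test_fun :: "(real \<Rightarrow> real) \<Rightarrow> bool" where
  "test_fun \<psi> \<longleftrightarrow> smooth_fun \<psi> \<and>
     (\<exists>a b. 0 < a \<and> b < 1 \<and> (\<forall>x. x \<notin> {a..b} \<longrightarrow> \<psi> x = 0))"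

definition is_second_deriv_measure :: "(real \<Rightarrow> real) \<Rightarrow> real measure \<Rightarrow> bool" where
  "is_second_deriv_measure \<eta> \<mu> \<longleftrightarrow>
     sets \<mu> = sets borel \<and> finite_measure \<mu> \<and> emeasure \<mu> (- {0<..<1}) = 0 \<and>
     (\<forall>\<psi>. test_fun \<psi> \<longrightarrow>
        (LINT x:{0..1}|lborel. \<eta> x * deriv (deriv \<psi>) x) = integral\<^sup>L \<mu> \<psi>)"

definition second_deriv_measure :: "(real \<Rightarrow> real) \<Rightarrow> real measure" where
  "second_deriv_measure \<eta> = (SOME \<mu>. is_second_deriv_measure \<eta> \<mu>)"

text \<open>f is (a version of) the density of the absolutely continuous part of mu w.r.t.
  Lebesgue measure (Lebesgue decomposition: mu = f dx + singular part carried by a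
  Lebesgue-null set N).\<close>

definition is_ac_density :: "real measure \<Rightarrow> (real \<Rightarrow> real) \<Rightarrow> bool" where
  "is_ac_density \<mu> f \<longleftrightarrow> f \<in> borel_measurable borel \<and> (\<forall>x. 0 \<le> f x) \<and>
     (\<exists>N \<in> null_sets lborel. \<forall>A \<in> sets borel.
        emeasure \<mu> A = (\<integral>\<^sup>+ x \<in> A. ennreal (f x) \<partial>lborel) + emeasure \<mu> (A \<inter> N))"

definition ac_density :: "(real \<Rightarrow> real) \<Rightarrow> real \<Rightarrow> real" where
  "ac_density \<eta> = (SOME f. is_ac_density (second_deriv_measure \<eta>) f)"

definition Dfun :: "(real \<Rightarrow> real) \<Rightarrow> real" where
  "Dfun \<eta> = 2 * (LINT x:{0..1}|lborel. sqrt (ac_density \<eta> x))"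

end

theory Submission
  imports Defs "HOL-Complex_Analysis.Great_Picard"
begin

text \<open>
  Write \<open>A \<phi>\<close> for the part of \<open>P\<close> that is linear in \<open>\<phi>\<close>. Every \<open>\<phi>\<close> in \<open>\<C>\<close> is a limit of nonnegative
  mixtures of constants and tents \<open>min (1 - s) (1 - x)\<close>, and for \<open>\<eta>\<close> in \<open>\<K>\<close> the tents satisfy
  \<open>\<integral> tent s d\<eta>'' = \<xi> 1 - \<eta> s + h\<^sup>2 (1 - s) \<le> \<xi> 1 - \<xi> s + h\<^sup>2 (1 - s) = A (tent s)\<close>. Hence
  \<open>A \<phi> \<ge> \<integral> \<phi> d\<eta>''\<close>, and \<open>\<phi> f + 1 / \<phi> \<ge> 2 sqrt f\<close> for the density \<open>f\<close> of \<open>\<eta>''\<close> gives \<open>P \<phi> \<ge> D \<eta>\<close>; equality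
  forces \<open>\<phi>\<^sup>2 f = 1\<close> and \<open>\<phi> = 0\<close> almost everywhere for the singular part, which is \<open>\<phi>\<^sup>2 \<eta>'' = dx\<close>.

  A minimizer \<open>\<phi>\<close> exists because \<open>P\<close> controls \<open>\<phi> 0\<close> and is lower semicontinuous under pointwise
  convergence on \<open>[0, 1)\<close>. Perturbing it to \<open>\<phi> + \<epsilon> \<psi>\<close> gives \<open>\<integral> \<psi> / \<phi>\<^sup>2 \<le> A \<psi>\<close>, which for tents says that the
  \<open>\<eta>\<close> with \<open>\<eta>'' = dx / \<phi>\<^sup>2\<close>, \<open>\<eta> 1 = \<xi> 1\<close> and \<open>\<eta>' 0 = - h\<^sup>2\<close> lies above \<open>\<xi>\<close>. Rescaling \<open>\<phi>\<close> gives
  \<open>A \<phi> \<le> \<integral> 1 / \<phi>\<close>, so \<open>D \<eta> = 2 \<integral> 1 / \<phi> \<ge> P \<phi>\<close>.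
\<close>

text \<open>Boundary behaviour shapes the proof. A member of \<open>classC\<close> may have infinite
  slope at 1, as sqrt (1 - x) does, and then it is no mixture of tents of finite total weight;
  dilating it makes the slope finite, and the dilation is undone by a limit under integrals against
  finite measures. On the open interval constants are limits of steep tents, so inequalities for
  tents are enough. On the dual side, \<eta> \<ge> \<xi> with contact at 1 bounds the slopes of
  \<eta> there, and the prescribed slope does so at 0, so that \<eta>'' is finite. Minimizing
  sequences may jump at 1 in the limit, which is why they are followed on [0, 1) only.
  \<open>second_deriv_measure\<close> and \<open>ac_density\<close> are Hilbert choices. Testing
  against smooth functions determines the first uniquely; the second is determined almost
  everywhere, which suffices because it occurs under integrals only. Estimates that may involve
  infinite values are written as sums of nonnegative terms in \<open>ennreal\<close>; a term is
  cancelled only after it is known to be finite.\<close>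

section \<open>Uniqueness of the distributional second derivative\<close>

text \<open>For p = 1 this is the standard smooth function that is flat at 0; polynomials in 1 / x
  are exactly what differentiation produces in front of the exponential.\<close>

definition flat :: "real poly \<Rightarrow> real \<Rightarrow> real" where
  "flat p x = (if 0 < x then poly p (1 / x) * exp (- (1 / x)) else 0)"

lemma poly_times_exp_tendsto_0: "((\<lambda>y::real. poly p y * exp (- y)) \<longlongrightarrow> 0) at_top"
proof -
  \<comment> \<open>The extra power carries the induction: \<open>pCons a p\<close> splits into a
    monomial and \<open>p\<close> with exponent \<open>Suc n\<close>.\<close>
  have "((\<lambda>y::real. y ^ n * poly p y * exp (- y)) \<longlongrightarrow> 0) at_top" for n
  proof (induction p arbitrary: n)
    case 0
    then show ?case by simp
  next
    case (pCons a p)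
    have "((\<lambda>y::real. a * (y ^ n / exp y) + y ^ Suc n * poly p y * exp (- y)) \<longlongrightarrow> a * 0 + 0) at_top"
      by (intro tendsto_intros tendsto_power_div_exp_0 pCons.IH)
    then show ?case
      by (simp add: algebra_simps exp_minus divide_inverse)
  qed
  from this[of 0] show ?thesis by simp
qed

text \<open>For x > 0 both the polynomial and the exponential contribute a factor 1 / x^2, which is
  the factor \<open>[:0, 0, 1:]\<close>. At 0 the right difference quotient is again a polynomial in
  1 / h times exp (- 1 / h), hence tends to 0.\<close>

lemma has_derivative_flat:
  "(flat p has_real_derivative flat ([:0, 0, 1:] * (p - pderiv p)) x) (at x)"
proof (cases x "0::real" rule: linorder_cases)
  case less
  have "((\<lambda>x. 0) has_real_derivative 0) (at x)" by simp
  then have "(flat p has_real_derivative 0) (at x)"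
    by (rule has_field_derivative_transform_within_open[where S = "{..<0}"])
       (use less in \<open>auto simp: flat_def\<close>)
  with less show ?thesis by (simp add: flat_def)
next
  case equal
  have "((\<lambda>h. (flat p h - flat p 0) / h) \<longlongrightarrow> 0) (at_left 0)"
    by (rule tendsto_eventually) (auto simp: flat_def eventually_at_filter)
  moreover have "((\<lambda>h. (flat p h - flat p 0) / h) \<longlongrightarrow> 0) (at_right 0)"
  proof -
    have *: "((\<lambda>h::real. poly ([:0, 1:] * p) (inverse h) * exp (- inverse h)) \<longlongrightarrow> 0) (at_right 0)"
      by (rule filterlim_compose[OF poly_times_exp_tendsto_0 filterlim_inverse_at_top_right])
    show ?thesis
      by (rule Lim_transform_eventually[OF *])
         (auto simp: flat_def eventually_at_filter divide_inverse intro!: always_eventually)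
  qed
  ultimately have "((\<lambda>h. (flat p h - flat p 0) / h) \<longlongrightarrow> 0) (at 0)"
    by (simp add: filterlim_at_split)
  with equal show ?thesis by (simp add: DERIV_def flat_def)
next
  case greater
  have "((\<lambda>x. poly p (1 / x) * exp (- (1 / x))) has_real_derivative
           flat ([:0, 0, 1:] * (p - pderiv p)) x) (at x)"
    using greater unfolding flat_def
    by (auto intro!: derivative_eq_intros simp: field_simps power2_eq_square)
  then show ?thesis
    by (rule has_field_derivative_transform_within_open[where S = "{0<..}"])
       (use greater in \<open>auto simp: flat_def\<close>)
qed

text \<open>A class of functions closed under differentiation consists of smooth functions; this one
  contains the bumps below.\<close>

inductive flat_algebra :: "(real \<Rightarrow> real) \<Rightarrow> bool" where
  base: "flat_algebra (\<lambda>x. flat p (c * x + d))"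
| add: "flat_algebra f \<Longrightarrow> flat_algebra g \<Longrightarrow> flat_algebra (\<lambda>x. f x + g x)"
| mult: "flat_algebra f \<Longrightarrow> flat_algebra g \<Longrightarrow> flat_algebra (\<lambda>x. f x * g x)"

lemma flat_algebra_derivative:
  "flat_algebra f \<Longrightarrow> \<exists>g. flat_algebra g \<and> (\<forall>x. (f has_real_derivative g x) (at x))"
proof (induction rule: flat_algebra.induct)
  case (base p c d)
  let ?q = "[:0, 0, 1:] * (p - pderiv p)"
  have "((\<lambda>x. flat p (c * x + d)) has_real_derivative flat (smult c ?q) (c * x + d)) (at x)" for x
  proof -
    have "((\<lambda>x. c * x + d) has_real_derivative c) (at x)"
      by (auto intro!: derivative_eq_intros)
    from DERIV_chain2[OF has_derivative_flat[of p "c * x + d"] this]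
    show ?thesis by (auto simp: flat_def mult_ac split: if_splits)
  qed
  then show ?case
    using flat_algebra.base by blast
next
  case (add f g)
  then obtain f' g' where "flat_algebra f'" "flat_algebra g'"
    "\<forall>x. (f has_real_derivative f' x) (at x)" "\<forall>x. (g has_real_derivative g' x) (at x)"
    by blast
  then show ?case
    by (intro exI[of _ "\<lambda>x. f' x + g' x"]) (auto intro: flat_algebra.add DERIV_add)
next
  case (mult f g)
  then obtain f' g' where *: "flat_algebra f'" "flat_algebra g'"
    "\<forall>x. (f has_real_derivative f' x) (at x)" "\<forall>x. (g has_real_derivative g' x) (at x)"
    by blast
  then show ?case
    using mult.hyps
    by (intro exI[of _ "\<lambda>x. f' x * g x + g' x * f x"])
       (auto intro: flat_algebra.add flat_algebra.mult DERIV_mult)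
qed

lemma flat_algebra_smooth:
  assumes "flat_algebra f" shows "smooth_fun f"
proof -
  have alg: "flat_algebra ((deriv ^^ n) f)" for n
  proof (induction n)
    case (Suc n)
    then obtain g where "flat_algebra g" "\<forall>x. ((deriv ^^ n) f has_real_derivative g x) (at x)"
      using flat_algebra_derivative by blast
    moreover from this(2) have "deriv ((deriv ^^ n) f) = g"
      by (auto intro: DERIV_imp_deriv)
    ultimately show ?case by simp
  qed (use assms in simp)
  show ?thesis
    unfolding smooth_fun_def
  proof (intro allI)
    fix n x
    obtain g where "\<forall>x. ((deriv ^^ n) f has_real_derivative g x) (at x)"
      using flat_algebra_derivative[OF alg] by blast
    then have "deriv ((deriv ^^ n) f) = g" "((deriv ^^ n) f has_real_derivative g x) (at x)"
      by (auto intro: DERIV_imp_deriv)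
    then show "((deriv ^^ n) f has_real_derivative (deriv ^^ Suc n) f x) (at x)"
      by simp
  qed
qed

text \<open>A smooth approximation of the indicator of the interval from \<open>a\<close> to 1. The
  shifts by -1 keep the support at distance 1 / k from both ends, as \<open>test_fun\<close>
  demands.\<close>

definition bump :: "real \<Rightarrow> nat \<Rightarrow> real \<Rightarrow> real" where
  "bump a k x = flat 1 (real k * (x - a) - 1) * flat 1 (real k * (1 - x) - 1)"

lemma test_fun_bump:
  assumes "0 \<le> a" "0 < k" shows "test_fun (bump a k)"
proof -
  have "bump a k = (\<lambda>x. flat 1 (real k * x + (- real k * a - 1)) * flat 1 (- real k * x + (real k - 1)))"
    by (auto simp: bump_def algebra_simps fun_eq_iff)
  moreover have "flat_algebra \<dots>"
    by (intro flat_algebra.intros)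
  ultimately have "smooth_fun (bump a k)"
    by (simp add: flat_algebra_smooth)
  moreover have "\<forall>x. x \<notin> {a + 1 / k .. 1 - 1 / k} \<longrightarrow> bump a k x = 0"
  proof (intro allI impI)
    fix x assume that: "x \<notin> {a + 1 / k .. 1 - 1 / k}"
    have "real k * (x - a) - 1 \<le> 0 \<or> real k * (1 - x) - 1 \<le> 0"
      using that assms by (auto simp: field_simps)
    then show "bump a k x = 0" by (auto simp: bump_def flat_def)
  qed
  moreover have "0 < a + 1 / k" "1 - 1 / k < (1::real)"
    using assms by (auto simp: add_nonneg_pos)
  ultimately show ?thesis
    unfolding test_fun_def
    by (intro conjI exI[of _ "a + 1 / k"] exI[of _ "1 - 1 / k"])
qed

lemma flat_1_bounds: "0 \<le> flat 1 x" "flat 1 x \<le> 1"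
  by (auto simp: flat_def)

lemma bump_bounds: "0 \<le> bump a k x" "bump a k x \<le> 1"
  using flat_1_bounds by (auto simp: bump_def mult_le_one)

lemma flat_1_tendsto:
  assumes "0 < c"
  shows "(\<lambda>k. flat 1 (real k * c - 1)) \<longlonglongrightarrow> 1"
proof -
  have lim: "filterlim (\<lambda>k. real k * c - 1) at_top sequentially"
    using assms by (intro filterlim_tendsto_add_at_top[where f = "\<lambda>_. -1" and c = "-1", simplified]
        filterlim_at_top_mult_tendsto_pos[where f = "\<lambda>_. c" and c = c] filterlim_real_sequentially)
       (auto simp: mult.commute)
  have "((\<lambda>y::real. exp (- (1 / y))) \<longlongrightarrow> exp (- 0)) at_top"
    by (intro tendsto_intros tendsto_divide_0[OF tendsto_const] filterlim_at_top_imp_at_infinity filterlim_ident)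
  moreover have "\<forall>\<^sub>F y in at_top. exp (- (1 / y)) = flat 1 y"
    using eventually_gt_at_top[of 0] by eventually_elim (auto simp: flat_def)
  ultimately have "(flat 1 \<longlongrightarrow> 1) at_top"
    using Lim_transform_eventually by fastforce
  from filterlim_compose[OF this lim] show ?thesis .
qed

lemma bump_tendsto:
  "(\<lambda>k. bump a (Suc k) x) \<longlonglongrightarrow> indicator ({a<..<1}) x"
proof (cases "a < x \<and> x < 1")
  case True
  have "(\<lambda>k. bump a k x) \<longlonglongrightarrow> 1 * 1"
    unfolding bump_def using True by (intro tendsto_mult flat_1_tendsto) auto
  from LIMSEQ_Suc[OF this] True show ?thesis by simp
next
  case False
  have "bump a (Suc k) x = 0" for k
  proof -
    have "real (Suc k) * (x - a) \<le> 0 \<or> real (Suc k) * (1 - x) \<le> 0"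
      using False by (auto simp only: mult_le_0_iff not_less)
    then show ?thesis by (auto simp: bump_def flat_def)
  qed
  with False show ?thesis by simp
qed

lemma bump_measurable [measurable]: "bump a k \<in> borel_measurable borel"
  unfolding bump_def flat_def by (intro borel_measurable_times measurable_If) (auto)

text \<open>Rays determine a Borel measure that is finite on them. Up to a null set each ray is an
  interval \<open>{a<..<1}\<close> with a \<ge> 0, whose indicator is a bounded limit of
  bumps.\<close>

lemma finite_measures_eqI_test_fun:
  fixes \<mu> \<nu> :: "real measure"
  assumes "finite_measure \<mu>" "finite_measure \<nu>" "sets \<mu> = sets borel" "sets \<nu> = sets borel"
    and "emeasure \<mu> (- {0<..<1}) = 0" "emeasure \<nu> (- {0<..<1}) = 0"
    and eq: "\<And>\<psi>. test_fun \<psi> \<Longrightarrow> integral\<^sup>L \<mu> \<psi> = integral\<^sup>L \<nu> \<psi>"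
  shows "\<mu> = \<nu>"
proof (rule measure_eqI_lessThan)
  interpret mu: finite_measure \<mu> by fact
  interpret nu: finite_measure \<nu> by fact
  note [measurable_cong] = assms(3,4)
  show "emeasure \<mu> {x<..} < \<infinity>" for x
    using mu.emeasure_finite[of "{x<..}"] by (simp add: less_top[symmetric])
  fix x :: real
  define a where "a = max 0 x"
  have lim: "(\<lambda>k. integral\<^sup>L M (bump a (Suc k))) \<longlonglongrightarrow> measure M {a<..<1}"
    if "finite_measure M" and [measurable_cong]: "sets M = sets borel" for M
  proof -
    interpret finite_measure M by fact
    have "(\<lambda>k. integral\<^sup>L M (bump a (Suc k))) \<longlonglongrightarrow> integral\<^sup>L M (indicator {a<..<1})"
      by (rule integral_dominated_convergence[where w = "\<lambda>_. 1"])
         (use bump_bounds in \<open>auto simp: bump_tendsto\<close>)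
    then show ?thesis using that sets_eq_imp_space_eq[OF that(2)] by simp
  qed
  have "integral\<^sup>L \<mu> (bump a (Suc k)) = integral\<^sup>L \<nu> (bump a (Suc k))" for k
    by (intro eq test_fun_bump) (auto simp: a_def)
  then have "measure \<mu> {a<..<1} = measure \<nu> {a<..<1}"
    using lim[of \<mu>] lim[of \<nu>] assms(1-4) LIMSEQ_unique by simp
  then have "emeasure \<mu> {a<..<1} = emeasure \<nu> {a<..<1}"
    by (simp add: mu.emeasure_eq_measure nu.emeasure_eq_measure)
  moreover have "emeasure M {x<..} = emeasure M {a<..<1}"
    if "emeasure M (- {0<..<1}) = 0" and [measurable_cong]: "sets M = sets borel" for M
  proof (rule emeasure_eq_AE)
    have "AE y in M. y \<in> {0<..<1}"
      using that by (intro AE_I'[of "- {0<..<1}"]) (auto simp: null_sets_def)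
    then show "AE y in M. y \<in> {x<..} \<longleftrightarrow> y \<in> {a<..<1}"
      by eventually_elim (auto simp: a_def)
  qed auto
  ultimately show "emeasure \<mu> {x<..} = emeasure \<nu> {x<..}"
    using assms(3-6) by metis
qed (use assms in auto)

lemma is_second_deriv_measure_unique:
  "is_second_deriv_measure \<eta> \<mu> \<Longrightarrow> is_second_deriv_measure \<eta> \<nu> \<Longrightarrow> \<mu> = \<nu>"
  unfolding is_second_deriv_measure_def by (intro finite_measures_eqI_test_fun) auto

text \<open>By uniqueness any measure exhibited as the second derivative is the one picked by
  \<open>SOME\<close>.\<close>

lemma second_deriv_measure_eqI:
  "is_second_deriv_measure \<eta> \<mu> \<Longrightarrow> second_deriv_measure \<eta> = \<mu>"
  unfolding second_deriv_measure_def
  by (meson is_second_deriv_measure_unique someI)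

section \<open>Lebesgue decomposition\<close>

lemma is_ac_density_exists:
  fixes \<mu> :: "real measure"
  assumes "finite_measure \<mu>" and sets [measurable_cong]: "sets \<mu> = sets borel"
  shows "\<exists>f. is_ac_density \<mu> f"
proof -
  interpret finite_measure \<mu> by fact
  \<comment> \<open>A Lebesgue-null set of maximal \<open>\<mu>\<close>-measure carries the singular part.\<close>
  define S where "S = Sup (measure \<mu> ` null_sets lborel)"
  have bdd: "bdd_above (measure \<mu> ` null_sets lborel)"
    by (intro bdd_aboveI[of _ "measure \<mu> (space \<mu>)"]) (auto intro: bounded_measure)
  have "\<exists>N\<in>null_sets lborel. S - 1 / Suc n < measure \<mu> N" for n
  proof -
    have "\<exists>y\<in>measure \<mu> ` null_sets lborel. S - 1 / Suc n < y"
      unfolding S_def by (rule less_cSupD) (auto intro!: exI[of _ "{}"])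
    then show ?thesis by auto
  qed
  then obtain N' where N': "\<And>n. N' n \<in> null_sets lborel" "\<And>n. S - 1 / Suc n < measure \<mu> (N' n)"
    by metis
  define N where "N = (\<Union>n. N' n)"
  have N: "N \<in> null_sets lborel" unfolding N_def using N'(1) by blast
  then have [measurable]: "N \<in> sets borel" by auto
  have le_S: "measure \<mu> A \<le> S" if "A \<in> null_sets lborel" for A
    unfolding S_def by (rule cSup_upper) (use that bdd in auto)
  have "S - 1 / Suc n \<le> measure \<mu> N" for n
  proof -
    have "measure \<mu> (N' n) \<le> measure \<mu> N"
      by (rule finite_measure_mono) (use \<open>N \<in> sets borel\<close> in \<open>auto simp: N_def sets\<close>)
    with N'(2)[of n] show ?thesis by simp
  qed
  then have "S \<le> measure \<mu> N"
    using LIMSEQ_le_const2[of "\<lambda>n. S - 1 / Suc n" S "measure \<mu> N"]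
      tendsto_diff[OF tendsto_const LIMSEQ_inverse_real_of_nat, of S]
    by (auto simp: inverse_eq_divide)
  define \<nu> where "\<nu> = density \<mu> (indicator (- N))"
  have sets_nu [simp]: "sets \<nu> = sets borel" by (simp add: \<nu>_def sets)
  have nu: "emeasure \<nu> A = emeasure \<mu> (A - N)" if [measurable]: "A \<in> sets borel" for A
  proof -
    have "emeasure \<nu> A = (\<integral>\<^sup>+x. indicator (- N) x * indicator A x \<partial>\<mu>)"
      unfolding \<nu>_def by (subst emeasure_density) auto
    also have "\<dots> = (\<integral>\<^sup>+x. indicator (A - N) x \<partial>\<mu>)"
      by (intro nn_integral_cong) (auto split: split_indicator)
    finally show ?thesis by simp
  qed
  \<comment> \<open>A Lebesgue-null \<open>A\<close> with positive mass outside \<open>N\<close>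
    would give \<open>A \<union> N\<close> a measure above the supremum \<open>S\<close>.\<close>
  have "absolutely_continuous lborel \<nu>"
    unfolding absolutely_continuous_def
  proof
    fix A :: "real set" assume A: "A \<in> null_sets lborel"
    then have [measurable]: "A \<in> sets borel" by auto
    have "measure \<mu> (A \<union> N) = measure \<mu> (A - N) + measure \<mu> N"
      by (subst finite_measure_Union[symmetric]) (auto simp: Un_commute)
    moreover have "measure \<mu> (A \<union> N) \<le> S" by (intro le_S) (use A N in auto)
    ultimately have "measure \<mu> (A - N) = 0"
      using \<open>S \<le> measure \<mu> N\<close> measure_nonneg[of \<mu> "A - N"] by linarith
    then show "A \<in> null_sets \<nu>"
      by (auto simp: nu emeasure_eq_measure null_sets_def)
  qed
  then obtain f where f [measurable]: "f \<in> borel_measurable lborel" and dens: "density lborel f = \<nu>"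
    using sigma_finite_measure.Radon_Nikodym[OF sigma_finite_lborel, of \<nu>] by auto
  have "(\<integral>\<^sup>+x. f x \<partial>lborel) = emeasure \<nu> UNIV"
    by (subst dens[symmetric], subst emeasure_density) auto
  also have "\<dots> < \<infinity>"
    using emeasure_finite by (simp add: nu less_top[symmetric])
  finally have "AE x in lborel. f x \<noteq> \<infinity>"
    by (intro nn_integral_PInf_AE) auto
  then have AE: "AE x in lborel. ennreal (enn2real (f x)) = f x"
    by eventually_elim (auto simp: less_top)
  have "is_ac_density \<mu> (\<lambda>x. enn2real (f x))"
    unfolding is_ac_density_def
  proof (intro conjI bexI[OF _ N] ballI)
    fix A :: "real set" assume [measurable]: "A \<in> sets borel"
    have "emeasure \<mu> A = emeasure \<mu> (A - N) + emeasure \<mu> (A \<inter> N)"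
      by (subst plus_emeasure) (auto intro: arg_cong[where f = "emeasure \<mu>"])
    also have "emeasure \<mu> (A - N) = (\<integral>\<^sup>+x\<in>A. f x \<partial>lborel)"
      by (subst nu[symmetric], simp, subst dens[symmetric], subst emeasure_density) auto
    also have "\<dots> = (\<integral>\<^sup>+x\<in>A. ennreal (enn2real (f x)) \<partial>lborel)"
      using AE by (intro nn_integral_cong_AE) auto
    finally show "emeasure \<mu> A = (\<integral>\<^sup>+x\<in>A. ennreal (enn2real (f x)) \<partial>lborel) + emeasure \<mu> (A \<inter> N)" .
  qed auto
  then show ?thesis by blast
qed

lemma is_ac_density_ac_density:
  assumes "finite_measure (second_deriv_measure \<eta>)" "sets (second_deriv_measure \<eta>) = sets borel"
  shows "is_ac_density (second_deriv_measure \<eta>) (ac_density \<eta>)"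
  unfolding ac_density_def using is_ac_density_exists[OF assms] by (rule someI_ex)

section \<open>Second derivatives of convex functions\<close>

text \<open>The kernel max 0 (t - x) has second t-derivative equal to the unit mass at x, so a
  potential of \<mu> plus an affine function has second derivative \<mu>.\<close>

lemma is_second_deriv_measureI:
  assumes fin: "finite_measure \<mu>" and sets [measurable_cong]: "sets \<mu> = sets borel"
    and null: "emeasure \<mu> (- {0<..<1}) = 0"
    and eq: "\<And>t. t \<in> {0..1} \<Longrightarrow> (\<integral>x. max 0 (t - x) \<partial>\<mu>) = \<eta> t - a - b * t"
    and cont_eta: "continuous_on {0..1} \<eta>"
  shows "is_second_deriv_measure \<eta> \<mu>"
  unfolding is_second_deriv_measure_def
proof (intro conjI allI impI)
  fix \<psi> assume test: "test_fun \<psi>"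
  define \<psi>' where "\<psi>' = deriv \<psi>"
  define \<psi>'' where "\<psi>'' = deriv \<psi>'"
  from test have smooth: "\<And>n x. ((deriv ^^ n) \<psi> has_real_derivative (deriv ^^ Suc n) \<psi> x) (at x)"
    by (auto simp: test_fun_def smooth_fun_def)
  have d1: "(\<psi> has_real_derivative \<psi>' x) (at x)" for x
    using smooth[of 0 x] by (simp add: \<psi>'_def)
  have d2: "(\<psi>' has_real_derivative \<psi>'' x) (at x)" for x
    using smooth[of 1 x] by (simp add: \<psi>'_def \<psi>''_def)
  have d3: "(\<psi>'' has_real_derivative deriv \<psi>'' x) (at x)" for x
    using smooth[of 2 x] by (simp add: \<psi>'_def \<psi>''_def numeral_2_eq_2)
  have cont: "continuous_on S \<psi>'" "continuous_on S \<psi>''" "continuous_on S \<psi>" for S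
    using d1 d2 d3 by (auto intro!: continuous_at_imp_continuous_on DERIV_isCont)
  then have [measurable]: "\<psi> \<in> borel_measurable borel" "\<psi>'' \<in> borel_measurable borel"
    by (auto intro: borel_measurable_continuous_onI)
  obtain l u where lu: "0 < l" "u < 1" "\<And>x. x \<notin> {l..u} \<Longrightarrow> \<psi> x = 0"
    using test by (auto simp: test_fun_def)
  have zero: "\<psi> 0 = 0" "\<psi> 1 = 0" using lu by auto
  have "(\<psi> has_real_derivative 0) (at 0)"
    by (rule has_field_derivative_transform_within_open[OF DERIV_const[of 0], where S = "{..<l}"])
       (use lu in auto)
  then have "\<psi>' 0 = 0" using d1 DERIV_unique by blast
  have "(\<psi> has_real_derivative 0) (at 1)"
    by (rule has_field_derivative_transform_within_open[OF DERIV_const[of 0], where S = "{u<..}"])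
       (use lu in auto)
  then have "\<psi>' 1 = 0" using d1 DERIV_unique by blast
  \<comment> \<open>\<open>K\<close> represents \<open>\<psi> x\<close> as \<open>\<integral> max 0 (t - x) \<psi>''(t) dt\<close>; the claim is then Fubini.\<close>
  define K where "K = (\<lambda>x t. indicator {0..1} t * (max 0 (t - x) * \<psi>'' t))"
  have repr: "(\<integral>t. K x t \<partial>lborel) = \<psi> x" if "x \<in> {0..1}" for x
  proof -
    have "(\<integral>t. (t - x) * \<psi>'' t * indicator {x..1} t \<partial>lborel) =
        ((1 - x) * \<psi>' 1 - \<psi> 1) - ((x - x) * \<psi>' x - \<psi> x)"
    proof (rule integral_FTC_Icc_real)
      fix t
      show "((\<lambda>t. (t - x) * \<psi>' t - \<psi> t) has_real_derivative (t - x) * \<psi>'' t) (at t)"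
        using d1 d2 by (auto intro!: derivative_eq_intros)
      show "isCont (\<lambda>t. (t - x) * \<psi>'' t) t"
        by (intro continuous_intros DERIV_isCont[OF d3])
    qed (use that in auto)
    moreover have "K x t = (t - x) * \<psi>'' t * indicator {x..1} t" for t
      using that by (auto simp: K_def indicator_def)
    ultimately show ?thesis using \<open>\<psi>' 1 = 0\<close> zero by simp
  qed
  have int0: "(\<integral>t. \<psi>'' t * indicator {0..1} t \<partial>lborel) = \<psi>' 1 - \<psi>' 0"
    by (rule integral_FTC_Icc_real) (use d2 DERIV_isCont[OF d3] in auto)
  obtain B where "\<forall>t\<in>{0..1}. \<bar>\<psi>'' t\<bar> \<le> B"
    using compact_imp_bounded[OF compact_continuous_image[OF cont(2)[of "{0..1}"]]]
    by (auto simp: bounded_iff)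
  then have B: "\<bar>\<psi>'' t\<bar> \<le> B" if "t \<in> {0..1}" for t
    using that by blast
  define \<Lambda> where "\<Lambda> = density lborel (\<lambda>t::real. ennreal (indicator {0..1} t))"
  have sets_L [measurable_cong, simp]: "sets \<Lambda> = sets borel" by (simp add: \<Lambda>_def)
  interpret mu: finite_measure \<mu> by fact
  interpret L: finite_measure \<Lambda>
  proof
    have "emeasure \<Lambda> (space \<Lambda>) = (\<integral>\<^sup>+t. indicator {0..1::real} t \<partial>lborel)"
      unfolding \<Lambda>_def by (subst emeasure_density) (auto simp: ennreal_indicator)
    then show "emeasure \<Lambda> (space \<Lambda>) \<noteq> \<infinity>" by simp
  qed
  interpret P: pair_sigma_finite \<mu> \<Lambda> ..
  \<comment> \<open>The indicator in \<open>x\<close> only removes a \<mu>-null set, and with it the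
    kernel is bounded everywhere, hence integrable over the product of the two finite
    measures.\<close>
  have K_meas [measurable]: "(\<lambda>(x, t). indicator {0..1} x * K x t) \<in> borel_measurable (\<mu> \<Otimes>\<^sub>M \<Lambda>)"
    unfolding K_def by measurable
  have bound: "\<bar>indicator {0..1} x * K x t\<bar> \<le> B" for x t
  proof (cases "x \<in> {0..1} \<and> t \<in> {0..1}")
    case True
    then have "\<bar>max 0 (t - x) * \<psi>'' t\<bar> \<le> 1 * B"
      unfolding abs_mult using B[of t] by (intro mult_mono) auto
    with True show ?thesis by (simp add: K_def)
  next
    case False
    then show ?thesis using B[of 0] by (auto simp: K_def)
  qed
  have integ: "integrable (\<mu> \<Otimes>\<^sub>M \<Lambda>) (\<lambda>(x, t). indicator {0..1} x * K x t)"
  proof (rule finite_measure.integrable_const_bound[where B = B])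
    show "finite_measure (\<mu> \<Otimes>\<^sub>M \<Lambda>)"
      by (rule finite_measure_pair_measure) unfold_locales
  qed (use bound in auto)
  have AE: "AE x in \<mu>. x \<in> {0<..<1}"
    using null sets by (intro AE_I'[of "- {0<..<1}"]) (auto simp: null_sets_def)
  have inner: "(\<integral>t. g t \<partial>\<Lambda>) = (\<integral>t. indicator {0..1} t * g t \<partial>lborel)"
    if [measurable]: "g \<in> borel_measurable borel" for g :: "real \<Rightarrow> real"
    unfolding \<Lambda>_def by (subst integral_density) auto
  have [measurable]: "K x \<in> borel_measurable borel" "(\<lambda>x. K x t) \<in> borel_measurable borel" for x t
    unfolding K_def by measurable
  have "integral\<^sup>L \<mu> \<psi> = (\<integral>x. (\<integral>t. indicator {0..1} x * K x t \<partial>\<Lambda>) \<partial>\<mu>)"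
  proof (rule integral_cong_AE)
    show "AE x in \<mu>. \<psi> x = (\<integral>t. indicator {0..1} x * K x t \<partial>\<Lambda>)"
      using AE
    proof eventually_elim
      case (elim x)
      have "(\<integral>t. K x t \<partial>\<Lambda>) = (\<integral>t. K x t \<partial>lborel)"
        by (subst inner) (auto intro!: Bochner_Integration.integral_cong simp: K_def split: split_indicator)
      with elim repr[of x] show ?case by simp
    qed
  qed (measurable, use P.borel_measurable_lebesgue_integral in measurable)
  also have "\<dots> = (\<integral>t. (\<integral>x. indicator {0..1} x * K x t \<partial>\<mu>) \<partial>\<Lambda>)"
    by (rule P.Fubini_integral[OF integ, symmetric])
  also have "\<dots> = (\<integral>t. indicator {0..1} t * (\<integral>x. indicator {0..1} x * K x t \<partial>\<mu>) \<partial>lborel)"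
    by (rule inner) measurable
  also have "\<dots> = (\<integral>t. indicator {0..1} t * (\<psi>'' t * (\<eta> t - a - b * t)) \<partial>lborel)"
  proof (rule Bochner_Integration.integral_cong[OF refl])
    fix t
    show "indicator {0..1} t * (\<integral>x. indicator {0..1} x * K x t \<partial>\<mu>) =
        indicator {0..1} t * (\<psi>'' t * (\<eta> t - a - b * t))"
    proof (cases "t \<in> {0..1}")
      case True
      have "(\<integral>x. indicator {0..1} x * K x t \<partial>\<mu>) = (\<integral>x. max 0 (t - x) * \<psi>'' t \<partial>\<mu>)"
        using AE True by (intro integral_cong_AE) (auto simp: K_def)
      then show ?thesis using eq[OF True] by simp
    qed simp
  qed
  \<comment> \<open>The affine part drops out: \<psi>'' integrates to \<psi>' 1 - \<psi>' 0 = 0, and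
    \<open>K 0\<close> integrates to \<psi> 0 = 0.\<close>
  also have "\<dots> = (\<integral>t. (indicator {0..1} t * (\<eta> t * \<psi>'' t)) - a * (\<psi>'' t * indicator {0..1} t)
      - b * K 0 t \<partial>lborel)"
    by (intro Bochner_Integration.integral_cong) (auto simp: K_def algebra_simps split: split_indicator)
  also have "\<dots> = (\<integral>t. indicator {0..1} t * (\<eta> t * \<psi>'' t) \<partial>lborel)"
  proof -
    have i1: "integrable lborel (\<lambda>t. \<psi>'' t * indicator {0..1} t)"
      using borel_integrable_atLeastAtMost'[OF cont(2), of 0 1]
      by (simp add: set_integrable_def mult.commute)
    have i2: "integrable lborel (K 0)"
    proof -
      have "continuous_on {0..1} (\<lambda>t. max 0 (t - 0) * \<psi>'' t)"
        by (intro continuous_intros cont)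
      from borel_integrable_atLeastAtMost'[OF this]
      show ?thesis by (simp add: set_integrable_def K_def)
    qed
    have i3: "integrable lborel (\<lambda>t. indicator {0..1} t * (\<eta> t * \<psi>'' t))"
    proof -
      have "continuous_on {0..1} (\<lambda>t. \<eta> t * \<psi>'' t)"
        by (intro continuous_intros cont cont_eta)
      from borel_integrable_atLeastAtMost'[OF this]
      show ?thesis by (simp add: set_integrable_def)
    qed
    show ?thesis
      using i1 i2 i3 int0 repr[of 0] zero \<open>\<psi>' 1 = 0\<close> \<open>\<psi>' 0 = 0\<close> by simp
  qed
  finally show "(LINT x:{0..1}|lborel. \<eta> x * deriv (deriv \<psi>) x) = integral\<^sup>L \<mu> \<psi>"
    by (simp add: set_lebesgue_integral_def \<psi>'_def \<psi>''_def)
qed (use assms in auto)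

text \<open>On n equal pieces the bounds telescope to (F b - F a) (b - a) / n, which tends to 0.
  This identifies two functions with the same one-sided slopes \<open>F\<close> without any
  derivative existing at the jumps of \<open>F\<close>.\<close>

lemma const_of_increment_bound:
  fixes D F :: "real \<Rightarrow> real"
  assumes le: "\<And>s t. a \<le> s \<Longrightarrow> s < t \<Longrightarrow> t \<le> b \<Longrightarrow> \<bar>D t - D s\<bar> \<le> (F t - F s) * (t - s)"
    and "a \<le> b"
  shows "D b = D a"
proof (cases "a = b")
  case False
  with \<open>a \<le> b\<close> have "a < b" by simp
  have bound: "\<bar>D b - D a\<bar> \<le> (F b - F a) * (b - a) * inverse (real (Suc n))" for n
  proof -
    define x where "x i = a + (b - a) * real i / real (Suc n)" for i
    have x0: "x 0 = a" and xn: "x (Suc n) = b" unfolding x_def by (simp, subst nonzero_mult_div_cancel_right) auto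
    have step: "x (Suc i) - x i = (b - a) * inverse (real (Suc n))" for i
    proof -
      have "(b - a) * real (Suc i) / N = (b - a) * real i / N + (b - a) * inverse N" for N
        by (simp add: ring_distribs add_divide_distrib diff_divide_distrib divide_inverse)
      then show ?thesis unfolding x_def by simp
    qed
    have "\<bar>D b - D a\<bar> = \<bar>\<Sum>i<Suc n. D (x (Suc i)) - D (x i)\<bar>"
      by (subst sum_lessThan_telescope) (simp add: x0 xn)
    also have "\<dots> \<le> (\<Sum>i<Suc n. \<bar>D (x (Suc i)) - D (x i)\<bar>)" by (rule sum_abs)
    also have "\<dots> \<le> (\<Sum>i<Suc n. (F (x (Suc i)) - F (x i)) * ((b - a) * inverse (real (Suc n))))"
    proof (rule sum_mono)
      fix i assume "i \<in> {..<Suc n}"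
      then have i: "Suc i \<le> Suc n" by simp
      have "a \<le> x i" using \<open>a < b\<close> by (simp add: x_def)
      moreover have "x i < x (Suc i)"
        using step[of i] \<open>a < b\<close> by (simp add: algebra_simps) (metis add_less_cancel_left diff_gt_0_iff_gt inverse_positive_iff_positive mult_pos_pos of_nat_0_less_iff step zero_less_Suc)
      moreover have "x (Suc i) \<le> b"
      proof -
        have "(b - a) * real (Suc i) / real (Suc n) \<le> (b - a) * real (Suc n) / real (Suc n)"
          using i \<open>a < b\<close> by (intro divide_right_mono mult_left_mono) auto
        then show ?thesis by (simp add: x_def)
      qed
      ultimately show "\<bar>D (x (Suc i)) - D (x i)\<bar> \<le> (F (x (Suc i)) - F (x i)) * ((b - a) * inverse (real (Suc n)))"
        using le[of "x i" "x (Suc i)"] by (simp only: step)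
    qed
    also have "\<dots> = (F b - F a) * (b - a) * inverse (real (Suc n))"
      unfolding sum_distrib_right[symmetric] by (subst sum_lessThan_telescope) (simp add: x0 xn)
    finally show ?thesis .
  qed
  have "(\<lambda>n. (F b - F a) * (b - a) * inverse (real (Suc n))) \<longlonglongrightarrow> (F b - F a) * (b - a) * 0"
    by (intro tendsto_intros LIMSEQ_inverse_real_of_nat)
  then have "\<bar>D b - D a\<bar> \<le> 0"
    using LIMSEQ_le_const bound by (metis (no_types, lifting) mult_zero_right)
  then show ?thesis by simp
qed simp

text \<open>The right derivative, extended by constants beyond \<open>[0, 1)\<close>; \<open>c\<close> has to dominate the left
  derivative at 1.\<close>

definition right_slope :: "(real \<Rightarrow> real) \<Rightarrow> real \<Rightarrow> real \<Rightarrow> real" where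
  "right_slope H c t = (if 1 \<le> t then c
     else Inf ((\<lambda>u. (H u - H (max 0 t)) / (u - max 0 t)) ` {max 0 t<..1}))"

text \<open>Continuity and convexity alone allow infinite slopes at both ends. The bounds
  \<open>c\<close> and \<open>bdd0\<close> exclude them, so that \<open>F\<close> is a bounded
  monotone function.\<close>

locale convex_fun_01 =
  fixes H :: "real \<Rightarrow> real" and c :: real
  assumes cont: "continuous_on {0..1} H" and convex: "convex_on {0..1} H"
    and c: "\<And>t. 0 \<le> t \<Longrightarrow> t < 1 \<Longrightarrow> H 1 - H t \<le> c * (1 - t)"
    and bdd0: "bdd_below ((\<lambda>u. (H u - H 0) / u) ` {0<..1})"
begin

abbreviation "F \<equiv> right_slope H c"

lemma slope_mono:
  assumes "0 \<le> s" "s < t" "t < u" "u \<le> 1"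
  shows "(H t - H s) / (t - s) \<le> (H u - H s) / (u - s)" "(H u - H s) / (u - s) \<le> (H u - H t) / (u - t)"
proof -
  have "(H p - H q) / (p - q) = (H q - H p) / (q - p)" for p q
    by (metis minus_diff_eq minus_divide_divide)
  then show "(H t - H s) / (t - s) \<le> (H u - H s) / (u - s)" "(H u - H s) / (u - s) \<le> (H u - H t) / (u - t)"
    using convex_on_slope_le[OF convex, of s u t] assms by auto
qed

lemma bdd:
  assumes "0 \<le> t" "t < 1"
  shows "bdd_below ((\<lambda>u. (H u - H t) / (u - t)) ` {t<..1})"
proof (cases "t = 0")
  case False
  then show ?thesis
    using assms slope_mono[of 0 t]
    by (intro bdd_belowI2[where m = "(H t - H 0) / (t - 0)"]) (smt (verit, best) greaterThanAtMost_iff)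
qed (use bdd0 in simp)

lemma F_lower:
  assumes "0 \<le> s" "s < t" "t \<le> 1"
  shows "F s \<le> (H t - H s) / (t - s)"
  using assms bdd[of s] by (auto simp: right_slope_def intro!: cInf_lower)

lemma F_greatest:
  assumes "0 \<le> s" "s < 1" "\<And>u. s < u \<Longrightarrow> u \<le> 1 \<Longrightarrow> m \<le> (H u - H s) / (u - s)"
  shows "m \<le> F s"
  using assms by (auto simp: right_slope_def intro!: cInf_greatest)

lemma F_upper:
  assumes "0 \<le> s" "s < t" "t \<le> 1"
  shows "(H t - H s) / (t - s) \<le> F t"
proof (cases "t = 1")
  case True
  then show ?thesis using c[of s] assms by (simp add: right_slope_def field_simps)
next
  case False
  with assms show ?thesis
    using slope_mono[of s t] by (intro F_greatest) (auto intro: order_trans)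
qed

lemma F_neg: "t \<le> 0 \<Longrightarrow> F t = F 0"
  by (simp add: right_slope_def)

lemma F_mono: assumes "s \<le> t" shows "F s \<le> F t"
proof -
  have 1: "F s \<le> F t" if "0 \<le> s" "s \<le> t" "t \<le> 1" for s t
    using F_lower[of s t] F_upper[of s t] that by (cases "s = t") auto
  have "F s = F (min 1 (max 0 s))" for s
    by (auto simp: right_slope_def min_def max_def)
  then show ?thesis
    using 1[of "min 1 (max 0 s)" "min 1 (max 0 t)"] assms by (metis max.cobounded1 max.mono min.cobounded1 min.mono min_def order_refl zero_le_one)
qed

text \<open>If some chord from \<open>t\<close> to \<open>u\<close> has slope below
  \<open>m\<close>, so have the chords from nearby \<open>s\<close> to \<open>u\<close>, and these
  dominate \<open>F s\<close>. Together with monotonicity this gives right continuity, as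
  \<open>interval_measure\<close> requires.\<close>

lemma F_right_cont: "continuous (at_right t) F"
proof -
  consider "t < 0" | "0 \<le> t" "t < 1" | "1 \<le> t" by linarith
  then show ?thesis
  proof cases
    case 1
    then have "\<forall>\<^sub>F s in at_right t. F s = F t"
      unfolding eventually_at_right_field by (intro exI[of _ 0]) (auto intro!: trans[OF F_neg F_neg[symmetric]])
    then show ?thesis
      unfolding continuous_within by (rule tendsto_eventually)
  next
    case 2
    show ?thesis
      unfolding continuous_within
    proof (rule order_tendstoI)
      fix m assume m: "m < F t"
      have "m < F s" if "t < s" for s
        using F_mono[of t s] m that by linarith
      then show "\<forall>\<^sub>F s in at_right t. m < F s"
        unfolding eventually_at_right_field using 2 by blast
    next
      fix m assume "F t < m"
      then have "\<exists>u\<in>{t<..1}. (H u - H t) / (u - t) < m"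
        using F_greatest[of t m] 2 by force
      then obtain u where u: "t < u" "u \<le> 1" "(H u - H t) / (u - t) < m" by auto
      have "continuous_on {t..1} H"
        by (rule continuous_on_subset[OF cont]) (use 2 in auto)
      then have "(H \<longlongrightarrow> H t) (at t within {t..1})"
        using 2 by (auto simp: continuous_on_def)
      then have "(H \<longlongrightarrow> H t) (at_right t)"
        using 2 by (simp add: at_within_Icc_at_right)
      then have "((\<lambda>s. (H u - H s) / (u - s)) \<longlongrightarrow> (H u - H t) / (u - t)) (at_right t)"
        using u by (intro tendsto_intros) auto
      then have "\<forall>\<^sub>F s in at_right t. (H u - H s) / (u - s) < m"
        using u order_tendstoD(2) by blast
      moreover have "\<forall>\<^sub>F s in at_right t. s \<in> {t<..<u}"
        using u eventually_at_right_real by blast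
      ultimately show "\<forall>\<^sub>F s in at_right t. F s < m"
      proof eventually_elim
        case (elim s)
        then show ?case using F_lower[of s u] u 2 by auto
      qed
    qed
  next
    case 3
    then have "\<forall>\<^sub>F s in at_right t. F s = F t"
      unfolding eventually_at_right_field by (intro exI[of _ "t + 1"]) (auto simp: right_slope_def)
    then show ?thesis
      unfolding continuous_within by (rule tendsto_eventually)
  qed
qed

text \<open>The potential \<open>G\<close> of the Stieltjes measure of \<open>F\<close> and the
  function \<open>H\<close> with its initial slope subtracted have increments squeezed between the
  same two multiples of the step, so they differ by a constant.\<close>

lemma representing_measure:
  obtains \<mu> where "finite_measure \<mu>" "sets \<mu> = sets borel" "emeasure \<mu> (- {0<..<1}) = 0"
    "\<And>t. t \<in> {0..1} \<Longrightarrow> (\<integral>x. max 0 (t - x) \<partial>\<mu>) = H t - H 0 - F 0 * t"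
proof -
  \<comment> \<open>The restriction removes a possible atom at 1, where \<open>F\<close> jumps to
    \<open>c\<close>. The potential at t \<le> 1 does not see this atom, because max 0 (t - 1) =
    0.\<close>
  define \<mu> where "\<mu> = density (interval_measure F) (indicator {0<..<1})"
  have sets [simp, measurable_cong]: "sets \<mu> = sets borel" by (simp add: \<mu>_def)
  have space [simp]: "space \<mu> = UNIV" by (simp add: \<mu>_def)
  have em: "emeasure \<mu> A = emeasure (interval_measure F) (A \<inter> {0<..<1})" if [measurable]: "A \<in> sets borel" for A
  proof -
    have "emeasure \<mu> A = (\<integral>\<^sup>+x. indicator (A \<inter> {0<..<1}) x \<partial>interval_measure F)"
      unfolding \<mu>_def by (subst emeasure_density) (auto intro!: nn_integral_cong simp del: nn_integral_indicator split: split_indicator)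
    then show ?thesis by (subst (asm) nn_integral_indicator) auto
  qed
  have Ioc: "emeasure (interval_measure F) {0<..t} = ennreal (F t - F 0)" if "0 \<le> t" for t
    using that by (intro emeasure_interval_measure_Ioc F_mono F_right_cont)
  have "emeasure \<mu> UNIV \<le> emeasure (interval_measure F) {0<..1}"
    by (subst em) (auto intro!: emeasure_mono)
  then have fin: "finite_measure \<mu>"
    by (intro finite_measureI) (auto simp: Ioc top_unique)
  then interpret finite_measure \<mu> .
  \<comment> \<open>Because of the removed atom, equality is claimed for t < 1 only. Below, the
    lower estimate uses the left end s < 1, and the upper one gets by with the inequality at
    t.\<close>
  have meas: "measure \<mu> {0<..t} \<le> F t - F 0" "t < 1 \<Longrightarrow> measure \<mu> {0<..t} = F t - F 0"
    if "0 \<le> t" for t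
  proof -
    have "emeasure \<mu> {0<..t} \<le> emeasure (interval_measure F) {0<..t}"
      by (subst em) (auto intro!: emeasure_mono)
    also have "\<dots> = ennreal (F t - F 0)" using that by (rule Ioc)
    finally show "measure \<mu> {0<..t} \<le> F t - F 0"
      using F_mono[OF that] by (simp add: emeasure_eq_measure)
    assume "t < 1"
    then have "{0<..t} \<inter> {0<..<1} = {0<..t}" by auto
    then have "emeasure \<mu> {0<..t} = ennreal (F t - F 0)"
      using Ioc[OF that] by (subst em) auto
    then show "measure \<mu> {0<..t} = F t - F 0"
      using F_mono[OF that] by (simp add: emeasure_eq_measure)
  qed
  have null: "emeasure \<mu> (- {0<..<1}) = 0" by (subst em) auto
  have AE: "AE x in \<mu>. x \<in> {0<..<1}"
    using null by (intro AE_I'[of "- {0<..<1}"]) (auto simp: null_sets_def)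
  define G where "G t = (\<integral>x. max 0 (t - x) \<partial>\<mu>)" for t
  have int: "integrable \<mu> (\<lambda>x. max 0 (t - x))" if "t \<le> 1" for t
    by (rule integrable_const_bound[where B = 1]) (use AE that in \<open>auto elim!: eventually_mono\<close>)
  have G0: "G 0 = 0"
    unfolding G_def using AE by (intro integral_eq_zero_AE) (auto elim!: eventually_mono)
  \<comment> \<open>For x > 0 the difference of the kernels lies between t - s on
    \<open>{0<..s}\<close> and t - s on \<open>{0<..t}\<close>, and vanishes beyond
    \<open>t\<close>.\<close>
  have incr: "(F s - F 0) * (t - s) \<le> G t - G s" "G t - G s \<le> (F t - F 0) * (t - s)"
    if st: "0 \<le> s" "s < t" "t \<le> 1" for s t
  proof -
    have diff: "G t - G s = (\<integral>x. max 0 (t - x) - max 0 (s - x) \<partial>\<mu>)"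
      unfolding G_def using int[of t] int[of s] st by simp
    have mi: "(\<integral>x. (t - s) * indicator {0<..u} x \<partial>\<mu>) = (t - s) * measure \<mu> {0<..u}" for u
      by simp
    have ii: "integrable \<mu> (\<lambda>x. (t - s) * indicator {0<..u} x)" for u
      by (intro integrable_mult_right integrable_real_indicator) (auto simp: less_top[symmetric])
    have "(t - s) * measure \<mu> {0<..s} \<le> G t - G s"
      unfolding diff mi[symmetric]
      using st AE int[of t] int[of s] by (intro integral_mono_AE ii) (auto elim!: eventually_mono split: split_indicator)
    then show "(F s - F 0) * (t - s) \<le> G t - G s"
      using meas(2)[of s] st by (simp add: mult.commute)
    have "G t - G s \<le> (t - s) * measure \<mu> {0<..t}"
      unfolding diff mi[symmetric]
      using st AE int[of t] int[of s] by (intro integral_mono_AE ii) (auto elim!: eventually_mono split: split_indicator)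
    also have "\<dots> \<le> (t - s) * (F t - F 0)"
      using meas(1)[of t] st by (intro mult_left_mono) auto
    finally show "G t - G s \<le> (F t - F 0) * (t - s)" by (simp add: mult.commute)
  qed
  have "H t - F 0 * t - G t = H 0 - F 0 * 0 - G 0" if t: "t \<in> {0..1}" for t
  proof (rule const_of_increment_bound[where D = "\<lambda>t. H t - F 0 * t - G t" and F = F])
    fix s u :: real assume su: "0 \<le> s" "s < u" "u \<le> t"
    then have "F s * (u - s) \<le> H u - H s" "H u - H s \<le> F u * (u - s)"
      using F_lower[of s u] F_upper[of s u] t by (auto simp: field_simps)
    with incr[of s u] su t
    show "\<bar>H u - F 0 * u - G u - (H s - F 0 * s - G s)\<bar> \<le> (F u - F s) * (u - s)"
      by (auto simp: algebra_simps)
  qed (use t in auto)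
  then have "(\<integral>x. max 0 (t - x) \<partial>\<mu>) = H t - H 0 - F 0 * t" if "t \<in> {0..1}" for t
    using that G0 by (fastforce simp: G_def)
  then show ?thesis
    by (rule that[OF fin sets null])
qed

end

section \<open>Models and tent functions\<close>

text \<open>Termwise differentiation inside the radius of convergence. As this exceeds 1,
  \<open>deriv\<close> has its usual two-sided meaning on the whole closed interval. The series
  starts at p = 2, hence the values at 0.\<close>

lemma model_derivatives:
  assumes "is_model \<beta>"
  obtains r where "1 < r"
    "\<And>x. \<bar>x\<bar> < r \<Longrightarrow> (xi \<beta> has_real_derivative deriv (xi \<beta>) x) (at x)"
    "\<And>x. \<bar>x\<bar> < r \<Longrightarrow> (deriv (xi \<beta>) has_real_derivative deriv (deriv (xi \<beta>)) x) (at x)"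
    "\<And>x. \<bar>x\<bar> < r \<Longrightarrow> isCont (deriv (deriv (xi \<beta>))) x"
    "\<And>x. 0 \<le> x \<Longrightarrow> x < r \<Longrightarrow> 0 \<le> deriv (deriv (xi \<beta>)) x"
    "deriv (xi \<beta>) 0 = 0" "0 < xi \<beta> 1" "xi \<beta> 0 = 0"
proof -
  define c where "c p = (if 2 \<le> p then (\<beta> p)\<^sup>2 else 0)" for p
  have xi: "xi \<beta> = (\<lambda>t. \<Sum>p. c p * t ^ p)"
    by (auto simp: xi_def c_def fun_eq_iff intro!: suminf_cong)
  obtain \<epsilon> where \<epsilon>: "\<epsilon> > 0" "summable (\<lambda>p. c p * (1 + \<epsilon>) ^ p)"
    using assms by (auto simp: is_model_def c_def if_distrib[of "\<lambda>x. x * _"] cong: if_cong)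
  define r where "r = 1 + \<epsilon>"
  have r: "1 < r" using \<epsilon> by (simp add: r_def)
  have s0: "summable (\<lambda>p. c p * x ^ p)" if "norm x < r" for x
    using powser_inside[OF \<epsilon>(2)[folded r_def], of x] that r by simp
  have s1: "summable (\<lambda>p. diffs c p * x ^ p)" if "norm x < r" for x
    using termdiff_converges[OF that s0] by simp
  have s2: "summable (\<lambda>p. diffs (diffs c) p * x ^ p)" if "norm x < r" for x
    using termdiff_converges[OF that s1] by simp
  define D1 where "D1 x = (\<Sum>p. diffs c p * x ^ p)" for x
  define D2 where "D2 x = (\<Sum>p. diffs (diffs c) p * x ^ p)" for x
  define D3 where "D3 x = (\<Sum>p. diffs (diffs (diffs c)) p * x ^ p)" for x
  have d1: "(xi \<beta> has_real_derivative D1 x) (at x)" if "\<bar>x\<bar> < r" for x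
    unfolding xi D1_def using termdiffs_strong'[OF s0] that by simp
  have d2': "(D1 has_real_derivative D2 x) (at x)" if "\<bar>x\<bar> < r" for x
    unfolding D1_def[abs_def] D2_def using termdiffs_strong'[OF s1] that by simp
  have d3': "(D2 has_real_derivative D3 x) (at x)" if "\<bar>x\<bar> < r" for x
    unfolding D2_def[abs_def] D3_def using termdiffs_strong'[OF s2] that by simp
  have e1: "deriv (xi \<beta>) x = D1 x" if "\<bar>x\<bar> < r" for x
    using d1[OF that] by (rule DERIV_imp_deriv)
  have d2: "(deriv (xi \<beta>) has_real_derivative D2 x) (at x)" if "\<bar>x\<bar> < r" for x
    by (rule has_field_derivative_transform_within_open[OF d2'[OF that], where S = "{-r<..<r}"])
       (use that e1 in auto)
  have e2: "deriv (deriv (xi \<beta>)) x = D2 x" if "\<bar>x\<bar> < r" for x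
    using d2[OF that] by (rule DERIV_imp_deriv)
  have d3: "(deriv (deriv (xi \<beta>)) has_real_derivative D3 x) (at x)" if "\<bar>x\<bar> < r" for x
    by (rule has_field_derivative_transform_within_open[OF d3'[OF that], where S = "{-r<..<r}"])
       (use that e2 in auto)
  have c_nonneg: "0 \<le> c p" for p by (simp add: c_def)
  show ?thesis
  proof (rule that[OF r])
    show "(xi \<beta> has_real_derivative deriv (xi \<beta>) x) (at x)" if "\<bar>x\<bar> < r" for x
      using d1 e1 that by simp
    show "(deriv (xi \<beta>) has_real_derivative deriv (deriv (xi \<beta>)) x) (at x)" if "\<bar>x\<bar> < r" for x
      using d2 e2 that by simp
    show "isCont (deriv (deriv (xi \<beta>))) x" if "\<bar>x\<bar> < r" for x
      using d3[OF that] by (rule DERIV_isCont)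
    show "0 \<le> deriv (deriv (xi \<beta>)) x" if "0 \<le> x" "x < r" for x
    proof -
      have "0 \<le> D2 x"
        unfolding D2_def
        by (rule suminf_nonneg[OF s2]) (use that c_nonneg in \<open>auto simp: diffs_def\<close>)
      then show ?thesis using e2 that by simp
    qed
    have "D1 0 = 0"
      unfolding D1_def by (subst powser_zero) (simp add: diffs_def c_def)
    then show "deriv (xi \<beta>) 0 = 0" using e1[of 0] r by simp
    show "xi \<beta> 0 = 0"
      unfolding xi by (subst powser_zero) (simp add: c_def)
    obtain p where "2 \<le> p" "\<beta> p \<noteq> 0" using assms by (auto simp: is_model_def)
    then have "0 < c p * 1 ^ p" by (simp add: c_def)
    then show "0 < xi \<beta> 1"
      unfolding xi using s0[of 1] r c_nonneg by (intro suminf_pos2) auto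
  qed
qed

text \<open>On \<open>[0, 1]\<close> this is \<open>min (1 - s) (1 - x)\<close>; together with the constants these functions span the
  extreme rays of \<open>classC\<close>.\<close>

definition tent :: "real \<Rightarrow> real \<Rightarrow> real" where
  "tent s x = 1 - max 0 (min 1 (max s x))"

lemma tent_bounds: "0 \<le> tent s x" "tent s x \<le> 1"
  by (auto simp: tent_def)

lemma tent_measurable [measurable]: "(\<lambda>(s, x). tent s x) \<in> borel_measurable (borel \<Otimes>\<^sub>M borel)"
  "tent s \<in> borel_measurable borel"
  unfolding tent_def by measurable

lemma tent_commute: "tent s x = tent x s"
  by (simp add: tent_def max.commute)

lemma convex_on_eqI:
  "convex_on S f \<Longrightarrow> (\<And>x. x \<in> S \<Longrightarrow> f x = g x) \<Longrightarrow> convex_on S g"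
  by (auto simp: convex_on_def convex_def)

lemma tent_classC:
  assumes "0 \<le> s" "s \<le> 1"
  shows "tent s \<in> classC"
proof -
  have "convex_on {0..1} (\<lambda>x. max s x - 1)"
  proof (rule convex_onI)
    fix t x y :: real assume t: "0 < t" "t < 1"
    have "(1 - t) * x + t * y \<le> (1 - t) * max s x + t * max s y" "(1 - t) * s + t * s \<le> (1 - t) * max s x + t * max s y"
      using t by (auto intro!: add_mono mult_left_mono)
    then have "max s ((1 - t) * x + t * y) \<le> (1 - t) * max s x + t * max s y"
      by (intro max.boundedI) (auto simp: algebra_simps)
    moreover have "(1 - t) * (max s x - 1) + t * (max s y - 1) = (1 - t) * max s x + t * max s y - 1"
      by (simp add: algebra_simps)
    ultimately show "max s ((1 - t) *\<^sub>R x + t *\<^sub>R y) - 1 \<le> (1 - t) * (max s x - 1) + t * (max s y - 1)"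
      by simp
  qed simp
  then have "concave_on {0..1} (tent s)"
    unfolding concave_on_def
    by (rule convex_on_eqI) (use assms in \<open>auto simp: tent_def\<close>)
  then show ?thesis
    using assms unfolding classC_def
    by (auto simp: tent_def intro!: continuous_intros)
qed

text \<open>Integration by parts on either side of the kink: the boundary terms at \<open>s\<close>
  cancel, the one at 0 vanishes because \<xi>' 0 = 0, and the one at 1 because the tent is 0
  there.\<close>

lemma tent_integral_xi:
  assumes "is_model \<beta>" "0 \<le> s" "s \<le> 1"
  shows "(\<integral>x. tent s x * deriv (deriv (xi \<beta>)) x * indicator {0..1} x \<partial>lborel) = xi \<beta> 1 - xi \<beta> s"
proof -
  obtain r where r: "1 < r"
    "\<And>x. \<bar>x\<bar> < r \<Longrightarrow> (xi \<beta> has_real_derivative deriv (xi \<beta>) x) (at x)"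
    "\<And>x. \<bar>x\<bar> < r \<Longrightarrow> (deriv (xi \<beta>) has_real_derivative deriv (deriv (xi \<beta>)) x) (at x)"
    "\<And>x. \<bar>x\<bar> < r \<Longrightarrow> isCont (deriv (deriv (xi \<beta>))) x"
    "deriv (xi \<beta>) 0 = 0"
    using model_derivatives[OF assms(1)] by metis
  let ?X = "xi \<beta>" and ?X1 = "deriv (xi \<beta>)" and ?X2 = "deriv (deriv (xi \<beta>))"
  have cont: "continuous_on {0..1} ?X2"
    using r by (intro continuous_at_imp_continuous_on) auto
  have 1: "(\<integral>x. (1 - s) * ?X2 x * indicator {0..s} x \<partial>lborel) = (1 - s) * ?X1 s - (1 - s) * ?X1 0"
    by (rule integral_FTC_Icc_real) (use assms r in \<open>auto intro!: derivative_eq_intros continuous_intros\<close>)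
  have 2: "(\<integral>x. (1 - x) * ?X2 x * indicator {s..1} x \<partial>lborel) =
      ((1 - 1) * ?X1 1 + ?X 1) - ((1 - s) * ?X1 s + ?X s)"
  proof (rule integral_FTC_Icc_real)
    fix x assume "s \<le> x" "x \<le> 1"
    then have x: "\<bar>x\<bar> < r" using assms r by auto
    show "((\<lambda>x. (1 - x) * ?X1 x + ?X x) has_real_derivative (1 - x) * ?X2 x) (at x)"
      by (rule derivative_eq_intros r(2)[OF x] r(3)[OF x] refl | simp)+
    show "isCont (\<lambda>x. (1 - x) * ?X2 x) x"
      by (intro continuous_intros r(4) x)
  qed (use assms in auto)
  have c: "continuous_on {0..s} (\<lambda>x. (1 - s) * ?X2 x)" "continuous_on {s..1} (\<lambda>x. (1 - x) * ?X2 x)"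
    using assms by (auto intro!: continuous_intros intro: continuous_on_subset[OF cont])
  have i: "integrable lborel (\<lambda>x. (1 - s) * ?X2 x * indicator {0..s} x)"
    "integrable lborel (\<lambda>x. (1 - x) * ?X2 x * indicator {s..1} x)"
    using c[THEN borel_integrable_atLeastAtMost'] by (simp_all add: set_integrable_def mult_ac)
  have "(\<integral>x. tent s x * ?X2 x * indicator {0..1} x \<partial>lborel) =
      (\<integral>x. (1 - s) * ?X2 x * indicator {0..s} x + (1 - x) * ?X2 x * indicator {s..1} x \<partial>lborel)"
  proof (rule integral_cong_AE)
    show "AE x in lborel. tent s x * ?X2 x * indicator {0..1} x =
        (1 - s) * ?X2 x * indicator {0..s} x + (1 - x) * ?X2 x * indicator {s..1} x"
      using AE_lborel_singleton[of s]
      by eventually_elim (use assms in \<open>auto simp: tent_def split: split_indicator\<close>)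
    show "(\<lambda>x. (1 - s) * ?X2 x * indicator {0..s} x + (1 - x) * ?X2 x * indicator {s..1} x)
       \<in> borel_measurable lborel"
      using i by (intro borel_measurable_add) auto
    have "(\<lambda>x. ?X2 x * indicator {0..1} x) \<in> borel_measurable lborel"
      using borel_measurable_integrable[OF borel_integrable_atLeastAtMost'[OF cont, unfolded set_integrable_def]]
      by (simp add: mult.commute)
    then have "(\<lambda>x. tent s x * (?X2 x * indicator {0..1} x)) \<in> borel_measurable lborel"
      by (rule borel_measurable_times[rotated]) simp
    then show "(\<lambda>x. tent s x * ?X2 x * indicator {0..1} x) \<in> borel_measurable lborel"
      by (simp add: mult_ac)
  qed
  also have "\<dots> = xi \<beta> 1 - xi \<beta> s"
    using i 1 2 r by simp
  finally show ?thesis .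
qed

section \<open>Mixtures of tents\<close>

text \<open>Elements of \<open>classC\<close> are arbitrary outside \<open>[0, 1]\<close>; clamping makes them globally continuous.\<close>

definition clamp01 :: "(real \<Rightarrow> real) \<Rightarrow> real \<Rightarrow> real" where
  "clamp01 \<phi> x = \<phi> (max 0 (min 1 x))"

lemma clamp01_eq [simp]: "x \<in> {0..1} \<Longrightarrow> clamp01 \<phi> x = \<phi> x"
  by (auto simp: clamp01_def)

lemma classC_D:
  assumes "\<phi> \<in> classC"
  shows "continuous_on {0..1} \<phi>" "x \<in> {0..1} \<Longrightarrow> 0 \<le> \<phi> x"
    "0 \<le> x \<Longrightarrow> x \<le> y \<Longrightarrow> y \<le> 1 \<Longrightarrow> \<phi> y \<le> \<phi> x" "concave_on {0..1} \<phi>"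
  using assms by (auto simp: classC_def)

lemma clamp01_continuous:
  assumes "continuous_on {0..1} \<phi>" shows "continuous_on S (clamp01 \<phi>)"
proof -
  have "continuous_on S (\<lambda>x. \<phi> (max 0 (min 1 x)))"
    by (rule continuous_on_compose2[OF assms]) (auto intro!: continuous_intros)
  then show ?thesis by (simp add: clamp01_def[abs_def])
qed

lemma clamp01_measurable:
  "continuous_on {0..1} \<phi> \<Longrightarrow> clamp01 \<phi> \<in> borel_measurable borel"
  by (intro borel_measurable_continuous_onI clamp01_continuous)

lemma clamp01_bounds:
  assumes "\<phi> \<in> classC" shows "0 \<le> clamp01 \<phi> x" "clamp01 \<phi> x \<le> \<phi> 0"
  using classC_D(2,3)[OF assms] by (auto simp: clamp01_def)

lemma clamp01_integrable:
  assumes "\<phi> \<in> classC" "finite_measure M" "sets M = sets borel"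
  shows "integrable M (clamp01 \<phi>)"
proof -
  interpret finite_measure M by fact
  show ?thesis
    using clamp01_bounds[OF assms(1)] clamp01_measurable[OF classC_D(1)[OF assms(1)]] assms(3)
    by (intro integrable_const_bound[where B = "\<phi> 0"]) (auto cong: measurable_cong_sets)
qed

lemma concave_on_dilation:
  fixes \<phi> :: "real \<Rightarrow> real"
  assumes "concave_on S \<phi>" "convex T" and sub: "\<And>x. x \<in> T \<Longrightarrow> c * x \<in> S"
  shows "concave_on T (\<lambda>x. \<phi> (c * x))"
  unfolding concave_on_iff
proof (intro conjI ballI allI impI)
  fix x y u v :: real assume *: "x \<in> T" "y \<in> T" "0 \<le> u" "0 \<le> v" "u + v = 1"
  then have "u * \<phi> (c * x) + v * \<phi> (c * y) \<le> \<phi> (u *\<^sub>R (c * x) + v *\<^sub>R (c * y))"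
    using assms(1) sub[of x] sub[of y] unfolding concave_on_iff by blast
  also have "u *\<^sub>R (c * x) + v *\<^sub>R (c * y) = c * (u *\<^sub>R x + v *\<^sub>R y)"
    by (simp add: algebra_simps)
  finally show "u * \<phi> (c * x) + v * \<phi> (c * y) \<le> \<phi> (c * (u *\<^sub>R x + v *\<^sub>R y))" .
qed fact

text \<open>The constant is the mean decrease of \<phi> over the interval from 1 - d to 1, finite
  however steep \<phi> is at 1, times the chain-rule factor 1 - d. By concavity it dominates every
  earlier rate of decrease.\<close>

lemma convex_fun_01_dilation:
  assumes C: "\<phi> \<in> classC" and d: "0 < d" "d < 1"
  shows "convex_fun_01 (\<lambda>x. - \<phi> ((1 - d) * x)) ((\<phi> (1 - d) - \<phi> 1) / d * (1 - d))"
proof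
  have sub: "(1 - d) * x \<in> {0..1}" if "x \<in> {0..1}" for x
    using that d by (auto intro: mult_le_one)
  show "continuous_on {0..1} (\<lambda>x. - \<phi> ((1 - d) * x))"
    using sub by (intro continuous_intros continuous_on_compose2[OF classC_D(1)[OF C]]) auto
  show "convex_on {0..1} (\<lambda>x. - \<phi> ((1 - d) * x))"
    using concave_on_dilation[OF classC_D(4)[OF C] convex_real_interval(5) sub, of 0 1]
    by (simp add: concave_on_def)
  show "- \<phi> ((1 - d) * 1) - - \<phi> ((1 - d) * t) \<le> (\<phi> (1 - d) - \<phi> 1) / d * (1 - d) * (1 - t)"
    if t: "0 \<le> t" "t < 1" for t
  proof -
    have cv: "convex_on {0..1} (\<lambda>x. - \<phi> x)" using classC_D(4)[OF C] by (simp add: concave_on_def)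
    have lt: "(1 - d) * t < 1 - d" using d t by simp
    then have lt1: "(1 - d) * t \<le> 1" using d by linarith
    have ge0: "0 \<le> (1 - d) * t" using d t by simp
    have "(- \<phi> ((1 - d) * t) - - \<phi> (1 - d)) / ((1 - d) * t - (1 - d)) \<le>
        (- \<phi> ((1 - d) * t) - - \<phi> 1) / ((1 - d) * t - 1)"
      by (rule convex_on_slope_le(1)[OF cv]) (use ge0 lt1 d lt in \<open>simp_all only: atLeastAtMost_iff, auto\<close>)
    also have "\<dots> \<le> (- \<phi> (1 - d) - - \<phi> 1) / ((1 - d) - 1)"
      by (rule convex_on_slope_le(2)[OF cv]) (use ge0 lt1 d lt in \<open>simp_all only: atLeastAtMost_iff, auto\<close>)
    also have "\<dots> = (\<phi> (1 - d) - \<phi> 1) / d"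
      using d by (simp add: field_simps)
    also have "(- \<phi> ((1 - d) * t) - - \<phi> (1 - d)) / ((1 - d) * t - (1 - d)) =
        (\<phi> ((1 - d) * t) - \<phi> (1 - d)) / ((1 - d) * (1 - t))"
      using d t by (simp add: divide_simps) (simp add: algebra_simps)
    finally have "\<phi> ((1 - d) * t) - \<phi> (1 - d) \<le> (\<phi> (1 - d) - \<phi> 1) / d * ((1 - d) * (1 - t))"
      using d t by (subst (asm) pos_divide_le_eq) auto
    then show ?thesis by (simp add: algebra_simps)
  qed
  show "bdd_below ((\<lambda>u. (- \<phi> ((1 - d) * u) - - \<phi> ((1 - d) * 0)) / u) ` {0<..1})"
    using classC_D(3)[OF C, of 0] sub by (intro bdd_belowI2[where m = 0]) auto
qed

text \<open>The dilation \<open>x \<mapsto> \<phi> ((1 - d) x)\<close> has finite slope at 1, so it is a mixture of a constant and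
  tents.\<close>

lemma concave_order_dilation:
  assumes C: "\<phi> \<in> classC" and d: "0 < d" "d < 1"
    and \<mu>: "finite_measure \<mu>" "sets \<mu> = sets borel" "AE x in \<mu>. x \<in> {0..1}"
    and \<gamma>: "finite_measure \<gamma>" "sets \<gamma> = sets borel" "AE x in \<gamma>. x \<in> {0..1}"
    and mass: "measure \<mu> UNIV \<le> measure \<gamma> UNIV + c"
    and le: "\<And>s. 0 \<le> s \<Longrightarrow> s < 1 \<Longrightarrow> (\<integral>x. tent s x \<partial>\<mu>) \<le> (\<integral>x. tent s x \<partial>\<gamma>) + c * (1 - s)"
  shows "(\<integral>x. clamp01 \<phi> ((1 - d) * x) \<partial>\<mu>) \<le> (\<integral>x. clamp01 \<phi> ((1 - d) * x) \<partial>\<gamma>) + c * \<phi> 0"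
proof -
  define q where "q x = \<phi> ((1 - d) * x)" for x
  interpret cf: convex_fun_01 "\<lambda>x. - q x" "(\<phi> (1 - d) - \<phi> 1) / d * (1 - d)"
    unfolding q_def by (rule convex_fun_01_dilation[OF C d])
  obtain \<kappa> where \<kappa>: "finite_measure \<kappa>" "sets \<kappa> = sets borel" "emeasure \<kappa> (- {0<..<1}) = 0"
    and rep: "\<And>t. t \<in> {0..1} \<Longrightarrow> (\<integral>x. max 0 (t - x) \<partial>\<kappa>) = - q t - - q 0 - cf.F 0 * t"
    using cf.representing_measure by blast
  define b where "b = cf.F 0"
  have sub: "(1 - d) * x \<in> {0..1}" if "x \<in> {0..1}" for x
    using that d by (auto intro: mult_le_one)
  have b: "0 \<le> b"
    unfolding b_def using classC_D(3)[OF C, of 0] sub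
    by (intro cf.F_greatest) (auto simp: q_def)
  note [measurable_cong] = \<kappa>(2) \<mu>(2) \<gamma>(2)
  interpret k: finite_measure \<kappa> by fact
  have AEk: "AE x in \<kappa>. x \<in> {0<..<1}"
    using \<kappa> by (intro AE_I'[of "- {0<..<1}"]) (auto simp: null_sets_def)
  \<comment> \<open>Subtracting the representation at \<open>t\<close> from the one at 1 cancels
    \<open>q 0\<close>, and for x in (0, 1) the difference of the two kernels is
    \<open>tent x t\<close>.\<close>
  have q: "q t = q 1 + b * (1 - t) + (\<integral>x. tent x t \<partial>\<kappa>)" if t: "t \<in> {0..1}" for t
  proof -
    have int: "integrable \<kappa> (\<lambda>x. max 0 (u - x))" if "u \<le> 1" for u
      by (rule k.integrable_const_bound[where B = 1]) (use AEk that in \<open>auto elim!: eventually_mono\<close>)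
    have "(\<integral>x. tent x t \<partial>\<kappa>) = (\<integral>x. max 0 (1 - x) - max 0 (t - x) \<partial>\<kappa>)"
      using AEk t by (intro integral_cong_AE) (auto simp: tent_def elim!: eventually_mono)
    also have "\<dots> = (\<integral>x. max 0 (1 - x) \<partial>\<kappa>) - (\<integral>x. max 0 (t - x) \<partial>\<kappa>)"
      using int[of 1] int[of t] t by simp
    finally show ?thesis
      using rep[of 1] rep[of t] t by (simp add: b_def algebra_simps)
  qed
  have mix: "(\<integral>x. clamp01 \<phi> ((1 - d) * x) \<partial>M) =
      q 1 * measure M UNIV + b * (\<integral>x. tent 0 x \<partial>M) + (\<integral>s. (\<integral>x. tent s x \<partial>M) \<partial>\<kappa>)"
    "integrable \<kappa> (\<lambda>s. \<integral>x. tent s x \<partial>M)"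
    if M: "finite_measure M" "sets M = sets borel" "AE x in M. x \<in> {0..1}" for M
  proof -
    interpret M: finite_measure M by fact
    note [measurable_cong] = M(2)
    interpret P: pair_sigma_finite \<kappa> M ..
    have sp: "space M = UNIV" using sets_eq_imp_space_eq[OF M(2)] by simp
    have integ: "integrable (\<kappa> \<Otimes>\<^sub>M M) (\<lambda>(s, x). tent s x)"
    proof (rule finite_measure.integrable_const_bound[where B = 1])
      show "finite_measure (\<kappa> \<Otimes>\<^sub>M M)"
        by (rule finite_measure_pair_measure) unfold_locales
    qed (use tent_bounds in auto)
    show i2: "integrable \<kappa> (\<lambda>s. \<integral>x. tent s x \<partial>M)"
      using P.integrable_fst[OF integ] .
    have i1: "integrable M (\<lambda>x. \<integral>s. tent s x \<partial>\<kappa>)"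
      using P.integrable_snd[OF integ] .
    have it: "integrable M (tent 0)"
      by (rule M.integrable_const_bound[where B = 1]) (use tent_bounds in auto)
    have "(\<integral>x. clamp01 \<phi> ((1 - d) * x) \<partial>M) = (\<integral>x. q 1 + b * tent 0 x + (\<integral>s. tent s x \<partial>\<kappa>) \<partial>M)"
    proof (rule integral_cong_AE)
      show "AE x in M. clamp01 \<phi> ((1 - d) * x) = q 1 + b * tent 0 x + (\<integral>s. tent s x \<partial>\<kappa>)"
        using M(3)
      proof eventually_elim
        case (elim x)
        have "clamp01 \<phi> ((1 - d) * x) = q x" using sub[OF elim] by (simp add: q_def)
        moreover have "tent 0 x = 1 - x" using elim by (auto simp: tent_def)
        ultimately show ?case using q[OF elim] by simp
      qed
      have [measurable]: "clamp01 \<phi> \<in> borel_measurable borel"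
        by (intro clamp01_measurable classC_D(1)[OF C])
      show "(\<lambda>x. clamp01 \<phi> ((1 - d) * x)) \<in> borel_measurable M" by measurable
      show "(\<lambda>x. q 1 + b * tent 0 x + (\<integral>s. tent s x \<partial>\<kappa>)) \<in> borel_measurable M"
        using i1 by (intro borel_measurable_add borel_measurable_times) auto
    qed
    also have "\<dots> = q 1 * measure M UNIV + b * (\<integral>x. tent 0 x \<partial>M) + (\<integral>x. (\<integral>s. tent s x \<partial>\<kappa>) \<partial>M)"
      using i1 it by (simp add: sp mult.commute)
    also have "(\<integral>x. (\<integral>s. tent s x \<partial>\<kappa>) \<partial>M) = (\<integral>s. (\<integral>x. tent s x \<partial>M) \<partial>\<kappa>)"
      by (rule P.Fubini_integral[OF integ])
    finally show "(\<integral>x. clamp01 \<phi> ((1 - d) * x) \<partial>M) =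
      q 1 * measure M UNIV + b * (\<integral>x. tent 0 x \<partial>M) + (\<integral>s. (\<integral>x. tent s x \<partial>M) \<partial>\<kappa>)" .
  qed
  have i0: "integrable \<kappa> (\<lambda>s. tent s 0)"
    by (rule k.integrable_const_bound[where B = 1]) (use tent_bounds in \<open>auto simp: tent_commute[of _ 0]\<close>)
  have "(\<integral>s. (\<integral>x. tent s x \<partial>\<mu>) \<partial>\<kappa>) \<le> (\<integral>s. (\<integral>x. tent s x \<partial>\<gamma>) + c * tent s 0 \<partial>\<kappa>)"
  proof (rule integral_mono_AE)
    show "AE s in \<kappa>. (\<integral>x. tent s x \<partial>\<mu>) \<le> (\<integral>x. tent s x \<partial>\<gamma>) + c * tent s 0"
      using AEk
    proof eventually_elim
      case (elim s)
      then have "tent s 0 = 1 - s" by (auto simp: tent_def)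
      then show ?case using le[of s] elim by simp
    qed
  qed (use mix(2)[OF \<mu>] mix(2)[OF \<gamma>] i0 in auto)
  also have "\<dots> = (\<integral>s. (\<integral>x. tent s x \<partial>\<gamma>) \<partial>\<kappa>) + c * (\<integral>s. tent s 0 \<partial>\<kappa>)"
    using mix(2)[OF \<gamma>] i0 by simp
  finally have 3: "(\<integral>s. (\<integral>x. tent s x \<partial>\<mu>) \<partial>\<kappa>) \<le> (\<integral>s. (\<integral>x. tent s x \<partial>\<gamma>) \<partial>\<kappa>) + c * (\<integral>s. tent s 0 \<partial>\<kappa>)" .
  \<comment> \<open>The three parts of the mixture, namely the constant, \<open>tent 0\<close> and
    the \<kappa>-average, are compared separately; their weights are nonnegative because \<phi> is
    nonnegative, nonincreasing and concave, respectively.\<close>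
  have 1: "q 1 * measure \<mu> UNIV \<le> q 1 * (measure \<gamma> UNIV + c)"
    using mass classC_D(2)[OF C] d by (intro mult_left_mono) (auto simp: q_def)
  have 2: "b * (\<integral>x. tent 0 x \<partial>\<mu>) \<le> b * ((\<integral>x. tent 0 x \<partial>\<gamma>) + c * (1 - 0))"
    using b by (intro mult_left_mono le) auto
  \<comment> \<open>The representation of \<open>q\<close> at 0 adds the three error terms up to
    \<open>c * \<phi> 0\<close>.\<close>
  have "c * \<phi> 0 = c * q 1 + c * b + c * (\<integral>s. tent s 0 \<partial>\<kappa>)"
    using q[of 0] by (simp add: q_def algebra_simps)
  then show ?thesis
    unfolding mix(1)[OF \<mu>] mix(1)[OF \<gamma>] using 1 2 3 by (simp add: algebra_simps)
qed

text \<open>The dilation tends to the identity, and \<phi> is bounded and continuous, so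
  \<open>concave_order_dilation\<close> passes to the limit by dominated convergence once the total
  masses have been compared.\<close>

lemma concave_order:
  assumes C: "\<phi> \<in> classC"
    and \<mu>: "finite_measure \<mu>" "sets \<mu> = sets borel" "AE x in \<mu>. x \<in> {0<..<1}"
    and \<gamma>: "finite_measure \<gamma>" "sets \<gamma> = sets borel" "AE x in \<gamma>. x \<in> {0..1}"
    and le: "\<And>s. 0 \<le> s \<Longrightarrow> s < 1 \<Longrightarrow> (\<integral>x. tent s x \<partial>\<mu>) \<le> (\<integral>x. tent s x \<partial>\<gamma>) + c * (1 - s)"
  shows "(\<integral>x. clamp01 \<phi> x \<partial>\<mu>) \<le> (\<integral>x. clamp01 \<phi> x \<partial>\<gamma>) + c * \<phi> 0"
proof -
  interpret m: finite_measure \<mu> by fact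
  interpret g: finite_measure \<gamma> by fact
  note [measurable_cong] = \<mu>(2) \<gamma>(2)
  have sp: "space \<mu> = UNIV" "space \<gamma> = UNIV"
    using sets_eq_imp_space_eq[OF \<mu>(2)] sets_eq_imp_space_eq[OF \<gamma>(2)] by auto
  have AEm: "AE x in \<mu>. x \<in> {0..1}" using \<mu>(3) by eventually_elim auto
  have it: "integrable \<mu> (tent s)" "integrable \<gamma> (tent s)" for s
    by (auto intro!: m.integrable_const_bound[where B = 1] g.integrable_const_bound[where B = 1] simp: tent_bounds)
  define s where "s n = 1 - inverse (real (Suc n))" for n
  have s: "0 \<le> s n" "s n < 1" for n by (auto simp: s_def inverse_eq_divide)
  have bnd: "real (Suc n) * tent (s n) x \<le> 1" for n x
  proof -
    have "tent (s n) x \<le> 1 - s n" using s[of n] by (auto simp: tent_def min_def max_def)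
    then have "tent (s n) x \<le> inverse (real (Suc n))" by (simp add: s_def)
    then show ?thesis by (simp add: field_simps)
  qed
  \<comment> \<open>The steep tents \<open>real (Suc n) * tent (s n)\<close> never exceed 1 and tend
    to 1 on the open interval, where \<mu> lives, so the hypothesis on tents yields the comparison
    of masses.\<close>
  have mass: "measure \<mu> UNIV \<le> measure \<gamma> UNIV + c"
  proof (rule LIMSEQ_le_const2)
    have "(\<lambda>n. \<integral>x. real (Suc n) * tent (s n) x \<partial>\<mu>) \<longlonglongrightarrow> (\<integral>x. 1 \<partial>\<mu>)"
    proof (rule integral_dominated_convergence[where w = "\<lambda>_. 1"])
      show "AE x in \<mu>. (\<lambda>n. real (Suc n) * tent (s n) x) \<longlonglongrightarrow> 1"
        using \<mu>(3)
      proof eventually_elim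
        case (elim x)
        have "s \<longlonglongrightarrow> 1 - 0"
          unfolding s_def by (intro tendsto_intros LIMSEQ_inverse_real_of_nat)
        then have "\<forall>\<^sub>F n in sequentially. x < s n"
          using elim by (intro order_tendstoD(1)) auto
        then have "\<forall>\<^sub>F n in sequentially. real (Suc n) * tent (s n) x = 1"
        proof eventually_elim
          case (elim n)
          then have "tent (s n) x = inverse (real (Suc n))"
            using s[of n] by (auto simp: tent_def s_def)
          then show ?case by simp
        qed
        then show ?case by (rule tendsto_eventually)
      qed
      show "AE x in \<mu>. norm (real (Suc n) * tent (s n) x) \<le> 1" for n
        using bnd[of n] tent_bounds by (auto simp: abs_mult)
    qed auto
    then show "(\<lambda>n. \<integral>x. real (Suc n) * tent (s n) x \<partial>\<mu>) \<longlonglongrightarrow> measure \<mu> UNIV"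
      by (simp add: sp)
    show "\<exists>N. \<forall>n\<ge>N. (\<integral>x. real (Suc n) * tent (s n) x \<partial>\<mu>) \<le> measure \<gamma> UNIV + c"
    proof (intro exI allI impI)
      fix n
      have "(\<integral>x. real (Suc n) * tent (s n) x \<partial>\<mu>) = real (Suc n) * (\<integral>x. tent (s n) x \<partial>\<mu>)"
        by simp
      also have "\<dots> \<le> real (Suc n) * ((\<integral>x. tent (s n) x \<partial>\<gamma>) + c * (1 - s n))"
        by (intro mult_left_mono le s) auto
      also have "\<dots> = (\<integral>x. real (Suc n) * tent (s n) x \<partial>\<gamma>) + c"
      proof -
        have "real (Suc n) * (1 - s n) = 1" by (simp add: s_def)
        then show ?thesis by (simp add: distrib_left mult.left_commute[of _ c] del: of_nat_Suc)
      qed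
      also have "(\<integral>x. real (Suc n) * tent (s n) x \<partial>\<gamma>) \<le> (\<integral>x. 1 \<partial>\<gamma>)"
        by (rule integral_mono) (use it bnd in auto)
      finally show "(\<integral>x. real (Suc n) * tent (s n) x \<partial>\<mu>) \<le> measure \<gamma> UNIV + c"
        by (simp add: sp)
    qed
  qed
  define d where "d n = inverse (real (Suc (Suc n)))" for n
  have d: "0 < d n" "d n < 1" for n by (auto simp: d_def inverse_eq_divide)
  have d0: "d \<longlonglongrightarrow> 0" unfolding d_def by (rule LIMSEQ_Suc[OF LIMSEQ_inverse_real_of_nat])
  have [measurable]: "clamp01 \<phi> \<in> borel_measurable borel"
    by (intro clamp01_measurable classC_D(1)[OF C])
  have lim: "(\<lambda>n. \<integral>x. clamp01 \<phi> ((1 - d n) * x) \<partial>M) \<longlonglongrightarrow> (\<integral>x. clamp01 \<phi> x \<partial>M)"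
    if "finite_measure M" and [measurable_cong]: "sets M = sets borel" for M
  proof -
    interpret M: finite_measure M by fact
    show ?thesis
    proof (rule integral_dominated_convergence[where w = "\<lambda>_. \<phi> 0"])
      show "AE x in M. (\<lambda>n. clamp01 \<phi> ((1 - d n) * x)) \<longlonglongrightarrow> clamp01 \<phi> x"
      proof (rule AE_I2)
        fix x
        have "isCont (clamp01 \<phi>) x"
          using clamp01_continuous[OF classC_D(1)[OF C], of UNIV] by (simp add: continuous_on_eq_continuous_at)
        moreover have "(\<lambda>n. (1 - d n) * x) \<longlonglongrightarrow> (1 - 0) * x"
          by (intro tendsto_intros d0)
        ultimately show "(\<lambda>n. clamp01 \<phi> ((1 - d n) * x)) \<longlonglongrightarrow> clamp01 \<phi> x"
          using isCont_tendsto_compose by fastforce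
      qed
    qed (use clamp01_bounds[OF C] in auto)
  qed
  show ?thesis
  proof (rule LIMSEQ_le[OF lim[OF \<mu>(1,2)] tendsto_add[OF lim[OF \<gamma>(1,2)] tendsto_const]])
    show "\<exists>N. \<forall>n\<ge>N. (\<integral>x. clamp01 \<phi> ((1 - d n) * x) \<partial>\<mu>) \<le> (\<integral>x. clamp01 \<phi> ((1 - d n) * x) \<partial>\<gamma>) + c * \<phi> 0"
      using concave_order_dilation[OF C d \<mu>(1,2) AEm \<gamma> mass le] by blast
  qed
qed

section \<open>Weak duality\<close>

lemma is_second_deriv_measure_D:
  assumes "is_second_deriv_measure \<eta> \<mu>"
  shows "finite_measure \<mu>" "sets \<mu> = sets borel" "AE x in \<mu>. x \<in> {0<..<1}"
proof -
  from assms show *: "finite_measure \<mu>" "sets \<mu> = sets borel"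
    by (auto simp: is_second_deriv_measure_def)
  show "AE x in \<mu>. x \<in> {0<..<1}"
    using assms * by (intro AE_I'[of "- {0<..<1}"]) (auto simp: null_sets_def is_second_deriv_measure_def)
qed

text \<open>\<open>F 0\<close> is the right derivative of \<eta> at 0, that is
  \<open>- h\<^sup>2\<close>. The integral over a tent is the difference of the potentials at 1 and
  \<open>s\<close>, and the affine part of the potential contributes the term with
  \<open>h\<^sup>2\<close>.\<close>

lemma classK_second_deriv_measure:
  assumes model: "is_model \<beta>" and K: "\<eta> \<in> classK h \<beta>"
  shows "is_second_deriv_measure \<eta> (second_deriv_measure \<eta>)"
    and "\<And>s. 0 \<le> s \<Longrightarrow> s \<le> 1 \<Longrightarrow>
      (\<integral>x. tent s x \<partial>second_deriv_measure \<eta>) = xi \<beta> 1 - \<eta> s + h\<^sup>2 * (1 - s)"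
proof -
  obtain r where r: "1 < r"
    "\<And>x. \<bar>x\<bar> < r \<Longrightarrow> (xi \<beta> has_real_derivative deriv (xi \<beta>) x) (at x)"
    "\<And>x. \<bar>x\<bar> < r \<Longrightarrow> (deriv (xi \<beta>) has_real_derivative deriv (deriv (xi \<beta>)) x) (at x)"
    "deriv (xi \<beta>) 0 = 0"
    using model_derivatives[OF model] by metis
  from K have \<eta>: "continuous_on {0..1} \<eta>" "convex_on {0..1} \<eta>" "\<And>x. x \<in> {0..1} \<Longrightarrow> xi \<beta> x \<le> \<eta> x"
    "\<eta> 1 = xi \<beta> 1" "((\<lambda>t. (\<eta> t - \<eta> 0) / t) \<longlongrightarrow> - h\<^sup>2) (at_right 0)"
    by (auto simp: classK_def has_right_deriv0_def r(4))
  have "continuous_on {0..1} (deriv (xi \<beta>))"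
    using r by (intro continuous_at_imp_continuous_on ballI DERIV_isCont[OF r(3)]) auto
  from compact_imp_bounded[OF compact_continuous_image[OF this]]
  obtain B where B: "\<forall>x\<in>{0..1}. \<bar>deriv (xi \<beta>) x\<bar> \<le> B"
    by (auto simp: bounded_iff)
  have slope: "(\<eta> s - \<eta> 0) / s \<le> (\<eta> u - \<eta> 0) / u" if "0 < s" "s < u" "u \<le> 1" for s u
    using convex_on_slope_le(1)[OF \<eta>(2), of 0 u s] that
    by (simp add: divide_simps) (simp add: algebra_simps)
  have slope_ge: "- h\<^sup>2 \<le> (\<eta> u - \<eta> 0) / u" if u: "0 < u" "u \<le> 1" for u
  proof (rule tendsto_upperbound[OF \<eta>(5)])
    show "\<forall>\<^sub>F s in at_right 0. (\<eta> s - \<eta> 0) / s \<le> (\<eta> u - \<eta> 0) / u"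
      using eventually_at_right_real[OF u(1)] by eventually_elim (use slope u in auto)
  qed simp
  \<comment> \<open>Since \<eta> lies above \<xi> and meets it at 1, chords of \<eta> ending at 1
    are no steeper than those of \<xi>, whose slopes are values of \<xi>'.\<close>
  interpret cf: convex_fun_01 \<eta> B
  proof
    fix t :: real assume t: "0 \<le> t" "t < 1"
    obtain z where z: "t < z" "z < 1" "xi \<beta> 1 - xi \<beta> t = (1 - t) * deriv (xi \<beta>) z"
      using MVT2[of t 1 "xi \<beta>" "deriv (xi \<beta>)"] r(1,2) t by auto
    have "\<eta> 1 - \<eta> t \<le> (1 - t) * deriv (xi \<beta>) z" using \<eta>(3)[of t] \<eta>(4) z t by simp
    also have "\<dots> \<le> (1 - t) * B"
      using B z t by (intro mult_left_mono) (auto simp: abs_le_iff)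
    finally show "\<eta> 1 - \<eta> t \<le> B * (1 - t)" by (simp add: mult.commute)
  qed (use \<eta> slope_ge in \<open>auto intro!: bdd_belowI2\<close>)
  have "- h\<^sup>2 \<le> cf.F 0"
    by (rule cf.F_greatest) (use slope_ge in auto)
  moreover have "cf.F 0 \<le> - h\<^sup>2"
  proof (rule tendsto_lowerbound[OF \<eta>(5)])
    show "\<forall>\<^sub>F s in at_right 0. cf.F 0 \<le> (\<eta> s - \<eta> 0) / s"
      using eventually_at_right_real[OF zero_less_one]
      by eventually_elim (use cf.F_lower[of 0] in auto)
  qed simp
  ultimately have F0: "cf.F 0 = - h\<^sup>2" by simp
  obtain \<mu> where \<mu>: "finite_measure \<mu>" "sets \<mu> = sets borel" "emeasure \<mu> (- {0<..<1}) = 0"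
    "\<And>t. t \<in> {0..1} \<Longrightarrow> (\<integral>x. max 0 (t - x) \<partial>\<mu>) = \<eta> t - \<eta> 0 - cf.F 0 * t"
    using cf.representing_measure by blast
  then have sd: "is_second_deriv_measure \<eta> \<mu>"
    by (intro is_second_deriv_measureI[where a = "\<eta> 0" and b = "cf.F 0"] \<eta>(1)) auto
  then have eq: "second_deriv_measure \<eta> = \<mu>" by (rule second_deriv_measure_eqI)
  with sd show "is_second_deriv_measure \<eta> (second_deriv_measure \<eta>)" by simp
  fix s :: real assume s: "0 \<le> s" "s \<le> 1"
  interpret finite_measure \<mu> by fact
  note AE = is_second_deriv_measure_D(3)[OF sd]
  note [measurable_cong] = \<mu>(2)
  have int: "integrable \<mu> (\<lambda>x. max 0 (u - x))" if "u \<le> 1" for u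
    by (rule integrable_const_bound[where B = 1]) (use AE that in \<open>auto elim!: eventually_mono\<close>)
  have "(\<integral>x. tent s x \<partial>\<mu>) = (\<integral>x. max 0 (1 - x) - max 0 (s - x) \<partial>\<mu>)"
    using AE s by (intro integral_cong_AE) (auto simp: tent_def elim!: eventually_mono)
  also have "\<dots> = (\<integral>x. max 0 (1 - x) \<partial>\<mu>) - (\<integral>x. max 0 (s - x) \<partial>\<mu>)"
    using int[of 1] int[of s] s by simp
  finally show "(\<integral>x. tent s x \<partial>second_deriv_measure \<eta>) = xi \<beta> 1 - \<eta> s + h\<^sup>2 * (1 - s)"
    using \<mu>(4)[of 1] \<mu>(4)[of s] s by (simp add: eq F0 \<eta>(4) algebra_simps)
qed

section \<open>Splitting the primal functional into a linear and an inverse part\<close>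

definition xi2_measure :: "(nat \<Rightarrow> real) \<Rightarrow> real measure" where
  "xi2_measure \<beta> = density lborel (\<lambda>x. ennreal (deriv (deriv (xi \<beta>)) x * indicator {0..1} x))"

lemma xi2_measure:
  assumes "is_model \<beta>"
  shows "finite_measure (xi2_measure \<beta>)" "sets (xi2_measure \<beta>) = sets borel"
    "AE x in xi2_measure \<beta>. x \<in> {0..1}"
    "g \<in> borel_measurable borel \<Longrightarrow> (\<integral>\<^sup>+x. g x \<partial>xi2_measure \<beta>) =
       (\<integral>\<^sup>+x. ennreal (deriv (deriv (xi \<beta>)) x * indicator {0..1} x) * g x \<partial>lborel)"
    "0 \<le> s \<Longrightarrow> s \<le> 1 \<Longrightarrow> (\<integral>x. tent s x \<partial>xi2_measure \<beta>) = xi \<beta> 1 - xi \<beta> s"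
    "x \<in> {0..1} \<Longrightarrow> 0 \<le> deriv (deriv (xi \<beta>)) x"
    "(\<lambda>x. deriv (deriv (xi \<beta>)) x * indicator {0..1} x) \<in> borel_measurable borel"
proof -
  obtain r where r: "1 < r" "\<And>x. \<bar>x\<bar> < r \<Longrightarrow> isCont (deriv (deriv (xi \<beta>))) x"
    "\<And>x. 0 \<le> x \<Longrightarrow> x < r \<Longrightarrow> 0 \<le> deriv (deriv (xi \<beta>)) x"
    using model_derivatives[OF assms] by metis
  let ?X2 = "\<lambda>x. deriv (deriv (xi \<beta>)) x * indicator {0..1} x"
  have "continuous_on {0..1} (deriv (deriv (xi \<beta>)))"
    using r by (intro continuous_at_imp_continuous_on) auto
  from borel_integrable_atLeastAtMost'[OF this]
  have int: "integrable lborel ?X2"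
    by (simp add: set_integrable_def mult.commute)
  then show meas: "?X2 \<in> borel_measurable borel"
    using borel_measurable_integrable by fastforce
  note [measurable] = meas
  have nonneg: "0 \<le> ?X2 x" for x using r by (auto split: split_indicator)
  show sets: "sets (xi2_measure \<beta>) = sets borel" by (simp add: xi2_measure_def)
  show "finite_measure (xi2_measure \<beta>)"
  proof
    have "emeasure (xi2_measure \<beta>) (space (xi2_measure \<beta>)) = (\<integral>\<^sup>+x. ennreal (?X2 x) \<partial>lborel)"
      unfolding xi2_measure_def by (subst emeasure_density) (auto intro!: nn_integral_cong)
    also have "\<dots> = ennreal (\<integral>x. ?X2 x \<partial>lborel)"
      by (rule nn_integral_eq_integral[OF int]) (use nonneg in auto)
    finally show "emeasure (xi2_measure \<beta>) (space (xi2_measure \<beta>)) \<noteq> \<infinity>" by simp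
  qed
  show "AE x in xi2_measure \<beta>. x \<in> {0..1}"
    unfolding xi2_measure_def by (subst AE_density) (auto split: split_indicator)
  show "(\<integral>\<^sup>+x. g x \<partial>xi2_measure \<beta>) = (\<integral>\<^sup>+x. ennreal (?X2 x) * g x \<partial>lborel)"
    if "g \<in> borel_measurable borel"
    unfolding xi2_measure_def using that by (subst nn_integral_density) auto
  show "(\<integral>x. tent s x \<partial>xi2_measure \<beta>) = xi \<beta> 1 - xi \<beta> s" if "0 \<le> s" "s \<le> 1"
    unfolding xi2_measure_def tent_integral_xi[OF assms that, symmetric] using nonneg
    by (subst integral_density) (auto intro!: Bochner_Integration.integral_cong)
  show "x \<in> {0..1} \<Longrightarrow> 0 \<le> deriv (deriv (xi \<beta>)) x"
    using r by auto
qed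

text \<open>The functional A of the overview. It is always finite and hence real; all infinite
  values of \<open>Pfun\<close> are left to \<open>Pinv\<close>.\<close>

definition Plin :: "real \<Rightarrow> (nat \<Rightarrow> real) \<Rightarrow> (real \<Rightarrow> real) \<Rightarrow> real" where
  "Plin h \<beta> \<phi> = (\<integral>x. clamp01 \<phi> x \<partial>xi2_measure \<beta>) + h\<^sup>2 * \<phi> 0"

definition Pinv :: "(real \<Rightarrow> real) \<Rightarrow> ennreal" where
  "Pinv \<phi> = (\<integral>\<^sup>+x\<in>{0..1}. inverse (ennreal (clamp01 \<phi> x)) \<partial>lborel)"

lemma Plin_nonneg: "\<phi> \<in> classC \<Longrightarrow> 0 \<le> Plin h \<beta> \<phi>"
  using clamp01_bounds[of \<phi>] classC_D(2)[of \<phi> 0] by (auto simp: Plin_def intro!: add_nonneg_nonneg)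

lemma Pfun_eq:
  assumes model: "is_model \<beta>" and C: "\<phi> \<in> classC"
  shows "Pfun h \<beta> \<phi> = ennreal (Plin h \<beta> \<phi>) + Pinv \<phi>"
proof -
  let ?X2 = "deriv (deriv (xi \<beta>))"
  note xi2 = xi2_measure[OF model]
  note [measurable] = xi2(7)
  have [measurable]: "clamp01 \<phi> \<in> borel_measurable borel"
    by (intro clamp01_measurable classC_D(1)[OF C])
  have "(\<integral>\<^sup>+ x \<in> {0..1}. (ennreal (?X2 x * \<phi> x)
        + (if \<phi> x = 0 then \<infinity> else ennreal (1 / \<phi> x))) \<partial>lborel) =
      (\<integral>\<^sup>+ x. ennreal (?X2 x * indicator {0..1} x) * ennreal (clamp01 \<phi> x)
        + inverse (ennreal (clamp01 \<phi> x)) * indicator {0..1} x \<partial>lborel)"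
  proof (rule nn_integral_cong)
    fix x
    show "(ennreal (?X2 x * \<phi> x) + (if \<phi> x = 0 then \<infinity> else ennreal (1 / \<phi> x))) * indicator {0..1} x =
       ennreal (?X2 x * indicator {0..1} x) * ennreal (clamp01 \<phi> x)
        + inverse (ennreal (clamp01 \<phi> x)) * indicator {0..1} x"
    proof (cases "x \<in> {0..1}")
      case True
      then have "(if \<phi> x = 0 then \<infinity> else ennreal (1 / \<phi> x)) = inverse (ennreal (\<phi> x))"
        using classC_D(2)[OF C, of x] by (auto simp: inverse_ennreal inverse_eq_divide)
      then show ?thesis
        using True xi2(6)[OF True] classC_D(2)[OF C, of x] by (simp add: ennreal_mult)
    qed simp
  qed
  also have "\<dots> = (\<integral>\<^sup>+ x. ennreal (clamp01 \<phi> x) \<partial>xi2_measure \<beta>) + Pinv \<phi>"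
    by (subst nn_integral_add) (auto simp: xi2(4) Pinv_def)
  also have "(\<integral>\<^sup>+ x. ennreal (clamp01 \<phi> x) \<partial>xi2_measure \<beta>) = ennreal (\<integral>x. clamp01 \<phi> x \<partial>xi2_measure \<beta>)"
    by (intro nn_integral_eq_integral clamp01_integrable C xi2) (use clamp01_bounds[OF C] in auto)
  finally show ?thesis
    using clamp01_bounds[OF C] classC_D(2)[OF C, of 0]
    by (simp add: Pfun_def Plin_def ennreal_plus add_ac)
qed

text \<open>On sets disjoint from \<open>N\<close> the decomposition says that \<mu> has density
  \<open>f\<close>, and \<open>N\<close> itself is invisible to Lebesgue measure. So \<mu>
  restricted to the complement of \<open>N\<close> equals \<open>f\<close> dx, and integrals split
  accordingly.\<close>

lemma is_ac_density_nn_integral: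
  assumes "is_ac_density \<mu> f" and [measurable_cong]: "sets \<mu> = sets borel"
  obtains N where "N \<in> null_sets lborel"
    "\<And>g. g \<in> borel_measurable borel \<Longrightarrow>
       (\<integral>\<^sup>+x. g x \<partial>\<mu>) = (\<integral>\<^sup>+x. ennreal (f x) * g x \<partial>lborel) + (\<integral>\<^sup>+x\<in>N. g x \<partial>\<mu>)"
proof -
  from assms obtain N where f [measurable]: "f \<in> borel_measurable borel" and N: "N \<in> null_sets lborel"
    and dec: "\<And>A. A \<in> sets borel \<Longrightarrow>
        emeasure \<mu> A = (\<integral>\<^sup>+ x \<in> A. ennreal (f x) \<partial>lborel) + emeasure \<mu> (A \<inter> N)"
    by (auto simp: is_ac_density_def)
  have [measurable]: "N \<in> sets borel" using N by auto
  have eq: "density \<mu> (indicator (- N)) = density lborel (\<lambda>x. ennreal (f x))"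
  proof (rule measure_eqI)
    fix A assume "A \<in> sets (density \<mu> (indicator (- N)))"
    then have [measurable]: "A \<in> sets borel" by (simp add: assms(2))
    have "emeasure (density \<mu> (indicator (- N))) A = (\<integral>\<^sup>+x. indicator (- N) x * indicator A x \<partial>\<mu>)"
      by (subst emeasure_density) auto
    also have "\<dots> = (\<integral>\<^sup>+x. indicator (A - N) x \<partial>\<mu>)"
      by (intro nn_integral_cong) (auto split: split_indicator)
    also have "\<dots> = emeasure \<mu> (A - N)" by simp
    also have "\<dots> = (\<integral>\<^sup>+ x \<in> A - N. ennreal (f x) \<partial>lborel)"
    proof -
      have "(A - N) \<inter> N = {}" by auto
      then show ?thesis by (subst dec) auto
    qed
    also have "\<dots> = (\<integral>\<^sup>+ x \<in> A. ennreal (f x) \<partial>lborel)"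
      using AE_not_in[OF N] by (intro nn_integral_cong_AE) (auto elim!: eventually_mono split: split_indicator)
    finally show "emeasure (density \<mu> (indicator (- N))) A = emeasure (density lborel (\<lambda>x. ennreal (f x))) A"
      by (subst (2) emeasure_density) auto
  qed (simp add: assms(2))
  show ?thesis
  proof (rule that[OF N])
    fix g :: "real \<Rightarrow> ennreal" assume [measurable]: "g \<in> borel_measurable borel"
    have "(\<integral>\<^sup>+x. g x \<partial>\<mu>) = (\<integral>\<^sup>+x. indicator (- N) x * g x + g x * indicator N x \<partial>\<mu>)"
      by (intro nn_integral_cong) (auto split: split_indicator)
    also have "\<dots> = (\<integral>\<^sup>+x. indicator (- N) x * g x \<partial>\<mu>) + (\<integral>\<^sup>+x\<in>N. g x \<partial>\<mu>)"
      by (rule nn_integral_add) auto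
    also have "(\<integral>\<^sup>+x. indicator (- N) x * g x \<partial>\<mu>) = (\<integral>\<^sup>+x. g x \<partial>density \<mu> (indicator (- N)))"
      by (subst nn_integral_density) auto
    also have "\<dots> = (\<integral>\<^sup>+x. ennreal (f x) * g x \<partial>lborel)"
      unfolding eq by (subst nn_integral_density) auto
    finally show "(\<integral>\<^sup>+x. g x \<partial>\<mu>) = (\<integral>\<^sup>+x. ennreal (f x) * g x \<partial>lborel) + (\<integral>\<^sup>+x\<in>N. g x \<partial>\<mu>)" .
  qed
qed

text \<open>The defect in the inequality \<open>2 sqrt f \<le> f p + 1 / p\<close>.\<close>

definition gap :: "real \<Rightarrow> real \<Rightarrow> ennreal" where
  "gap p f = (if p = 0 then \<infinity> else ennreal (p * (sqrt f - 1 / p)\<^sup>2))"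

lemma gap_identity:
  assumes "0 \<le> p" "0 \<le> f"
  shows "ennreal f * ennreal p + inverse (ennreal p) = ennreal (2 * sqrt f) + gap p f"
proof (cases "p = 0")
  case False
  then have p: "0 < p" using assms by simp
  have "f * p + 1 / p = 2 * sqrt f + p * (sqrt f - 1 / p)\<^sup>2"
    using p assms by (simp add: power2_diff field_simps power2_eq_square)
  then show ?thesis
    using p assms
    by (simp add: gap_def inverse_ennreal inverse_eq_divide ennreal_mult[symmetric] ennreal_plus[symmetric] del: ennreal_plus)
qed (simp add: gap_def)

lemma gap_eq_0:
  assumes "0 \<le> p" "0 \<le> f" "gap p f = 0"
  shows "f * p\<^sup>2 = 1"
proof -
  have p: "0 < p" using assms by (cases "p = 0") (auto simp: gap_def)
  with assms have "p * (sqrt f - 1 / p)\<^sup>2 \<le> 0" by (simp add: gap_def ennreal_eq_0_iff)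
  with p have "sqrt f = 1 / p" by (simp add: mult_le_0_iff)
  then have "f = (1 / p)\<^sup>2" using assms by (metis real_sqrt_pow2)
  then show ?thesis using p by (simp add: power_divide)
qed

lemma gap_measurable [measurable]:
  assumes [measurable]: "p \<in> borel_measurable M" "f \<in> borel_measurable M"
  shows "(\<lambda>x. gap (p x) (f x)) \<in> borel_measurable M"
  unfolding gap_def by measurable

text \<open>The Bochner integral in \<open>Dfun\<close> would be 0 by convention if its integrand
  were not integrable. It is integrable, since 2 sqrt f \<le> 1 + f and \<open>f\<close> is
  integrable as part of a finite measure.\<close>

lemma ennreal_Dfun:
  assumes "is_second_deriv_measure \<eta> (second_deriv_measure \<eta>)"
  shows "ennreal (Dfun \<eta>) = (\<integral>\<^sup>+x\<in>{0..1}. ennreal (2 * sqrt (ac_density \<eta> x)) \<partial>lborel)"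
proof -
  let ?\<mu> = "second_deriv_measure \<eta>"
  define f where "f = ac_density \<eta>"
  note mu = is_second_deriv_measure_D[OF assms]
  interpret finite_measure ?\<mu> by fact
  note [measurable_cong] = mu(2)
  have ac: "is_ac_density ?\<mu> f"
    unfolding f_def using mu by (intro is_ac_density_ac_density)
  have [measurable]: "f \<in> borel_measurable borel" and f0: "\<And>x. 0 \<le> f x"
    using ac by (auto simp: is_ac_density_def)
  obtain N where dec: "\<And>g. g \<in> borel_measurable borel \<Longrightarrow>
       (\<integral>\<^sup>+x. g x \<partial>?\<mu>) = (\<integral>\<^sup>+x. ennreal (f x) * g x \<partial>lborel) + (\<integral>\<^sup>+x\<in>N. g x \<partial>?\<mu>)"
    using is_ac_density_nn_integral[OF ac mu(2)] by metis
  have "(\<integral>\<^sup>+x. ennreal (f x) \<partial>lborel) \<le> (\<integral>\<^sup>+x. 1 \<partial>?\<mu>)"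
    by (subst dec) auto
  also have "\<dots> < \<infinity>" using emeasure_finite by (simp add: less_top[symmetric])
  finally have intf: "integrable lborel f"
    using f0 by (intro integrableI_nonneg) auto
  have "integrable lborel (\<lambda>x. indicator {0..1} x * (2 * sqrt (f x)))"
  proof (rule Bochner_Integration.integrable_bound)
    show "integrable lborel (\<lambda>x. indicator {0..1} x + f x)"
      using intf by (intro Bochner_Integration.integrable_add) auto
    show "AE x in lborel. norm (indicator {0..1} x * (2 * sqrt (f x))) \<le> norm (indicator {0..1} x + f x)"
    proof (rule AE_I2)
      fix x
      have "2 * sqrt (f x) * 1 \<le> (sqrt (f x))\<^sup>2 + 1\<^sup>2"
        using sum_squares_bound[of "sqrt (f x)" 1] by simp
      then show "norm (indicator {0..1} x * (2 * sqrt (f x))) \<le> norm (indicator {0..1} x + f x)"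
        using f0[of x] by (auto split: split_indicator)
    qed
  qed measurable
  then have "(\<integral>\<^sup>+x. ennreal (indicator {0..1} x * (2 * sqrt (f x))) \<partial>lborel) =
      ennreal (\<integral>x. indicator {0..1} x * (2 * sqrt (f x)) \<partial>lborel)"
    by (rule nn_integral_eq_integral) (use f0 in auto)
  also have "(\<integral>x. indicator {0..1} x * (2 * sqrt (f x)) \<partial>lborel) = Dfun \<eta>"
    by (simp add: Dfun_def set_lebesgue_integral_def f_def mult.left_commute[of _ 2])
  finally have "(\<integral>\<^sup>+x. ennreal (indicator {0..1} x * (2 * sqrt (f x))) \<partial>lborel) = ennreal (Dfun \<eta>)" .
  moreover have "(\<integral>\<^sup>+x\<in>{0..1}. ennreal (2 * sqrt (f x)) \<partial>lborel) =
      (\<integral>\<^sup>+x. ennreal (indicator {0..1} x * (2 * sqrt (f x))) \<partial>lborel)"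
    by (intro nn_integral_cong) (auto split: split_indicator)
  ultimately show ?thesis
    unfolding f_def by simp
qed

text \<open>Weak duality with both nonnegative losses kept: the pointwise defect \<open>gap\<close>
  and the mass that \<phi> collects from the singular part. Weak duality discards them; in the
  equality case both must vanish, and the same \<open>N\<close> is then used to decompose further
  integrals.\<close>

lemma duality_gap:
  assumes model: "is_model \<beta>" and K: "\<eta> \<in> classK h \<beta>" and C: "\<phi> \<in> classC"
  obtains N where "N \<in> null_sets lborel"
    "\<And>g. g \<in> borel_measurable borel \<Longrightarrow> (\<integral>\<^sup>+x. g x \<partial>second_deriv_measure \<eta>) =
       (\<integral>\<^sup>+x. ennreal (ac_density \<eta> x) * g x \<partial>lborel) + (\<integral>\<^sup>+x\<in>N. g x \<partial>second_deriv_measure \<eta>)"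
    "ennreal (Dfun \<eta>) + (\<integral>\<^sup>+x\<in>{0..1}. gap (clamp01 \<phi> x) (ac_density \<eta> x) \<partial>lborel)
       + (\<integral>\<^sup>+x\<in>N. ennreal (clamp01 \<phi> x) \<partial>second_deriv_measure \<eta>) \<le> Pfun h \<beta> \<phi>"
proof -
  define \<mu> where "\<mu> = second_deriv_measure \<eta>"
  define f where "f = ac_density \<eta>"
  have sd: "is_second_deriv_measure \<eta> \<mu>"
    unfolding \<mu>_def by (rule classK_second_deriv_measure[OF model K])
  note mu = is_second_deriv_measure_D[OF sd]
  note xi2 = xi2_measure[OF model]
  note [measurable_cong] = mu(2)
  have ac: "is_ac_density \<mu> f"
    unfolding f_def \<mu>_def using mu by (intro is_ac_density_ac_density) (auto simp: \<mu>_def)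
  have [measurable]: "f \<in> borel_measurable borel" and f0: "\<And>x. 0 \<le> f x"
    using ac by (auto simp: is_ac_density_def)
  have [measurable]: "clamp01 \<phi> \<in> borel_measurable borel"
    by (intro clamp01_measurable classC_D(1)[OF C])
  obtain N where N: "N \<in> null_sets lborel" and dec: "\<And>g. g \<in> borel_measurable borel \<Longrightarrow>
       (\<integral>\<^sup>+x. g x \<partial>\<mu>) = (\<integral>\<^sup>+x. ennreal (f x) * g x \<partial>lborel) + (\<integral>\<^sup>+x\<in>N. g x \<partial>\<mu>)"
    using is_ac_density_nn_integral[OF ac mu(2)] by metis
  have "(\<integral>x. clamp01 \<phi> x \<partial>\<mu>) \<le> Plin h \<beta> \<phi>"
    unfolding Plin_def
  proof (rule concave_order[OF C mu xi2(1-3)])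
    fix s :: real assume s: "0 \<le> s" "s < 1"
    have "xi \<beta> s \<le> \<eta> s" using K s by (auto simp: classK_def)
    then show "(\<integral>x. tent s x \<partial>\<mu>) \<le> (\<integral>x. tent s x \<partial>xi2_measure \<beta>) + h\<^sup>2 * (1 - s)"
      using classK_second_deriv_measure(2)[OF model K, of s] xi2(5)[of s] s
      by (simp add: \<mu>_def)
  qed
  then have "ennreal (\<integral>x. clamp01 \<phi> x \<partial>\<mu>) \<le> ennreal (Plin h \<beta> \<phi>)"
    by (rule ennreal_leI)
  moreover have "ennreal (\<integral>x. clamp01 \<phi> x \<partial>\<mu>) = (\<integral>\<^sup>+x. ennreal (clamp01 \<phi> x) \<partial>\<mu>)"
    by (intro nn_integral_eq_integral[symmetric] clamp01_integrable C mu) (use clamp01_bounds[OF C] in auto)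
  ultimately have le1: "(\<integral>\<^sup>+x. ennreal (f x) * ennreal (clamp01 \<phi> x) \<partial>lborel) + (\<integral>\<^sup>+x\<in>N. ennreal (clamp01 \<phi> x) \<partial>\<mu>) + Pinv \<phi> \<le> Pfun h \<beta> \<phi>"
    unfolding Pfun_eq[OF model C] by (intro add_right_mono) (simp add: dec)
  have le2: "ennreal (Dfun \<eta>) + (\<integral>\<^sup>+x\<in>{0..1}. gap (clamp01 \<phi> x) (f x) \<partial>lborel)
      \<le> (\<integral>\<^sup>+x. ennreal (f x) * ennreal (clamp01 \<phi> x) \<partial>lborel) + Pinv \<phi>"
  proof -
    have "ennreal (Dfun \<eta>) + (\<integral>\<^sup>+x\<in>{0..1}. gap (clamp01 \<phi> x) (f x) \<partial>lborel) =
        (\<integral>\<^sup>+x\<in>{0..1}. (ennreal (2 * sqrt (f x)) + gap (clamp01 \<phi> x) (f x)) \<partial>lborel)"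
      unfolding ennreal_Dfun[OF sd[unfolded \<mu>_def]] f_def[symmetric]
      by (subst nn_integral_add[symmetric]) (auto simp: distrib_right)
    also have "\<dots> = (\<integral>\<^sup>+x\<in>{0..1}. (ennreal (f x) * ennreal (clamp01 \<phi> x) + inverse (ennreal (clamp01 \<phi> x))) \<partial>lborel)"
      using gap_identity[OF clamp01_bounds(1)[OF C] f0] by simp
    also have "\<dots> = (\<integral>\<^sup>+x\<in>{0..1}. ennreal (f x) * ennreal (clamp01 \<phi> x) \<partial>lborel) + Pinv \<phi>"
      unfolding Pinv_def by (subst nn_integral_add[symmetric]) (auto simp: distrib_right)
    also have "\<dots> \<le> (\<integral>\<^sup>+x. ennreal (f x) * ennreal (clamp01 \<phi> x) \<partial>lborel) + Pinv \<phi>"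
      by (intro add_right_mono nn_integral_mono) (auto split: split_indicator)
    finally show ?thesis .
  qed
  have "ennreal (Dfun \<eta>) + (\<integral>\<^sup>+x\<in>{0..1}. gap (clamp01 \<phi> x) (f x) \<partial>lborel)
       + (\<integral>\<^sup>+x\<in>N. ennreal (clamp01 \<phi> x) \<partial>\<mu>) \<le> Pfun h \<beta> \<phi>"
    using order_trans[OF add_right_mono[OF le2], of "\<integral>\<^sup>+x\<in>N. ennreal (clamp01 \<phi> x) \<partial>\<mu>"] le1
    by (simp only: add_ac)
  then show ?thesis
    using that[OF N] dec unfolding f_def \<mu>_def by blast
qed

lemma weak_duality:
  assumes "is_model \<beta>" "\<eta> \<in> classK h \<beta>" "\<phi> \<in> classC"
  shows "ennreal (Dfun \<eta>) \<le> Pfun h \<beta> \<phi>"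
proof -
  obtain N where "ennreal (Dfun \<eta>) + (\<integral>\<^sup>+x\<in>{0..1}. gap (clamp01 \<phi> x) (ac_density \<eta> x) \<partial>lborel)
       + (\<integral>\<^sup>+x\<in>N. ennreal (clamp01 \<phi> x) \<partial>second_deriv_measure \<eta>) \<le> Pfun h \<beta> \<phi>"
    by (rule duality_gap[OF assms])
  then show ?thesis
    by (rule order_trans[rotated]) (simp add: add.assoc)
qed

lemma Dfun_nonneg:
  assumes "is_model \<beta>" "\<eta> \<in> classK h \<beta>"
  shows "0 \<le> Dfun \<eta>"
proof -
  note mu = is_second_deriv_measure_D[OF classK_second_deriv_measure(1)[OF assms]]
  have "\<forall>x. 0 \<le> ac_density \<eta> x"
    using is_ac_density_ac_density[OF mu(1,2)] by (simp add: is_ac_density_def)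
  then show ?thesis
    by (auto simp: Dfun_def set_lebesgue_integral_def)
qed

text \<open>\<open>ennreal (Dfun \<eta>)\<close> is finite and cancels from the duality gap, so both
  losses are 0. The weight \<open>(\<phi> x)\<^sup>2\<close> then kills the singular part and turns
  the density into 1.\<close>

lemma equality_case:
  assumes model: "is_model \<beta>" and K: "\<eta> \<in> classK h \<beta>" and C: "\<phi> \<in> classC"
    and eq: "Pfun h \<beta> \<phi> = ennreal (Dfun \<eta>)" and A [measurable]: "A \<in> sets borel"
  shows "(\<integral>\<^sup>+ x \<in> A. ennreal ((\<phi> x)\<^sup>2) \<partial>second_deriv_measure \<eta>) = emeasure lborel (A \<inter> {0..1})"
proof -
  define \<mu> where "\<mu> = second_deriv_measure \<eta>"
  define f where "f = ac_density \<eta>"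
  have sd: "is_second_deriv_measure \<eta> \<mu>"
    unfolding \<mu>_def by (rule classK_second_deriv_measure[OF model K])
  note mu = is_second_deriv_measure_D[OF sd]
  note [measurable_cong] = mu(2)
  have ac: "is_ac_density \<mu> f"
    unfolding f_def \<mu>_def using mu by (intro is_ac_density_ac_density) (auto simp: \<mu>_def)
  have [measurable]: "f \<in> borel_measurable borel" and f0: "\<And>x. 0 \<le> f x"
    using ac by (auto simp: is_ac_density_def)
  have [measurable]: "clamp01 \<phi> \<in> borel_measurable borel"
    by (intro clamp01_measurable classC_D(1)[OF C])
  obtain N where N: "N \<in> null_sets lborel" and dec: "\<And>g. g \<in> borel_measurable borel \<Longrightarrow>
       (\<integral>\<^sup>+x. g x \<partial>\<mu>) = (\<integral>\<^sup>+x. ennreal (f x) * g x \<partial>lborel) + (\<integral>\<^sup>+x\<in>N. g x \<partial>\<mu>)"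
    and gap: "ennreal (Dfun \<eta>) + (\<integral>\<^sup>+x\<in>{0..1}. gap (clamp01 \<phi> x) (f x) \<partial>lborel)
       + (\<integral>\<^sup>+x\<in>N. ennreal (clamp01 \<phi> x) \<partial>\<mu>) \<le> ennreal (Dfun \<eta>)"
    by (rule duality_gap[OF model K C, folded f_def \<mu>_def, unfolded eq]) (rule that)
  have [measurable]: "N \<in> sets borel" using N by auto
  have "ennreal (Dfun \<eta>) + ((\<integral>\<^sup>+x\<in>{0..1}. gap (clamp01 \<phi> x) (f x) \<partial>lborel)
       + (\<integral>\<^sup>+x\<in>N. ennreal (clamp01 \<phi> x) \<partial>\<mu>)) \<le> ennreal (Dfun \<eta>) + 0"
    using gap by (simp add: add.assoc)
  then have "(\<integral>\<^sup>+x\<in>{0..1}. gap (clamp01 \<phi> x) (f x) \<partial>lborel)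
       + (\<integral>\<^sup>+x\<in>N. ennreal (clamp01 \<phi> x) \<partial>\<mu>) \<le> 0"
    by (subst (asm) ennreal_add_left_cancel_le) auto
  then have g0: "(\<integral>\<^sup>+x\<in>{0..1}. gap (clamp01 \<phi> x) (f x) \<partial>lborel) = 0"
    and n0: "(\<integral>\<^sup>+x\<in>N. ennreal (clamp01 \<phi> x) \<partial>\<mu>) = 0" by auto
  from n0 have AE1: "AE x in \<mu>. ennreal (clamp01 \<phi> x) * indicator N x = 0"
    by (subst (asm) nn_integral_0_iff_AE) auto
  from g0 have AE2: "AE x in lborel. gap (clamp01 \<phi> x) (f x) * indicator {0..1} x = 0"
    by (subst (asm) nn_integral_0_iff_AE) auto
  \<comment> \<open>The set \<open>A\<close> ranges over the whole line, so \<open>f\<close> also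
    has to vanish almost everywhere outside \<open>{0..1}\<close>; it does because \<mu> has no mass
    there.\<close>
  have "(\<integral>\<^sup>+x. ennreal (f x) * indicator (- {0..1}) x \<partial>lborel) \<le> (\<integral>\<^sup>+x. indicator (- {0..1}) x \<partial>\<mu>)"
    by (subst dec) auto
  also have "\<dots> = (\<integral>\<^sup>+x. 0 \<partial>\<mu>)"
    by (intro nn_integral_cong_AE eventually_mono[OF mu(3)]) (auto split: split_indicator)
  finally have "AE x in lborel. ennreal (f x) * indicator (- {0..1}) x = 0"
    by (subst nn_integral_0_iff_AE[symmetric]) auto
  with AE2 have AE3: "AE x in lborel. ennreal (f x) * ennreal ((clamp01 \<phi> x)\<^sup>2) = indicator {0..1} x"
  proof eventually_elim
    case (elim x)
    show ?case
    proof (cases "x \<in> {0..1}")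
      case True
      then have "gap (clamp01 \<phi> x) (f x) = 0" using elim by simp
      from gap_eq_0[OF clamp01_bounds(1)[OF C] f0 this]
      have "f x * (clamp01 \<phi> x)\<^sup>2 = 1" .
      then show ?thesis using True f0[of x] by (simp add: ennreal_mult[symmetric])
    qed (use elim in auto)
  qed
  have "(\<integral>\<^sup>+ x \<in> A. ennreal ((\<phi> x)\<^sup>2) \<partial>\<mu>) = (\<integral>\<^sup>+ x \<in> A. ennreal ((clamp01 \<phi> x)\<^sup>2) \<partial>\<mu>)"
    by (intro nn_integral_cong_AE eventually_mono[OF mu(3)]) auto
  also have "\<dots> = (\<integral>\<^sup>+x. ennreal (f x) * (ennreal ((clamp01 \<phi> x)\<^sup>2) * indicator A x) \<partial>lborel)
      + (\<integral>\<^sup>+x\<in>N. ennreal ((clamp01 \<phi> x)\<^sup>2) * indicator A x \<partial>\<mu>)"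
    by (rule dec) measurable
  also have "(\<integral>\<^sup>+x\<in>N. ennreal ((clamp01 \<phi> x)\<^sup>2) * indicator A x \<partial>\<mu>) = (\<integral>\<^sup>+x. 0 \<partial>\<mu>)"
    using clamp01_bounds(1)[OF C]
    by (intro nn_integral_cong_AE eventually_mono[OF AE1])
       (auto simp: ennreal_eq_0_iff power2_eq_square mult_le_0_iff split: split_indicator_asm split_indicator)
  also have "(\<integral>\<^sup>+x. ennreal (f x) * (ennreal ((clamp01 \<phi> x)\<^sup>2) * indicator A x) \<partial>lborel) =
      (\<integral>\<^sup>+x. indicator (A \<inter> {0..1}) x \<partial>lborel)"
    by (intro nn_integral_cong_AE eventually_mono[OF AE3])
       (simp add: mult.assoc[symmetric] indicator_inter_arith, rule mult.commute)
  finally show ?thesis by (simp add: \<mu>_def)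
qed

section \<open>Existence of a minimizer\<close>

lemma concave_on_limit:
  fixes f :: "nat \<Rightarrow> real \<Rightarrow> real"
  assumes "\<And>n. concave_on S (f n)" and lim: "\<And>x. x \<in> S \<Longrightarrow> (\<lambda>n. f n x) \<longlonglongrightarrow> g x"
  shows "concave_on S g"
  unfolding concave_on_iff
proof (intro conjI ballI allI impI)
  show "convex S" using assms(1)[of 0] by (simp add: concave_on_iff)
  fix x y u v :: real assume *: "x \<in> S" "y \<in> S" "0 \<le> u" "0 \<le> v" "u + v = 1"
  then have "u *\<^sub>R x + v *\<^sub>R y \<in> S"
    using \<open>convex S\<close> by (simp add: convex_def)
  from lim[OF this] show "u * g x + v * g y \<le> g (u *\<^sub>R x + v *\<^sub>R y)"
  proof (rule LIMSEQ_le[rotated])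
    show "(\<lambda>n. u * f n x + v * f n y) \<longlonglongrightarrow> u * g x + v * g y"
      using * by (intro tendsto_intros lim)
    show "\<exists>N. \<forall>n\<ge>N. u * f n x + v * f n y \<le> f n (u *\<^sub>R x + v *\<^sub>R y)"
      using * assms(1) by (auto simp: concave_on_iff)
  qed
qed

text \<open>By concavity the decrease before \<open>y\<close> is no faster than that between
  \<open>y\<close> and \<open>z\<close>, where at most \<open>M\<close> can be lost. The bound is
  uniform over all functions below \<open>M\<close>, which supplies equicontinuity away from
  1.\<close>

lemma concave_decrease_bound:
  fixes \<phi> :: "real \<Rightarrow> real"
  assumes "concave_on S \<phi>" "x \<in> S" "z \<in> S" "x < y" "y < z"
    and "0 \<le> \<phi> z" "\<phi> y \<le> M"
  shows "\<phi> x - \<phi> y \<le> M / (z - y) * (y - x)"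
proof -
  have cv: "convex_on S (\<lambda>x. - \<phi> x)" using assms(1) by (simp add: concave_on_def)
  have "(- \<phi> x - - \<phi> y) / (x - y) \<le> (- \<phi> y - - \<phi> z) / (y - z)"
    using convex_on_slope_le[OF cv assms(2-5)] by linarith
  then have "(\<phi> x - \<phi> y) / (y - x) \<le> (\<phi> y - \<phi> z) / (z - y)"
    using assms(4,5) by (simp add: divide_simps) (simp add: algebra_simps)
  also have "\<dots> \<le> M / (z - y)"
    using assms by (intro divide_right_mono) auto
  finally show ?thesis
    using assms(4) by (simp add: pos_divide_le_eq)
qed

text \<open>Up to any u < 1 the function is Lipschitz with constant \<phi> 0 / (1 - u). At 1 a
  monotone function can only fail to be continuous by a jump, which \<open>end1\<close>
  excludes.\<close>

lemma continuous_on_concave_antimono: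
  fixes \<phi> :: "real \<Rightarrow> real"
  assumes conc: "concave_on {0..1} \<phi>" and nonneg: "\<And>x. x \<in> {0..1} \<Longrightarrow> 0 \<le> \<phi> x"
    and anti: "\<And>x y. 0 \<le> x \<Longrightarrow> x \<le> y \<Longrightarrow> y \<le> 1 \<Longrightarrow> \<phi> y \<le> \<phi> x"
    and end1: "\<And>m. \<phi> 1 < m \<Longrightarrow> \<exists>x. 0 \<le> x \<and> x < 1 \<and> \<phi> x < m"
  shows "continuous_on {0..1} \<phi>"
  unfolding continuous_on_eq_continuous_within
proof
  fix x0 :: real assume x0: "x0 \<in> {0..1}"
  show "continuous (at x0 within {0..1}) \<phi>"
  proof (cases "x0 = 1")
    case True
    show ?thesis
      unfolding continuous_within True
    proof (rule order_tendstoI)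
      fix m assume m: "m < \<phi> 1"
      have "m < \<phi> x" if "x \<in> {0..1}" for x
        using anti[of x 1] that m by auto
      then show "\<forall>\<^sub>F x in at 1 within {0..1}. m < \<phi> x"
        by (auto simp: eventually_at_filter)
    next
      fix m assume "\<phi> 1 < m"
      then obtain y where y: "0 \<le> y" "y < 1" "\<phi> y < m" using end1 by blast
      have "\<forall>\<^sub>F x in nhds 1. y < x" using y by (intro order_tendstoD(1)[OF filterlim_ident])
      then show "\<forall>\<^sub>F x in at 1 within {0..1}. \<phi> x < m"
        unfolding eventually_at_filter
      proof eventually_elim
        case (elim x)
        then show ?case using anti[of y x] y by auto
      qed
    qed
  next
    case False
    define u where "u = (1 + x0) / 2"
    have u: "x0 < u" "u < 1" "0 \<le> u" using x0 False by (auto simp: u_def)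
    define L where "L = \<phi> 0 / (1 - u)"
    have L0: "0 \<le> L" using u nonneg[of 0] by (simp add: L_def)
    have bound: "\<bar>\<phi> x - \<phi> y\<bar> \<le> L * \<bar>x - y\<bar>" if "0 \<le> x" "x < y" "y \<le> u" for x y
    proof -
      have "\<phi> x - \<phi> y \<le> \<phi> 0 / (1 - y) * (y - x)"
        by (rule concave_decrease_bound[OF conc]) (use that u nonneg[of 1] anti[of 0 y] in auto)
      also have "\<dots> \<le> L * (y - x)"
        unfolding L_def using that u nonneg[of 0] by (intro mult_right_mono divide_left_mono) auto
      finally show ?thesis using anti[of x y] that u by auto
    qed
    have "L-lipschitz_on {0..u} \<phi>"
    proof (rule lipschitz_onI[OF _ L0])
      fix x y assume "x \<in> {0..u}" "y \<in> {0..u}"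
      then show "dist (\<phi> x) (\<phi> y) \<le> L * dist x y"
        using bound[of x y] bound[of y x] by (cases x y rule: linorder_cases) (auto simp: dist_real_def abs_minus_commute)
    qed
    then have "continuous_on {0..u} \<phi>" by (rule lipschitz_on_continuous_on)
    then have "continuous (at x0 within {0..u}) \<phi>"
      using x0 u by (auto simp: continuous_on_eq_continuous_within)
    moreover have "at x0 within {0..u} = at x0 within {0..1}"
      by (rule at_within_nhd[of _ "{..<u}"]) (use x0 u in auto)
    ultimately show ?thesis by simp
  qed
qed

text \<open>The graph lies above its chord over [0, 1], and the chord lies above the one with end
  value 0 because \<phi> 1 \<ge> 0.\<close>

lemma classC_tent_lower:
  assumes C: "\<phi> \<in> classC"
  shows "\<phi> 0 * tent 0 x \<le> clamp01 \<phi> x"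
proof -
  define y where "y = max 0 (min 1 x)"
  have y: "0 \<le> y" "y \<le> 1" by (auto simp: y_def)
  have "convex_on {0..1} (\<lambda>x. - \<phi> x)" using classC_D(4)[OF C] by (simp add: concave_on_def)
  from convex_onD[OF this, of y 0 1] y have "(1 - y) * \<phi> 0 + y * \<phi> 1 \<le> \<phi> y" by simp
  moreover have "0 \<le> y * \<phi> 1" using y classC_D(2)[OF C, of 1] by simp
  moreover have "tent 0 x = 1 - y" by (auto simp: tent_def y_def)
  ultimately show ?thesis by (simp add: clamp01_def y_def[symmetric] mult.commute)
qed

text \<open>Coercivity: the lower bound by \<open>tent 0\<close> is integrated against \<xi>''. As
  \<xi> 1 > 0, a bound on \<open>Plin\<close> bounds \<phi> 0 and with it all values of
  \<phi>.\<close>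

lemma classC_at_0_le_Plin:
  assumes model: "is_model \<beta>" and C: "\<phi> \<in> classC"
  shows "\<phi> 0 * xi \<beta> 1 \<le> Plin h \<beta> \<phi>"
proof -
  note xi2 = xi2_measure[OF model]
  interpret finite_measure "xi2_measure \<beta>" by (rule xi2(1))
  note [measurable_cong] = xi2(2)
  have "xi \<beta> 0 = 0" using model_derivatives[OF model] by metis
  then have "\<phi> 0 * xi \<beta> 1 = (\<integral>x. \<phi> 0 * tent 0 x \<partial>xi2_measure \<beta>)"
    using xi2(5)[of 0] by simp
  also have "\<dots> \<le> (\<integral>x. clamp01 \<phi> x \<partial>xi2_measure \<beta>)"
  proof (rule integral_mono)
    show "integrable (xi2_measure \<beta>) (\<lambda>x. \<phi> 0 * tent 0 x)"
      by (intro integrable_mult_right integrable_const_bound[where B = 1]) (auto simp: tent_bounds)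
  qed (use clamp01_integrable[OF C xi2(1,2)] classC_tent_lower[OF C] in auto)
  finally show ?thesis
    using classC_D(2)[OF C, of 0] unfolding Plin_def by (auto intro: add_increasing2)
qed

text \<open>A selection argument: a diagonal subsequence converges at the rationals, and the
  Lipschitz bound on \<open>{0..u}\<close>, uniform in \<open>n\<close> for each u < 1, carries
  convergence over to all points before 1.\<close>

lemma classC_bounded_subsequence:
  assumes C: "\<And>n. \<phi> n \<in> classC" and M: "\<And>n. \<phi> n 0 \<le> M"
  obtains k \<psi> where "strict_mono (k :: nat \<Rightarrow> nat)" "\<psi> \<in> classC"
    "\<And>x. 0 \<le> x \<Longrightarrow> x < 1 \<Longrightarrow> (\<lambda>n. \<phi> (k n) x) \<longlonglongrightarrow> \<psi> x"
proof -
  have bnd: "0 \<le> \<phi> n x" "\<phi> n x \<le> M" if "0 \<le> x" "x \<le> 1" for n x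
    using classC_D(2)[OF C] classC_D(3)[OF C, of 0 x n] M[of n] that by (auto intro: order_trans)
  have M0: "0 \<le> M" using bnd[of 0 0] by simp
  obtain k where k: "strict_mono (k :: nat \<Rightarrow> nat)"
    and conv_rat: "\<And>x. x \<in> \<rat> \<inter> {0..1} \<Longrightarrow> \<exists>l. (\<lambda>n. \<phi> (k n) x) \<longlonglongrightarrow> l"
    by (rule function_convergent_subsequence[of "\<rat> \<inter> {0..1}" \<phi> M])
       (use bnd countable_rat in \<open>auto intro: countable_Int1\<close>)
  define f where "f n = \<phi> (k n)" for n
  have conv: "convergent (\<lambda>n. f n x)" if x: "0 \<le> x" "x < 1" for x
  proof -
    have "Cauchy (\<lambda>n. f n x)"
    proof (rule metric_CauchyI)
      fix e :: real assume e: "0 < e"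
      define u where "u = (1 + x) / 2"
      have u: "x < u" "u < 1" using x by (auto simp: u_def)
      \<comment> \<open>Before \<open>u\<close> all \<open>f n\<close> decrease at rate at most (M +
        1) / (1 - u), so points this close have values within e / 3. Using \<open>M + 1\<close>
        keeps the divisor positive.\<close>
      define r where "r = min u (x + e / 3 * (1 - u) / (M + 1))"
      have "x < r" using u e M0 by (auto simp: r_def)
      then obtain q where q: "q \<in> \<rat>" "x < q" "q < r" using Rats_dense_in_real by blast
      have q': "q < u" "q < x + e / 3 * (1 - u) / (M + 1)" using q by (auto simp: r_def)
      have small: "\<bar>f n x - f n q\<bar> < e / 3" for n
      proof -
        have "f n x - f n q \<le> M / (1 - q) * (q - x)"
          unfolding f_def
          by (rule concave_decrease_bound[OF classC_D(4)[OF C]]) (use q q' u x bnd[of 1] bnd[of q] in auto)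
        also have "\<dots> \<le> (M + 1) / (1 - u) * (q - x)"
          using q q' u M0 by (intro mult_right_mono frac_le) auto
        also have "\<dots> < (M + 1) / (1 - u) * (e / 3 * (1 - u) / (M + 1))"
          using q' u M0 by (intro mult_strict_left_mono) auto
        also have "\<dots> = e / 3"
        proof -
          have cancel: "a / b * (c * b / a) = c" if "a \<noteq> 0" "b \<noteq> 0" for a b c :: real
            using that by simp
          show ?thesis by (rule cancel) (use u M0 in auto)
        qed
        finally show ?thesis
          using classC_D(3)[OF C, of x q "k n"] q q' u x by (auto simp: f_def)
      qed
      have "Cauchy (\<lambda>n. f n q)"
        using conv_rat[of q] q q' u x unfolding f_def by (auto dest: LIMSEQ_imp_Cauchy)
      then obtain N where N: "\<And>m n. m \<ge> N \<Longrightarrow> n \<ge> N \<Longrightarrow> dist (f m q) (f n q) < e / 3"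
        using e metric_CauchyD[of _ "e / 3"] by (metis divide_pos_pos zero_less_numeral)
      show "\<exists>N. \<forall>m\<ge>N. \<forall>n\<ge>N. dist (f m x) (f n x) < e"
      proof (intro exI allI impI)
        fix m n assume "N \<le> m" "N \<le> n"
        then show "dist (f m x) (f n x) < e"
          using N[of m n] small[of m] small[of n] unfolding dist_real_def by linarith
      qed
    qed
    then show ?thesis by (rule Cauchy_convergent)
  qed
  define g where "g x = lim (\<lambda>n. f n x)" for x
  have lim: "(\<lambda>n. f n x) \<longlonglongrightarrow> g x" if "0 \<le> x" "x < 1" for x
    unfolding g_def using conv[OF that] by (simp add: convergent_LIMSEQ_iff)
  have g_anti: "g y \<le> g x" if "0 \<le> x" "x \<le> y" "y < 1" for x y
    by (rule LIMSEQ_le[OF lim lim]) (use that classC_D(3)[OF C] in \<open>auto simp: f_def\<close>)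
  have g_nonneg: "0 \<le> g x" if "0 \<le> x" "x < 1" for x
    by (rule LIMSEQ_le_const[OF lim]) (use that bnd in \<open>auto simp: f_def\<close>)
  have g_concave: "concave_on {0..<1} g"
  proof (rule concave_on_limit)
    show "concave_on {0..<1} (f n)" for n
      using classC_D(4)[OF C, of "k n"] by (auto simp: f_def concave_on_def intro: convex_on_subset)
  qed (use lim in auto)
  \<comment> \<open>The limit of the values at 1 may be wrong: min 1 (n (1 - x)) is 0 at 1 but tends
    to 1 before it. The infimum is the left limit of the monotone \<open>g\<close>, the only value
    that makes \<psi> continuous.\<close>
  define \<psi> where "\<psi> x = (if x < 1 then g x else Inf (g ` {0..<1}))" for x
  have bdd: "bdd_below (g ` {0..<1})" using g_nonneg by (intro bdd_belowI2[where m = 0]) auto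
  have psi1_le: "\<psi> 1 \<le> g x" if "0 \<le> x" "x < 1" for x
    using bdd that by (auto simp: \<psi>_def intro!: cInf_lower)
  have psi1_ge: "m \<le> \<psi> 1" if "\<And>x. 0 \<le> x \<Longrightarrow> x < 1 \<Longrightarrow> m \<le> g x" for m
    using that by (auto simp: \<psi>_def intro!: cInf_greatest)
  have psi_nonneg: "0 \<le> \<psi> x" if "x \<in> {0..1}" for x
    using that g_nonneg psi1_ge[of 0] by (cases "x = 1") (auto simp: \<psi>_def)
  have psi_anti: "\<psi> y \<le> \<psi> x" if "0 \<le> x" "x \<le> y" "y \<le> 1" for x y
    using that g_anti psi1_le[of x] by (cases "y = 1"; cases "x = 1") (auto simp: \<psi>_def)
  have end1: "\<exists>x. 0 \<le> x \<and> x < 1 \<and> \<psi> x < m" if "\<psi> 1 < m" for m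
    using psi1_ge[of m] that by (force simp: \<psi>_def)
  \<comment> \<open>Concavity of \<open>g\<close> is known on the half-open interval only. Its
    dilations are concave on the closed one and tend pointwise to \<psi>.\<close>
  have psi_concave: "concave_on {0..1} \<psi>"
  proof (rule concave_on_limit)
    define d where "d n = inverse (real (Suc (Suc n)))" for n
    have d: "0 < d n" "d n < 1" for n by (auto simp: d_def inverse_eq_divide)
    have d0: "d \<longlonglongrightarrow> 0" unfolding d_def by (rule LIMSEQ_Suc[OF LIMSEQ_inverse_real_of_nat])
    have dx: "0 \<le> (1 - d n) * x" "(1 - d n) * x < 1" "(1 - d n) * x \<le> x" if "0 \<le> x" "x \<le> 1" for n x
    proof -
      show "0 \<le> (1 - d n) * x" "(1 - d n) * x \<le> x"
        using d[of n] that by (auto simp: mult_left_le_one_le)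
      have "(1 - d n) * x \<le> 1 - d n" using d[of n] that by (simp add: mult_left_le)
      then show "(1 - d n) * x < 1" using d[of n] by linarith
    qed
    show "concave_on {0..1} (\<lambda>x. g ((1 - d n) * x))" for n
      by (rule concave_on_dilation[OF g_concave]) (use dx in auto)
    fix x :: real assume x: "x \<in> {0..1}"
    show "(\<lambda>n. g ((1 - d n) * x)) \<longlonglongrightarrow> \<psi> x"
    proof (cases "x = 1")
      case True
      show ?thesis
      proof (rule order_tendstoI)
        fix m assume "m < \<psi> x"
        then show "\<forall>\<^sub>F n in sequentially. m < g ((1 - d n) * x)"
          using psi1_le dx[of 1] True by (auto intro!: always_eventually intro: less_le_trans)
      next
        fix m assume "\<psi> x < m"
        then obtain y where y: "0 \<le> y" "y < 1" "g y < m"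
          using psi1_ge[of m] True by force
        have "(\<lambda>n. 1 - d n) \<longlonglongrightarrow> 1 - 0" by (intro tendsto_intros d0)
        then have "\<forall>\<^sub>F n in sequentially. y < 1 - d n"
          using y by (intro order_tendstoD(1)) auto
        then show "\<forall>\<^sub>F n in sequentially. g ((1 - d n) * x) < m"
        proof eventually_elim
          case (elim n)
          then show ?case using g_anti[of y "1 - d n"] y d[of n] True by auto
        qed
      qed
    next
      case False
      with x have x1: "0 \<le> x" "x < 1" by auto
      define z where "z = (1 + x) / 2"
      have z: "x < z" "z < 1" using x1 by (auto simp: z_def)
      have lower: "g x \<le> g ((1 - d n) * x)" for n
        using g_anti[of "(1 - d n) * x" x] dx[of x n] x1 by auto
      have upper: "g ((1 - d n) * x) \<le> g x + g x / (z - x) * (x - (1 - d n) * x)" for n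
      proof (cases "x = 0")
        case False
        then have "(1 - d n) * x < x" using d[of n] x1 by simp
        then have "g ((1 - d n) * x) - g x \<le> g x / (z - x) * (x - (1 - d n) * x)"
          using dx[of x n] x1 z g_nonneg[of z]
          by (intro concave_decrease_bound[OF g_concave]) auto
        then show ?thesis by simp
      qed simp
      have "(\<lambda>n. g x + g x / (z - x) * (x - (1 - d n) * x)) \<longlonglongrightarrow> g x + g x / (z - x) * (x - (1 - 0) * x)"
        by (intro tendsto_intros d0)
      then have "(\<lambda>n. g x + g x / (z - x) * (x - (1 - d n) * x)) \<longlonglongrightarrow> g x" by simp
      then have "(\<lambda>n. g ((1 - d n) * x)) \<longlonglongrightarrow> g x"
        by (rule tendsto_sandwich[OF always_eventually always_eventually tendsto_const, rotated 2])
           (use lower upper in auto)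
      then show ?thesis using x1 by (simp add: \<psi>_def)
    qed
  qed
  have "continuous_on {0..1} \<psi>"
    by (rule continuous_on_concave_antimono[OF psi_concave psi_nonneg psi_anti end1])
  then have "\<psi> \<in> classC"
    using psi_nonneg psi_anti psi_concave by (auto simp: classC_def)
  moreover have "(\<lambda>n. \<phi> (k n) x) \<longlonglongrightarrow> \<psi> x" if "0 \<le> x" "x < 1" for x
    using lim[OF that] that by (simp add: \<psi>_def f_def)
  ultimately show ?thesis using that[OF k] by blast
qed

section \<open>Linearity and semicontinuity of the primal functional\<close>

lemma classC_combination:
  assumes "\<phi> \<in> classC" "\<psi> \<in> classC" "0 \<le> a" "0 \<le> b"
  shows "(\<lambda>x. a * \<phi> x + b * \<psi> x) \<in> classC"
proof -
  have "concave_on {0..1} (\<lambda>x. a * \<phi> x + b * \<psi> x)"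
    using assms by (intro concave_on_add concave_on_cmul classC_D(4)) auto
  moreover have "continuous_on {0..1} (\<lambda>x. a * \<phi> x + b * \<psi> x)"
    using assms by (intro continuous_intros classC_D(1))
  moreover have "0 \<le> a * \<phi> x + b * \<psi> x" if "x \<in> {0..1}" for x
    using classC_D(2)[OF assms(1) that] classC_D(2)[OF assms(2) that] assms(3,4) by simp
  moreover have "a * \<phi> y + b * \<psi> y \<le> a * \<phi> x + b * \<psi> x" if "x \<in> {0..1}" "y \<in> {0..1}" "x \<le> y" for x y
    using classC_D(3)[OF assms(1), of x y] classC_D(3)[OF assms(2), of x y] assms(3,4) that
    by (intro add_mono mult_left_mono) auto
  ultimately show ?thesis unfolding classC_def by blast
qed

lemma Plin_combination:
  assumes "is_model \<beta>" "\<phi> \<in> classC" "\<psi> \<in> classC"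
  shows "Plin h \<beta> (\<lambda>x. a * \<phi> x + b * \<psi> x) = a * Plin h \<beta> \<phi> + b * Plin h \<beta> \<psi>"
proof -
  note xi2 = xi2_measure[OF assms(1)]
  have "clamp01 (\<lambda>x. a * \<phi> x + b * \<psi> x) = (\<lambda>x. a * clamp01 \<phi> x + b * clamp01 \<psi> x)"
    by (simp add: clamp01_def fun_eq_iff)
  then show ?thesis
    using clamp01_integrable[OF assms(2) xi2(1,2)] clamp01_integrable[OF assms(3) xi2(1,2)]
    by (simp add: Plin_def algebra_simps)
qed

lemma one_classC: "(\<lambda>_. 1) \<in> classC"
  by (auto simp: classC_def concave_on_const)

lemma Pfun_one_finite:
  assumes "is_model \<beta>" shows "Pfun h \<beta> (\<lambda>_. 1) < \<infinity>"
  by (simp add: Pfun_eq[OF assms one_classC] Pinv_def clamp01_def)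

lemma Plin_limit:
  assumes model: "is_model \<beta>" and C: "\<And>n. \<phi> n \<in> classC" and M: "\<And>n. \<phi> n 0 \<le> M"
    and \<psi>: "\<psi> \<in> classC" "\<And>x. 0 \<le> x \<Longrightarrow> x < 1 \<Longrightarrow> (\<lambda>n. \<phi> n x) \<longlonglongrightarrow> \<psi> x"
  shows "(\<lambda>n. Plin h \<beta> (\<phi> n)) \<longlonglongrightarrow> Plin h \<beta> \<psi>"
  unfolding Plin_def
proof (intro tendsto_add tendsto_mult tendsto_const)
  note xi2 = xi2_measure[OF model]
  note [measurable_cong] = xi2(2)
  interpret finite_measure "xi2_measure \<beta>" by (rule xi2(1))
  have [measurable]: "clamp01 (\<phi> n) \<in> borel_measurable borel" "clamp01 \<psi> \<in> borel_measurable borel" for n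
    using clamp01_measurable classC_D(1) C \<psi>(1) by blast+
  have "AE x in lborel. x \<noteq> (1::real)" by (rule AE_lborel_singleton)
  then have "AE x in xi2_measure \<beta>. x \<noteq> 1"
    unfolding xi2_measure_def using xi2(7) by (subst AE_density) (auto elim!: eventually_mono)
  with xi2(3) have AE: "AE x in xi2_measure \<beta>. 0 \<le> x \<and> x < 1"
    by eventually_elim auto
  show "(\<lambda>n. \<integral>x. clamp01 (\<phi> n) x \<partial>xi2_measure \<beta>) \<longlonglongrightarrow> (\<integral>x. clamp01 \<psi> x \<partial>xi2_measure \<beta>)"
  proof (rule integral_dominated_convergence[where w = "\<lambda>_. M"])
    show "AE x in xi2_measure \<beta>. (\<lambda>n. clamp01 (\<phi> n) x) \<longlonglongrightarrow> clamp01 \<psi> x"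
      by (rule eventually_mono[OF AE]) (use \<psi>(2) in auto)
    show "AE x in xi2_measure \<beta>. norm (clamp01 (\<phi> n) x) \<le> M" for n
      using clamp01_bounds[OF C[of n]] M[of n] by (auto intro: order_trans)
  qed auto
qed (use \<psi>(2)[of 0] in auto)

text \<open>Fatou's lemma; inversion is continuous on \<open>ennreal\<close> even at 0, so points
  where the limit vanishes are covered. The point 1, where convergence may fail, is null.\<close>

lemma Pinv_liminf:
  assumes C: "\<And>n. \<phi> n \<in> classC"
    and \<psi>: "\<psi> \<in> classC" "\<And>x. 0 \<le> x \<Longrightarrow> x < 1 \<Longrightarrow> (\<lambda>n. \<phi> n x) \<longlonglongrightarrow> \<psi> x"
  shows "Pinv \<psi> \<le> liminf (\<lambda>n. Pinv (\<phi> n))"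
proof -
  have [measurable]: "clamp01 (\<phi> n) \<in> borel_measurable borel" "clamp01 \<psi> \<in> borel_measurable borel" for n
    using clamp01_measurable classC_D(1) C \<psi>(1) by blast+
  have "Pinv \<psi> = (\<integral>\<^sup>+x. liminf (\<lambda>n. inverse (ennreal (clamp01 (\<phi> n) x)) * indicator {0..1} x) \<partial>lborel)"
    unfolding Pinv_def
  proof (rule nn_integral_cong_AE, rule eventually_mono[OF AE_lborel_singleton[of 1]])
    fix x :: real assume "x \<noteq> 1"
    show "inverse (ennreal (clamp01 \<psi> x)) * indicator {0..1} x =
        liminf (\<lambda>n. inverse (ennreal (clamp01 (\<phi> n) x)) * indicator {0..1} x)"
    proof (cases "x \<in> {0..1}")
      case True
      then have "(\<lambda>n. clamp01 (\<phi> n) x) \<longlonglongrightarrow> clamp01 \<psi> x" using \<psi>(2)[of x] \<open>x \<noteq> 1\<close> by auto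
      then have *: "(\<lambda>n. ennreal (clamp01 (\<phi> n) x)) \<longlonglongrightarrow> ennreal (clamp01 \<psi> x)" by (rule tendsto_ennrealI)
      have "continuous_on UNIV (inverse :: ennreal \<Rightarrow> ennreal)"
        by (intro continuous_on_inverse_ennreal continuous_on_id)
      from continuous_on_tendsto_compose[OF this *]
      have "(\<lambda>n. inverse (ennreal (clamp01 (\<phi> n) x))) \<longlonglongrightarrow> inverse (ennreal (clamp01 \<psi> x))"
        by simp
      then show ?thesis using True by (simp add: lim_imp_Liminf)
    qed (simp add: Liminf_const)
  qed
  also have "\<dots> \<le> liminf (\<lambda>n. Pinv (\<phi> n))"
    unfolding Pinv_def by (rule nn_integral_liminf) measurable
  finally show ?thesis .
qed

text \<open>The direct method: coercivity bounds a minimizing sequence, selection gives a limit in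
  \<open>classC\<close>, and semicontinuity makes the limit optimal.\<close>

lemma minimizer_exists:
  assumes model: "is_model \<beta>"
  obtains \<phi> where "\<phi> \<in> classC" "Pfun h \<beta> \<phi> < \<infinity>" "\<And>\<psi>. \<psi> \<in> classC \<Longrightarrow> Pfun h \<beta> \<phi> \<le> Pfun h \<beta> \<psi>"
proof -
  define I where "I = (INF \<psi>\<in>classC. Pfun h \<beta> \<psi>)"
  have I_le: "I \<le> Pfun h \<beta> \<psi>" if "\<psi> \<in> classC" for \<psi>
    unfolding I_def using that by (rule INF_lower)
  have "I < \<infinity>" using I_le[OF one_classC] Pfun_one_finite[OF model] by (rule le_less_trans)
  then obtain i where i: "I = ennreal i" "0 \<le> i" by (cases I) auto
  have "\<exists>\<phi>\<in>classC. Pfun h \<beta> \<phi> < ennreal (i + inverse (real (Suc n)))" for n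
  proof -
    have "I < ennreal (i + inverse (real (Suc n)))"
      unfolding i using i(2) by (intro ennreal_lessI) (auto simp: add_nonneg_pos)
    then show ?thesis unfolding I_def by (simp add: INF_less_iff)
  qed
  then obtain \<phi> where C: "\<And>n. \<phi> n \<in> classC"
    and P: "\<And>n. Pfun h \<beta> (\<phi> n) < ennreal (i + inverse (real (Suc n)))" by metis
  have pos: "0 < xi \<beta> 1" using model_derivatives[OF model] by metis
  \<comment> \<open>Bounding \<open>Pinv\<close> by the remaining budget, a convergent real
    sequence, lets its liminf be combined with the limit of \<open>Plin\<close>.\<close>
  have lin_le: "Plin h \<beta> (\<phi> n) \<le> i + inverse (real (Suc n))"
    and inv_le: "Pinv (\<phi> n) \<le> ennreal (i + inverse (real (Suc n)) - Plin h \<beta> (\<phi> n))" for n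
  proof -
    have *: "ennreal (Plin h \<beta> (\<phi> n)) + Pinv (\<phi> n) \<le> ennreal (i + inverse (real (Suc n)))"
      using P[of n] by (simp add: Pfun_eq[OF model C])
    then have "ennreal (Plin h \<beta> (\<phi> n)) \<le> ennreal (i + inverse (real (Suc n)))"
      by (rule order_trans[rotated]) simp
    then show 1: "Plin h \<beta> (\<phi> n) \<le> i + inverse (real (Suc n))"
      using i(2) by (subst (asm) ennreal_le_iff) auto
    have "Pinv (\<phi> n) < top"
      using * by (metis ennreal_add_eq_top ennreal_less_top le_less_trans less_top)
    then obtain b where b: "Pinv (\<phi> n) = ennreal b" "0 \<le> b" by (cases "Pinv (\<phi> n)") auto
    have "Plin h \<beta> (\<phi> n) + b \<le> i + inverse (real (Suc n))"
      using * b i(2) Plin_nonneg[OF C[of n], of h \<beta>]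
      by (simp add: ennreal_plus[symmetric] del: ennreal_plus of_nat_Suc)
    then show "Pinv (\<phi> n) \<le> ennreal (i + inverse (real (Suc n)) - Plin h \<beta> (\<phi> n))"
      unfolding b by (intro ennreal_leI) simp
  qed
  define M where "M = (i + 1) / xi \<beta> 1"
  have M: "\<phi> n 0 \<le> M" for n
  proof -
    have "\<phi> n 0 * xi \<beta> 1 \<le> i + inverse (real (Suc n))"
      using classC_at_0_le_Plin[OF model C[of n]] lin_le[of n] by (rule order_trans)
    also have "\<dots> \<le> i + 1" by (simp add: inverse_eq_divide)
    finally show ?thesis using pos by (simp add: M_def pos_le_divide_eq)
  qed
  obtain k \<psi> where k: "strict_mono k" and \<psi>: "\<psi> \<in> classC"
    "\<And>x. 0 \<le> x \<Longrightarrow> x < 1 \<Longrightarrow> (\<lambda>n. \<phi> (k n) x) \<longlonglongrightarrow> \<psi> x"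
    by (rule classC_bounded_subsequence[of \<phi> M, OF C M]) (rule that)
  have inv0: "(\<lambda>n. inverse (real (Suc (k n)))) \<longlonglongrightarrow> 0"
    using LIMSEQ_subseq_LIMSEQ[OF LIMSEQ_inverse_real_of_nat k] by (simp add: o_def)
  have lin: "(\<lambda>n. Plin h \<beta> (\<phi> (k n))) \<longlonglongrightarrow> Plin h \<beta> \<psi>"
    by (rule Plin_limit[OF model C M \<psi>])
  have bound: "(\<lambda>n. i + inverse (real (Suc (k n))) - Plin h \<beta> (\<phi> (k n))) \<longlonglongrightarrow> i + 0 - Plin h \<beta> \<psi>"
    by (intro tendsto_intros inv0 lin)
  have le_i: "Plin h \<beta> \<psi> \<le> i"
    using LIMSEQ_le_const[OF bound, of 0] lin_le by auto
  have "Pinv \<psi> \<le> liminf (\<lambda>n. Pinv (\<phi> (k n)))"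
    by (rule Pinv_liminf[OF C \<psi>])
  also have "\<dots> \<le> liminf (\<lambda>n. ennreal (i + inverse (real (Suc (k n))) - Plin h \<beta> (\<phi> (k n))))"
    by (rule Liminf_mono) (use inv_le in auto)
  also have "\<dots> = ennreal (i + 0 - Plin h \<beta> \<psi>)"
    by (rule lim_imp_Liminf[OF _ tendsto_ennrealI[OF bound]]) simp
  finally have "Pfun h \<beta> \<psi> \<le> ennreal (Plin h \<beta> \<psi>) + ennreal (i - Plin h \<beta> \<psi>)"
    unfolding Pfun_eq[OF model \<psi>(1)] by (intro add_left_mono) simp
  also have "\<dots> = I"
    using le_i Plin_nonneg[OF \<psi>(1), of h \<beta>] i by (simp add: ennreal_plus[symmetric] del: ennreal_plus)
  finally have le: "Pfun h \<beta> \<psi> \<le> I" .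
  show ?thesis
  proof (rule that[OF \<psi>(1)])
    show "Pfun h \<beta> \<psi> < \<infinity>" using le \<open>I < \<infinity>\<close> by (rule le_less_trans)
    show "Pfun h \<beta> \<psi> \<le> Pfun h \<beta> \<zeta>" if "\<zeta> \<in> classC" for \<zeta>
      using le I_le[OF that] by (rule order_trans)
  qed
qed

section \<open>Strong duality\<close>

text \<open>If \<phi> 0 = 0 then \<phi> vanishes identically and \<open>Pinv\<close> is infinite;
  otherwise the tent below \<phi> is positive before 1. A zero at 1 itself remains possible.\<close>

lemma classC_pos:
  assumes C: "\<phi> \<in> classC" and fin: "Pinv \<phi> < \<infinity>" and x: "0 \<le> x" "x < 1"
  shows "0 < clamp01 \<phi> x"
proof -
  have "0 < \<phi> 0"
  proof (rule ccontr)
    assume "\<not> 0 < \<phi> 0"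
    then have "clamp01 \<phi> x = 0" for x using clamp01_bounds[OF C, of x] by auto
    then have "Pinv \<phi> = (\<integral>\<^sup>+x\<in>{0..1::real}. \<infinity> \<partial>lborel)" by (simp add: Pinv_def)
    also have "\<dots> = \<infinity>" by (subst nn_integral_cmult_indicator) (auto simp: ennreal_top_mult)
    finally show False using fin by simp
  qed
  moreover have "0 < tent 0 x" using x by (auto simp: tent_def)
  ultimately have "0 < \<phi> 0 * tent 0 x" by simp
  with classC_tent_lower[OF C, of x] show ?thesis by linarith
qed

lemma Pinv_eq:
  assumes C: "\<phi> \<in> classC" and fin: "Pinv \<phi> < \<infinity>"
  shows "Pinv \<phi> = (\<integral>\<^sup>+x\<in>{0<..<1}. ennreal (1 / clamp01 \<phi> x) \<partial>lborel)"
  unfolding Pinv_def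
proof (rule nn_integral_cong_AE)
  show "AE x in lborel. inverse (ennreal (clamp01 \<phi> x)) * indicator {0..1} x =
      ennreal (1 / clamp01 \<phi> x) * indicator {0<..<1} x"
    using AE_lborel_singleton[of "0::real"] AE_lborel_singleton[of "1::real"]
  proof eventually_elim
    case (elim x)
    then show ?case
      using classC_pos[OF C fin, of x]
      by (auto simp: inverse_ennreal inverse_eq_divide split: split_indicator)
  qed
qed

lemma Pinv_antimono:
  assumes C: "\<phi> \<in> classC" "\<psi> \<in> classC" and le: "\<And>x. x \<in> {0..1} \<Longrightarrow> \<phi> x \<le> \<psi> x"
  shows "Pinv \<psi> \<le> Pinv \<phi>"
  unfolding Pinv_def
proof (rule nn_integral_mono)
  fix x :: real
  show "inverse (ennreal (clamp01 \<psi> x)) * indicator {0..1} x \<le> inverse (ennreal (clamp01 \<phi> x)) * indicator {0..1} x"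
  proof (cases "x \<in> {0..1} \<and> \<phi> x \<noteq> 0")
    case True
    then have "0 < \<phi> x" "\<phi> x \<le> \<psi> x" using le classC_D(2)[OF C(1), of x] by auto
    then show ?thesis using True by (auto simp: inverse_ennreal intro!: ennreal_leI le_imp_inverse_le)
  qed (auto split: split_indicator)
qed

locale minimizer =
  fixes h :: real and \<beta> :: "nat \<Rightarrow> real" and \<phi> :: "real \<Rightarrow> real"
  assumes model: "is_model \<beta>" and C: "\<phi> \<in> classC" and fin: "Pfun h \<beta> \<phi> < \<infinity>"
    and min: "\<And>\<psi>. \<psi> \<in> classC \<Longrightarrow> Pfun h \<beta> \<phi> \<le> Pfun h \<beta> \<psi>"
begin

lemma Pinv_fin: "Pinv \<phi> < \<infinity>"
  using fin by (simp add: Pfun_eq[OF model C] less_top[symmetric])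

lemma pos: "0 \<le> x \<Longrightarrow> x < 1 \<Longrightarrow> 0 < clamp01 \<phi> x"
  by (rule classC_pos[OF C Pinv_fin])

lemma meas [measurable]: "clamp01 \<phi> \<in> borel_measurable borel"
  by (intro clamp01_measurable classC_D(1)[OF C])

text \<open>First-order condition in the direction \<open>\<psi>\<close>, with the difference quotient written out.\<close>

lemma perturbation:
  assumes D: "\<psi> \<in> classC" and e: "0 < e"
  shows "(\<integral>\<^sup>+x\<in>{0<..<1}. ennreal (clamp01 \<psi> x / (clamp01 \<phi> x * (clamp01 \<phi> x + e * clamp01 \<psi> x))) \<partial>lborel)
    \<le> ennreal (Plin h \<beta> \<psi>)" (is "?J \<le> _")
proof -
  define \<zeta> where "\<zeta> x = 1 * \<phi> x + e * \<psi> x" for x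
  have \<zeta>: "\<zeta> \<in> classC" unfolding \<zeta>_def using C D e by (intro classC_combination) auto
  have [measurable]: "clamp01 \<psi> \<in> borel_measurable borel" "clamp01 \<zeta> \<in> borel_measurable borel"
    using clamp01_measurable classC_D(1) D \<zeta> by blast+
  have cz: "clamp01 \<zeta> x = clamp01 \<phi> x + e * clamp01 \<psi> x" for x
    by (simp add: \<zeta>_def clamp01_def)
  have "Pinv \<zeta> \<le> Pinv \<phi>"
    using e classC_D(2)[OF D] by (intro Pinv_antimono C \<zeta>) (auto simp: \<zeta>_def)
  then have zfin: "Pinv \<zeta> < \<infinity>" using Pinv_fin by (rule le_less_trans)
  \<comment> \<open>The identity 1 / a = 1 / (a + e b) + e b / (a (a + e b)), written as a sum so
    that no subtraction occurs in \<open>ennreal\<close>; the finite \<open>Pinv \<zeta>\<close> is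
    cancelled at the end.\<close>
  have "Pinv \<phi> = (\<integral>\<^sup>+x. ennreal (1 / clamp01 \<zeta> x) * indicator {0<..<1} x +
      ennreal e * (ennreal (clamp01 \<psi> x / (clamp01 \<phi> x * (clamp01 \<phi> x + e * clamp01 \<psi> x))) * indicator {0<..<1} x) \<partial>lborel)"
    unfolding Pinv_eq[OF C Pinv_fin]
  proof (rule nn_integral_cong)
    fix x
    show "ennreal (1 / clamp01 \<phi> x) * indicator {0<..<1} x = ennreal (1 / clamp01 \<zeta> x) * indicator {0<..<1} x +
      ennreal e * (ennreal (clamp01 \<psi> x / (clamp01 \<phi> x * (clamp01 \<phi> x + e * clamp01 \<psi> x))) * indicator {0<..<1} x)"
    proof (cases "x \<in> {0<..<1}")
      case True
      define a b where "a = clamp01 \<phi> x" and "b = clamp01 \<psi> x"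
      have ab: "0 < a" "0 \<le> b" using True pos[of x] clamp01_bounds(1)[OF D, of x] by (auto simp: a_def b_def)
      then have abp: "0 < a + e * b" using e by (simp add: add_pos_nonneg)
      have "1 / a = 1 / (a + e * b) + e * (b / (a * (a + e * b)))"
        using ab abp e by (simp add: divide_simps)
      then have "ennreal (1 / a) = ennreal (1 / (a + e * b)) + ennreal e * ennreal (b / (a * (a + e * b)))"
        using ab abp e by (simp add: ennreal_mult[symmetric] ennreal_plus[symmetric] del: ennreal_plus)
      then show ?thesis using True by (simp add: cz a_def b_def)
    qed simp
  qed
  also have "\<dots> = Pinv \<zeta> + ennreal e * ?J"
    unfolding Pinv_eq[OF \<zeta> zfin] by (subst nn_integral_add) (auto simp: nn_integral_cmult)
  finally have split: "Pinv \<phi> = Pinv \<zeta> + ennreal e * ?J" .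
  have "Pfun h \<beta> \<phi> \<le> Pfun h \<beta> \<zeta>" by (rule min[OF \<zeta>])
  moreover have "Plin h \<beta> \<zeta> = Plin h \<beta> \<phi> + e * Plin h \<beta> \<psi>"
    unfolding \<zeta>_def[abs_def] using Plin_combination[OF model C D, of h 1 e] by simp
  ultimately have "(ennreal (Plin h \<beta> \<phi>) + Pinv \<zeta>) + ennreal e * ?J \<le>
      (ennreal (Plin h \<beta> \<phi>) + Pinv \<zeta>) + ennreal e * ennreal (Plin h \<beta> \<psi>)"
    using e Plin_nonneg[OF C, of h \<beta>] Plin_nonneg[OF D, of h \<beta>]
    by (simp add: Pfun_eq[OF model C] Pfun_eq[OF model \<zeta>] split ennreal_mult add_ac)
  then have "ennreal e * ?J \<le> ennreal e * ennreal (Plin h \<beta> \<psi>)"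
    using zfin by (subst (asm) ennreal_add_left_cancel_le) (auto simp: less_top[symmetric])
  then show ?thesis
    using e by (subst (asm) ennreal_mult_le_mult_iff) auto
qed

text \<open>Fatou's lemma as the step size tends to 0. Finiteness of the integral thus comes out as
  a conclusion, although \<phi> may vanish at 1.\<close>

lemma first_order:
  assumes D: "\<psi> \<in> classC"
  shows "(\<integral>\<^sup>+x\<in>{0<..<1}. ennreal (clamp01 \<psi> x / (clamp01 \<phi> x)\<^sup>2) \<partial>lborel) \<le> ennreal (Plin h \<beta> \<psi>)"
proof -
  define e where "e n = inverse (real (Suc n))" for n
  have e: "0 < e n" for n by (simp add: e_def)
  have e0: "e \<longlonglongrightarrow> 0" unfolding e_def by (rule LIMSEQ_inverse_real_of_nat)
  define J where "J n x = ennreal (clamp01 \<psi> x / (clamp01 \<phi> x * (clamp01 \<phi> x + e n * clamp01 \<psi> x))) * indicator {0<..<1} x" for n x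
  have [measurable]: "clamp01 \<psi> \<in> borel_measurable borel"
    using clamp01_measurable classC_D(1) D by blast
  have "(\<integral>\<^sup>+x\<in>{0<..<1}. ennreal (clamp01 \<psi> x / (clamp01 \<phi> x)\<^sup>2) \<partial>lborel) = (\<integral>\<^sup>+x. liminf (\<lambda>n. J n x) \<partial>lborel)"
  proof (rule nn_integral_cong)
    fix x
    show "ennreal (clamp01 \<psi> x / (clamp01 \<phi> x)\<^sup>2) * indicator {0<..<1} x = liminf (\<lambda>n. J n x)"
    proof (cases "x \<in> {0<..<1}")
      case True
      then have p: "0 < clamp01 \<phi> x" using pos by auto
      have "(\<lambda>n. clamp01 \<psi> x / (clamp01 \<phi> x * (clamp01 \<phi> x + e n * clamp01 \<psi> x)))
          \<longlonglongrightarrow> clamp01 \<psi> x / (clamp01 \<phi> x * (clamp01 \<phi> x + 0 * clamp01 \<psi> x))"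
        using p by (intro tendsto_intros e0) auto
      then have "(\<lambda>n. J n x) \<longlonglongrightarrow> ennreal (clamp01 \<psi> x / (clamp01 \<phi> x)\<^sup>2)"
        using True unfolding J_def by (auto simp: power2_eq_square intro!: tendsto_ennrealI)
      then show ?thesis using True by (simp add: lim_imp_Liminf)
    qed (simp add: J_def Liminf_const)
  qed
  also have "\<dots> \<le> liminf (\<lambda>n. \<integral>\<^sup>+x. J n x \<partial>lborel)"
    by (rule nn_integral_liminf) (unfold J_def, measurable)
  also have "\<dots> \<le> liminf (\<lambda>n. ennreal (Plin h \<beta> \<psi>))"
    by (rule Liminf_mono) (use perturbation[OF D e] in \<open>auto simp: J_def\<close>)
  finally show ?thesis by (simp add: Liminf_const)
qed

section \<open>Construction of the dual maximizer from the minimizer\<close>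

definition \<rho> :: "real measure" where
  "\<rho> = density lborel (\<lambda>x. ennreal (1 / (clamp01 \<phi> x)\<^sup>2) * indicator {0<..<1} x)"

lemma sets_\<rho> [simp, measurable_cong]: "sets \<rho> = sets borel"
  by (simp add: \<rho>_def)

lemma nn_integral_\<rho>:
  assumes D: "\<psi> \<in> classC"
  shows "(\<integral>\<^sup>+x. ennreal (clamp01 \<psi> x) \<partial>\<rho>) \<le> ennreal (Plin h \<beta> \<psi>)"
proof -
  have [measurable]: "clamp01 \<psi> \<in> borel_measurable borel"
    using clamp01_measurable classC_D(1) D by blast
  have "(\<integral>\<^sup>+x. ennreal (clamp01 \<psi> x) \<partial>\<rho>) =
      (\<integral>\<^sup>+x. ennreal (1 / (clamp01 \<phi> x)\<^sup>2) * indicator {0<..<1} x * ennreal (clamp01 \<psi> x) \<partial>lborel)"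
    unfolding \<rho>_def by (subst nn_integral_density) auto
  also have "\<dots> = (\<integral>\<^sup>+x\<in>{0<..<1}. ennreal (clamp01 \<psi> x / (clamp01 \<phi> x)\<^sup>2) \<partial>lborel)"
    using clamp01_bounds(1)[OF D]
    by (intro nn_integral_cong)
       (auto simp: ennreal_mult[symmetric] simp del: clamp01_eq split: split_indicator)
  also have "\<dots> \<le> ennreal (Plin h \<beta> \<psi>)" by (rule first_order[OF D])
  finally show ?thesis .
qed

text \<open>The first-order condition in the direction of the constant 1 bounds the total
  mass.\<close>

lemma finite_\<rho>: "finite_measure \<rho>"
proof
  have "emeasure \<rho> (space \<rho>) = (\<integral>\<^sup>+x. ennreal (clamp01 (\<lambda>_. 1) x) \<partial>\<rho>)"
    by (simp add: clamp01_def)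
  also have "\<dots> \<le> ennreal (Plin h \<beta> (\<lambda>_. 1))" by (rule nn_integral_\<rho>[OF one_classC])
  finally show "emeasure \<rho> (space \<rho>) \<noteq> \<infinity>" by (auto simp: top_unique)
qed

lemma null_\<rho>: "emeasure \<rho> (- {0<..<1}) = 0"
  unfolding \<rho>_def by (subst emeasure_density) (auto simp: nn_integral_0_iff_AE split: split_indicator)

lemma AE_\<rho>: "AE x in \<rho>. x \<in> {0<..<1}"
  using null_\<rho> by (intro AE_I'[of "- {0<..<1}"]) (auto simp: null_sets_def)

text \<open>The first-order condition in the direction of a tent. As the left side is
  \<open>G 1 - G s\<close>, this is the constraint \<xi> s \<le> \<eta> s on the dual
  candidate.\<close>

lemma integral_tent_\<rho>:
  assumes s: "0 \<le> s" "s \<le> 1"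
  shows "(\<integral>x. tent s x \<partial>\<rho>) \<le> xi \<beta> 1 - xi \<beta> s + h\<^sup>2 * (1 - s)"
proof -
  interpret finite_measure \<rho> by (rule finite_\<rho>)
  note T = tent_classC[OF s]
  have clamp: "clamp01 (tent s) = tent s"
    using s by (auto simp: clamp01_def tent_def fun_eq_iff)
  have "ennreal (\<integral>x. tent s x \<partial>\<rho>) = (\<integral>\<^sup>+x. ennreal (tent s x) \<partial>\<rho>)"
    using clamp01_integrable[OF T finite_\<rho>] tent_bounds
    by (intro nn_integral_eq_integral[symmetric]) (auto simp: clamp)
  also have "\<dots> \<le> ennreal (Plin h \<beta> (tent s))"
    using nn_integral_\<rho>[OF T] by (simp add: clamp)
  finally have "(\<integral>x. tent s x \<partial>\<rho>) \<le> Plin h \<beta> (tent s)"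
    using Plin_nonneg[OF T, of h \<beta>] by (simp add: ennreal_le_iff)
  also have "\<dots> = xi \<beta> 1 - xi \<beta> s + h\<^sup>2 * (1 - s)"
    using xi2_measure(5)[OF model s] s by (simp add: Plin_def clamp) (simp add: tent_def)
  finally show ?thesis .
qed

definition G :: "real \<Rightarrow> real" where "G s = (\<integral>x. max 0 (s - x) \<partial>\<rho>)"

lemma integrable_G: "integrable \<rho> (\<lambda>x. max 0 (s - x))"
proof -
  interpret finite_measure \<rho> by (rule finite_\<rho>)
  show ?thesis
    by (rule integrable_const_bound[where B = "\<bar>s\<bar>"]) (auto intro!: eventually_mono[OF AE_\<rho>])
qed

lemma G_0: "G 0 = 0"
  unfolding G_def by (intro integral_eq_zero_AE eventually_mono[OF AE_\<rho>]) auto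

lemma G_convex: "convex_on {0..1} G"
proof (rule convex_onI)
  fix t x y :: real assume t: "0 < t" "t < 1"
  have "G ((1 - t) *\<^sub>R x + t *\<^sub>R y) \<le> (\<integral>z. (1 - t) * max 0 (x - z) + t * max 0 (y - z) \<partial>\<rho>)"
    unfolding G_def
  proof (rule integral_mono)
    fix z
    have "(1 - t) * (x - z) + t * (y - z) \<le> (1 - t) * max 0 (x - z) + t * max 0 (y - z)"
      using t by (intro add_mono mult_left_mono) auto
    moreover have "0 \<le> (1 - t) * max 0 (x - z) + t * max 0 (y - z)" using t by simp
    moreover have "(1 - t) *\<^sub>R x + t *\<^sub>R y - z = (1 - t) * (x - z) + t * (y - z)" by (simp add: algebra_simps)
    ultimately show "max 0 ((1 - t) *\<^sub>R x + t *\<^sub>R y - z) \<le> (1 - t) * max 0 (x - z) + t * max 0 (y - z)"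
      by simp
  qed (use integrable_G in auto)
  also have "\<dots> = (1 - t) * G x + t * G y"
    unfolding G_def using integrable_G by simp
  finally show "G ((1 - t) *\<^sub>R x + t *\<^sub>R y) \<le> (1 - t) * G x + t * G y" .
qed simp

lemma G_continuous: "continuous_on {0..1} G"
proof (rule lipschitz_on_continuous_on[where L = "measure \<rho> UNIV"], rule lipschitz_onI)
  interpret finite_measure \<rho> by (rule finite_\<rho>)
  have sp: "space \<rho> = UNIV" by (simp add: \<rho>_def)
  fix x y :: real
  have "\<bar>G x - G y\<bar> = \<bar>\<integral>z. max 0 (x - z) - max 0 (y - z) \<partial>\<rho>\<bar>"
    unfolding G_def using integrable_G by simp
  also have "\<dots> \<le> (\<integral>z. \<bar>max 0 (x - z) - max 0 (y - z)\<bar> \<partial>\<rho>)"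
    by (rule integral_abs_bound)
  also have "\<dots> \<le> (\<integral>z. \<bar>x - y\<bar> \<partial>\<rho>)"
    using integrable_G by (intro integral_mono) auto
  finally show "dist (G x) (G y) \<le> measure \<rho> UNIV * dist x y"
    by (simp add: dist_real_def sp)
qed simp

text \<open>The quotient max 0 (t - x) / t is at most 1 and vanishes once t < x. Since \<rho> has no
  mass at 0, dominated convergence applies.\<close>

lemma G_right_deriv0: "((\<lambda>t. G t / t) \<longlongrightarrow> 0) (at_right 0)"
  unfolding tendsto_at_iff_sequentially
proof (intro allI impI)
  interpret finite_measure \<rho> by (rule finite_\<rho>)
  fix X :: "nat \<Rightarrow> real" assume X: "\<forall>i. X i \<in> {0<..} - {0}" "X \<longlonglongrightarrow> 0"
  have "(\<lambda>n. \<integral>x. max 0 (X n - x) / X n \<partial>\<rho>) \<longlonglongrightarrow> (\<integral>x. 0 \<partial>\<rho>)"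
  proof (rule integral_dominated_convergence[where w = "\<lambda>_. 1"])
    show "AE x in \<rho>. (\<lambda>n. max 0 (X n - x) / X n) \<longlonglongrightarrow> 0"
    proof (rule eventually_mono[OF AE_\<rho>])
      fix x :: real assume "x \<in> {0<..<1}"
      then have "\<forall>\<^sub>F n in sequentially. X n < x" using X(2) by (auto intro: order_tendstoD)
      then have "\<forall>\<^sub>F n in sequentially. max 0 (X n - x) / X n = 0" by eventually_elim auto
      then show "(\<lambda>n. max 0 (X n - x) / X n) \<longlonglongrightarrow> 0" by (rule tendsto_eventually)
    qed
    show "AE x in \<rho>. norm (max 0 (X n - x) / X n) \<le> 1" for n
      by (rule eventually_mono[OF AE_\<rho>]) (use X(1) in \<open>auto simp: divide_simps\<close>)
  qed auto
  then show "((\<lambda>t. G t / t) \<circ> X) \<longlonglongrightarrow> 0"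
    by (simp add: G_def o_def)
qed

text \<open>The potential \<open>G\<close> supplies the second derivative and has slope 0 at 0; the
  affine part is then forced by the slope \<open>- h\<^sup>2\<close> at 0 and the value \<xi> 1 at
  1.\<close>

definition \<eta> :: "real \<Rightarrow> real" where
  "\<eta> s = xi \<beta> 1 + h\<^sup>2 * (1 - s) - G 1 + G s"

lemma eta_classK: "\<eta> \<in> classK h \<beta>"
proof -
  have "continuous_on {0..1} \<eta>"
    unfolding \<eta>_def[abs_def] by (intro continuous_intros G_continuous)
  moreover have "convex_on {0..1} \<eta>"
  proof -
    have "convex_on {0..1} (\<lambda>s. (xi \<beta> 1 + h\<^sup>2 - G 1) - h\<^sup>2 * s)"
      by (rule convex_onI) (auto simp: algebra_simps)
    from convex_on_add[OF this G_convex] show ?thesis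
      by (rule convex_on_eqI) (simp add: \<eta>_def algebra_simps)
  qed
  moreover have "xi \<beta> s \<le> \<eta> s" if "s \<in> {0..1}" for s
  proof -
    have s: "0 \<le> s" "s \<le> 1" using that by auto
    have "(\<integral>x. tent s x \<partial>\<rho>) = (\<integral>x. max 0 (1 - x) - max 0 (s - x) \<partial>\<rho>)"
      using s by (intro integral_cong_AE eventually_mono[OF AE_\<rho>]) (auto simp: tent_def)
    also have "\<dots> = G 1 - G s" unfolding G_def using integrable_G by simp
    finally show ?thesis using integral_tent_\<rho>[OF s] by (simp add: \<eta>_def)
  qed
  moreover have "has_right_deriv0 \<eta> (deriv (xi \<beta>) 0 - h\<^sup>2)"
  proof -
    have "deriv (xi \<beta>) 0 = 0" using model_derivatives[OF model] by metis
    moreover have "((\<lambda>t. - h\<^sup>2 + G t / t) \<longlongrightarrow> - h\<^sup>2 + 0) (at_right 0)"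
      by (intro tendsto_intros G_right_deriv0)
    moreover have "\<forall>\<^sub>F t in at_right 0. - h\<^sup>2 + G t / t = (\<eta> t - \<eta> 0) / t"
      unfolding eventually_at_right_field
      by (intro exI[of _ 1]) (auto simp: \<eta>_def G_0 field_simps)
    ultimately show ?thesis
      unfolding has_right_deriv0_def using Lim_transform_eventually by fastforce
  qed
  ultimately show ?thesis by (auto simp: classK_def \<eta>_def)
qed

lemma second_deriv_eta: "is_second_deriv_measure \<eta> \<rho>"
proof (rule is_second_deriv_measureI[OF finite_\<rho> sets_\<rho> null_\<rho>])
  show "(\<integral>x. max 0 (t - x) \<partial>\<rho>) = \<eta> t - (xi \<beta> 1 + h\<^sup>2 - G 1) - (- h\<^sup>2) * t" for t
    unfolding G_def[symmetric] by (simp add: \<eta>_def algebra_simps)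
  show "continuous_on {0..1} \<eta>" using eta_classK by (simp add: classK_def)
qed

text \<open>Since \<rho> is absolutely continuous, every version of its density, including the one
  chosen by \<open>ac_density\<close>, is almost everywhere \<open>1 / (\<phi> x)\<^sup>2\<close> on
  the open interval and 0 outside it.\<close>

lemma Dfun_eta: "ennreal (Dfun \<eta>) = 2 * Pinv \<phi>"
proof -
  have sd: "second_deriv_measure \<eta> = \<rho>" by (rule second_deriv_measure_eqI[OF second_deriv_eta])
  define f where "f = ac_density \<eta>"
  have ac: "is_ac_density \<rho> f"
    using is_ac_density_ac_density[of \<eta>] finite_\<rho> by (simp add: sd f_def)
  then obtain N where [measurable]: "f \<in> borel_measurable borel" and N: "N \<in> null_sets lborel"
    and dec: "\<And>A. A \<in> sets borel \<Longrightarrow>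
        emeasure \<rho> A = (\<integral>\<^sup>+ x \<in> A. ennreal (f x) \<partial>lborel) + emeasure \<rho> (A \<inter> N)"
    and f0: "\<And>x. 0 \<le> f x"
    by (auto simp: is_ac_density_def)
  have [measurable]: "N \<in> sets borel" using N by auto
  have "density lborel (\<lambda>x. ennreal (f x)) = \<rho>"
  proof (rule measure_eqI)
    fix A assume "A \<in> sets (density lborel (\<lambda>x. ennreal (f x)))"
    then have [measurable]: "A \<in> sets borel" by simp
    have "A \<inter> N \<in> null_sets lborel" using N by (intro null_set_Int1) auto
    from AE_not_in[OF this] have "emeasure \<rho> (A \<inter> N) = 0"
      unfolding \<rho>_def
      by (subst emeasure_density)
         (auto simp: nn_integral_0_iff_AE simp del: clamp01_eq elim!: eventually_mono)
    then show "emeasure (density lborel (\<lambda>x. ennreal (f x))) A = emeasure \<rho> A"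
      using dec[of A] by (simp add: emeasure_density)
  qed simp
  then have "AE x in lborel. ennreal (f x) = ennreal (1 / (clamp01 \<phi> x)\<^sup>2) * indicator {0<..<1} x"
    unfolding \<rho>_def by (intro sigma_finite_measure.density_unique[OF sigma_finite_lborel]) auto
  then have AE: "AE x in lborel. ennreal (2 * sqrt (f x)) * indicator {0..1} x =
      2 * (ennreal (1 / clamp01 \<phi> x) * indicator {0<..<1} x)"
  proof eventually_elim
    case (elim x)
    show ?case
    proof (cases "x \<in> {0<..<1}")
      case True
      then have p: "0 < clamp01 \<phi> x" using pos by auto
      have "f x = 1 / (clamp01 \<phi> x)\<^sup>2" using elim True f0[of x] by (simp add: ennreal_inj)
      then have "sqrt (f x) = 1 / clamp01 \<phi> x" using p by (simp add: real_sqrt_divide)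
      moreover have "ennreal (2 * (1 / clamp01 \<phi> x)) = 2 * ennreal (1 / clamp01 \<phi> x)"
        using p by (subst ennreal_mult) (auto simp del: clamp01_eq)
      ultimately show ?thesis using True by simp
    next
      case False
      then have "f x = 0" using elim f0[of x] by (simp add: ennreal_eq_0_iff)
      with False show ?thesis by simp
    qed
  qed
  have "ennreal (Dfun \<eta>) = (\<integral>\<^sup>+x\<in>{0..1}. ennreal (2 * sqrt (f x)) \<partial>lborel)"
    unfolding f_def using second_deriv_eta by (intro ennreal_Dfun) (simp add: sd)
  also have "\<dots> = (\<integral>\<^sup>+x. 2 * (ennreal (1 / clamp01 \<phi> x) * indicator {0<..<1} x) \<partial>lborel)"
    by (rule nn_integral_cong_AE[OF AE])
  also have "\<dots> = 2 * Pinv \<phi>"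
    unfolding Pinv_eq[OF C Pinv_fin] by (rule nn_integral_cmult) measurable
  finally show ?thesis .
qed

text \<open>Comparing \<open>\<phi>\<close> with its multiples \<open>t \<phi>\<close>, \<open>t < 1\<close>.\<close>

lemma Plin_le_Pinv: "ennreal (Plin h \<beta> \<phi>) \<le> Pinv \<phi>"
proof -
  obtain B where B: "Pinv \<phi> = ennreal B" "0 \<le> B" using Pinv_fin by (cases "Pinv \<phi>") auto
  define A where "A = Plin h \<beta> \<phi>"
  have A0: "0 \<le> A" unfolding A_def by (rule Plin_nonneg[OF C])
  have scale: "t * A \<le> B" if t: "0 < t" "t < 1" for t
  proof -
    define \<zeta> where "\<zeta> x = t * \<phi> x + 0 * \<phi> x" for x
    have \<zeta>: "\<zeta> \<in> classC" unfolding \<zeta>_def using C t by (intro classC_combination) auto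
    have lin: "Plin h \<beta> \<zeta> = t * A"
      unfolding \<zeta>_def[abs_def] A_def using Plin_combination[OF model C C, of h t 0] by simp
    have "Pinv \<zeta> = (\<integral>\<^sup>+x. ennreal (1 / t) * (inverse (ennreal (clamp01 \<phi> x)) * indicator {0..1} x) \<partial>lborel)"
      unfolding Pinv_def
    proof (rule nn_integral_cong)
      fix x
      have "clamp01 \<zeta> x = t * clamp01 \<phi> x" by (simp add: clamp01_def \<zeta>_def)
      then have "inverse (ennreal (clamp01 \<zeta> x)) = ennreal (1 / t) * inverse (ennreal (clamp01 \<phi> x))"
        using t clamp01_bounds(1)[OF C, of x]
        by (simp add: ennreal_mult ennreal_inverse_mult inverse_ennreal inverse_eq_divide)
      then show "inverse (ennreal (clamp01 \<zeta> x)) * indicator {0..1} x =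
          ennreal (1 / t) * (inverse (ennreal (clamp01 \<phi> x)) * indicator {0..1} x)"
        by (simp add: mult.assoc)
    qed
    also have "\<dots> = ennreal (1 / t) * Pinv \<phi>"
      unfolding Pinv_def by (rule nn_integral_cmult) measurable
    also have "\<dots> = ennreal (B / t)" using B t by (simp add: ennreal_mult[symmetric])
    finally have inv: "Pinv \<zeta> = ennreal (B / t)" .
    have "ennreal (A + B) \<le> ennreal (t * A + B / t)"
      using min[OF \<zeta>] A0 B t
      by (simp add: Pfun_eq[OF model C] Pfun_eq[OF model \<zeta>] lin inv A_def[symmetric])
    then have "A + B \<le> t * A + B / t"
      using A0 B t by (subst (asm) ennreal_le_iff) auto
    \<comment> \<open>After multiplication by \<open>t\<close> the inequality has the common factor
      1 - t; cancelling it leaves t A \<le> B, and then t tends to 1.\<close>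
    then have "t * (A + B) \<le> t * (t * A + B / t)" using t by (intro mult_left_mono) auto
    then have "(1 - t) * (t * A) \<le> (1 - t) * B" using t by (simp add: algebra_simps)
    then show ?thesis using t by simp
  qed
  have "A \<le> B"
  proof (rule tendsto_upperbound)
    show "((\<lambda>t. t * A) \<longlongrightarrow> A) (at_left 1)"
      by (auto intro!: tendsto_eq_intros)
    show "\<forall>\<^sub>F t in at_left 1. t * A \<le> B"
      using eventually_at_left_real[OF zero_less_one] by eventually_elim (use scale in auto)
  qed simp
  then show ?thesis unfolding B A_def[symmetric] by (rule ennreal_leI)
qed

lemma strong_duality: "ennreal (Dfun \<eta>) = Pfun h \<beta> \<phi>"
proof (rule antisym)
  show "ennreal (Dfun \<eta>) \<le> Pfun h \<beta> \<phi>"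
    by (rule weak_duality[OF model eta_classK C])
  have "Pfun h \<beta> \<phi> \<le> Pinv \<phi> + Pinv \<phi>"
    unfolding Pfun_eq[OF model C] by (intro add_right_mono Plin_le_Pinv)
  also have "\<dots> = ennreal (Dfun \<eta>)" by (simp add: Dfun_eta mult_2)
  finally show "Pfun h \<beta> \<phi> \<le> ennreal (Dfun \<eta>)" .
qed

end

lemma dual_attainment:
  assumes "is_model \<beta>" "\<phi> \<in> classC" "Pfun h \<beta> \<phi> < \<infinity>"
    and "\<And>\<psi>. \<psi> \<in> classC \<Longrightarrow> Pfun h \<beta> \<phi> \<le> Pfun h \<beta> \<psi>"
  obtains \<eta> where "\<eta> \<in> classK h \<beta>" "ennreal (Dfun \<eta>) = Pfun h \<beta> \<phi>"
proof -
  interpret minimizer h \<beta> \<phi> by unfold_locales (use assms in auto)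
  show ?thesis by (rule that[OF eta_classK strong_duality])
qed

theorem theorem1p10:
  fixes \<beta> :: "nat \<Rightarrow> real" and h :: real
  assumes "is_model \<beta>" and "0 \<le> h"
  shows "(\<exists>v::real.
           (\<exists>\<phi>\<in>classC. Pfun h \<beta> \<phi> = ennreal v \<and> (\<forall>\<psi>\<in>classC. Pfun h \<beta> \<phi> \<le> Pfun h \<beta> \<psi>)) \<and>
           (\<exists>\<eta>\<in>classK h \<beta>. Dfun \<eta> = v \<and> (\<forall>\<zeta>\<in>classK h \<beta>. Dfun \<zeta> \<le> Dfun \<eta>)))
         \<and> (\<forall>\<phi> \<eta>. \<phi> \<in> classC \<longrightarrow> (\<forall>\<psi>\<in>classC. Pfun h \<beta> \<phi> \<le> Pfun h \<beta> \<psi>) \<longrightarrow>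
           \<eta> \<in> classK h \<beta> \<longrightarrow> (\<forall>\<zeta>\<in>classK h \<beta>. Dfun \<zeta> \<le> Dfun \<eta>) \<longrightarrow>
           (\<forall>A\<in>sets borel. (\<integral>\<^sup>+ x \<in> A. ennreal ((\<phi> x)\<^sup>2) \<partial>second_deriv_measure \<eta>)
                             = emeasure lborel (A \<inter> {0..1})))"
proof -
  obtain \<phi> where C: "\<phi> \<in> classC" and fin: "Pfun h \<beta> \<phi> < \<infinity>"
    and min: "\<And>\<psi>. \<psi> \<in> classC \<Longrightarrow> Pfun h \<beta> \<phi> \<le> Pfun h \<beta> \<psi>"
    using minimizer_exists[OF assms(1)] by metis
  obtain \<eta> where K: "\<eta> \<in> classK h \<beta>" and eq: "ennreal (Dfun \<eta>) = Pfun h \<beta> \<phi>"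
    using dual_attainment[OF assms(1) C fin min] by metis
  \<comment> \<open>Both values are compared through \<open>Pfun h \<beta> \<phi>\<close> in
    \<open>ennreal\<close>, where negative reals become 0; nonnegativity of
    \<open>Dfun \<eta>\<close> lets the inequality return to the reals.\<close>
  have max: "Dfun \<zeta> \<le> Dfun \<eta>" if "\<zeta> \<in> classK h \<beta>" for \<zeta>
    using weak_duality[OF assms(1) that C] Dfun_nonneg[OF assms(1) K]
    by (simp flip: eq)
  show ?thesis
  proof (intro conjI allI impI ballI)
    show "\<exists>v::real.
           (\<exists>\<phi>\<in>classC. Pfun h \<beta> \<phi> = ennreal v \<and> (\<forall>\<psi>\<in>classC. Pfun h \<beta> \<phi> \<le> Pfun h \<beta> \<psi>)) \<and>
           (\<exists>\<eta>\<in>classK h \<beta>. Dfun \<eta> = v \<and> (\<forall>\<zeta>\<in>classK h \<beta>. Dfun \<zeta> \<le> Dfun \<eta>))"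
      using C K eq min max by metis
    fix \<phi>' \<eta>' and A :: "real set"
    assume C': "\<phi>' \<in> classC" and min': "\<forall>\<psi>\<in>classC. Pfun h \<beta> \<phi>' \<le> Pfun h \<beta> \<psi>"
      and K': "\<eta>' \<in> classK h \<beta>" and max': "\<forall>\<zeta>\<in>classK h \<beta>. Dfun \<zeta> \<le> Dfun \<eta>'"
      and A: "A \<in> sets borel"
    \<comment> \<open>Any optimal pair has the same two values as the constructed one, hence no
      duality gap, which is all that \<open>equality_case\<close> asks for.\<close>
    have "Pfun h \<beta> \<phi>' = Pfun h \<beta> \<phi>" using min' C min[OF C'] by (intro antisym) auto
    moreover have "Dfun \<eta>' = Dfun \<eta>" using max' K max[OF K'] by (intro antisym) auto
    ultimately have "Pfun h \<beta> \<phi>' = ennreal (Dfun \<eta>')" using eq by simp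
    then show "(\<integral>\<^sup>+ x \<in> A. ennreal ((\<phi>' x)\<^sup>2) \<partial>second_deriv_measure \<eta>') = emeasure lborel (A \<inter> {0..1})"
      by (rule equality_case[OF assms(1) K' C' _ A])
  qed
qed

end
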